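(* Let $F=F(C_l;PC_{n_1},\dots,PC_{n_l})$ be a polygon flower, where $k^i_1,\dots,k^i_{n_i}$ are the sizes of the polygons of $PC_{n_i}$. Let \[\omega(n_i,k^i_1,\dots,k^i_{n_i})=\sum_{\mu\in M(P_{n_i})}(-1)^{|\mu|}\prod_{v\notin V(\mu)}k^i_v,\] where $P_{n_i}$ is the path with vertices $1,\dots,n_i$, $M(P_{n_i})$ its set of matchings and $V(\mu)$ the vertices covered by $\mu$. For $j\in\{1,\dots,l-2\}$ let \[\Delta_j=\gcd\left(\omega(n_{i_1},k^{i_1}_1,\dots,k^{i_1}_{n_{i_1}})\cdots\omega(n_{i_j},k^{i_j}_1,\dots,k^{i_j}_{n_{i_j}}) : 1\leq i_1<\cdots<i_j\leq l\right).\] Then \[K(F)\cong\mathbb{Z}_{\Delta_1}\oplus\mathbb{Z}_{\Delta_2/\Delta_1}\oplus\cdots\oplus\mathbb{Z}_{\Delta_{l-2}/\Delta_{l-3}}\oplus\mathbb{Z}_{\tau(F)/\Delta_{l-2}}.\]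
   Context: Polygon chain: given integers $k_1,\dots,k_n\geq 2$, $PC_0$ is the path with one edge and, for $1\le i\le n$, $PC_i$ is obtained from $PC_{i-1}$ by adding a path with $k_i-1$ edges between some pair of adjacent vertices of the path added in the construction of $PC_{i-1}$; $PC_n$ is a stack of $n$ polygons with $k_1,\dots,k_n$ sides. Polygon flower: let $C_l=v_1e_1v_2e_2\cdots v_le_lv_1$ be a cycle of length $l$ and $PC_{n_1},\dots,PC_{n_l}$ polygon chains. $F(C_l;PC_{n_1},\dots,PC_{n_l})$ is obtained by identifying, for each $i\in\{1,\dots,l\}$, the edge $e_i$ of $C_l$ with an edge $e'_i$ of $PC_{n_i}$ that lies in the first or the last polygon of $PC_{n_i}$ and in no other polygon of that chain. $K(G)$ is the sandpile group of $G$ (the torsion subgroup of $\mathbb{Z}^{V(G)}/\operatorname{Im}L(G)$, $L(G)$ the Laplacian matrix), $\tau(G)$ is the number of spanning trees of $G$, and $\mathbb{Z}_1$ is the trivial group. *)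

theory Defs
  imports "HOL-Algebra.Product_Groups"
begin

section \<open>Loopless multigraphs\<close>

text \<open>Parallel edges must be allowed, since polygons may have two sides. Every edge of the
  graphs considered here has two distinct ends; the degree in \<open>laplacian\<close> relies on this.\<close>

record ('v, 'e) mgraph =
  verts :: "'v set"
  edges :: "'e set"
  ends  :: "'e \<Rightarrow> 'v set"

text \<open>The path \<open>vs ! 0, es ! 0, vs ! 1, es ! 1, \<dots>\<close> in \<open>G\<close>, without repetitions.\<close>

definition is_path :: "('v, 'e) mgraph \<Rightarrow> 'v list \<Rightarrow> 'e list \<Rightarrow> bool" where
  "is_path G vs es \<longleftrightarrow>
     length vs = Suc (length es) \<and> distinct vs \<and> distinct es \<and>
     set vs \<subseteq> verts G \<and> set es \<subseteq> edges G \<and>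
     (\<forall>i < length es. ends G (es ! i) = {vs ! i, vs ! Suc i})"

definition is_cycle :: "('v, 'e) mgraph \<Rightarrow> 'v list \<Rightarrow> 'e list \<Rightarrow> bool" where
  "is_cycle G vs es \<longleftrightarrow>
     es \<noteq> [] \<and> length vs = length es \<and> distinct vs \<and> distinct es \<and>
     set vs \<subseteq> verts G \<and> set es \<subseteq> edges G \<and>
     (\<forall>i < length es. ends G (es ! i) = {vs ! i, vs ! (Suc i mod length vs)})"

definition is_connected :: "('v, 'e) mgraph \<Rightarrow> bool" where
  "is_connected G \<longleftrightarrow>
     (\<forall>u \<in> verts G. \<forall>v \<in> verts G. (u, v) \<in> {(x, y). \<exists>e \<in> edges G. ends G e = {x, y}}\<^sup>*)"

definition is_tree :: "('v, 'e) mgraph \<Rightarrow> bool" where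
  "is_tree G \<longleftrightarrow> is_connected G \<and> (\<nexists>vs es. is_cycle G vs es)"

text \<open>A spanning tree is given by its edge set.\<close>

definition num_spanning_trees :: "('v, 'e) mgraph \<Rightarrow> nat" where
  "num_spanning_trees G = card {T. T \<subseteq> edges G \<and> is_tree (G\<lparr>edges := T\<rparr>)}"


section \<open>The sandpile group\<close>

definition laplacian :: "('v, 'e) mgraph \<Rightarrow> 'v \<Rightarrow> 'v \<Rightarrow> int" where
  "laplacian G u v =
     (if u = v then int (card {e \<in> edges G. v \<in> ends G e})
      else - int (card {e \<in> edges G. ends G e = {u, v}}))"

definition free_Z :: "'v set \<Rightarrow> ('v \<Rightarrow> int) monoid" where
  "free_Z V = product_group V (\<lambda>_. integer_group)"

definition laplacian_image :: "('v, 'e) mgraph \<Rightarrow> ('v \<Rightarrow> int) set" where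
  "laplacian_image G =
     (\<lambda>x. \<lambda>u \<in> verts G. \<Sum>v \<in> verts G. laplacian G u v * x v) ` carrier (free_Z (verts G))"

definition torsion_subgroup :: "('a, 'b) monoid_scheme \<Rightarrow> ('a, 'b) monoid_scheme" where
  "torsion_subgroup A =
     A\<lparr>carrier := {x \<in> carrier A. \<exists>n::nat. n > 0 \<and> x [^]\<^bsub>A\<^esub> n = \<one>\<^bsub>A\<^esub>}\<rparr>"

definition sandpile_group :: "('v, 'e) mgraph \<Rightarrow> ('v \<Rightarrow> int) set monoid" where
  "sandpile_group G = torsion_subgroup (free_Z (verts G) Mod laplacian_image G)"


section \<open>Polygon chains and polygon flowers\<close>

text \<open>
  \<open>chain_build ks G Ps vs es\<close>: \<open>G\<close> is a polygon chain with polygons of sizes \<open>ks\<close>; the list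
  \<open>Ps\<close> contains the edge sets of these polygons, and \<open>vs\<close>, \<open>es\<close> are the vertices and the edges
  of the path added last. The \<open>i\<close>-th polygon consists of the path added in the \<open>i\<close>-th step and
  of the edge, on the path added before, that joins the ends of the new path. An adjacent pair
  of vertices of a path is a pair of consecutive ones.
\<close>

inductive chain_build ::
  "nat list \<Rightarrow> ('v, 'e) mgraph \<Rightarrow> 'e set list \<Rightarrow> 'v list \<Rightarrow> 'e list \<Rightarrow> bool" where
  chain_base:
    "\<lbrakk>is_path G [u, v] [e]; verts G = {u, v}; edges G = {e}\<rbrakk>
     \<Longrightarrow> chain_build [] G [] [u, v] [e]"
| chain_step:
    "\<lbrakk>chain_build ks G Ps vs es; j < length es; k \<ge> 2;
      is_path H ws fs; length fs = k - 1; hd ws = vs ! j; last ws = vs ! Suc j;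
      verts H = verts G \<union> set ws; verts G \<inter> set ws = {vs ! j, vs ! Suc j};
      edges H = edges G \<union> set fs; edges G \<inter> set fs = {};
      \<forall>e \<in> edges G. ends H e = ends G e\<rbrakk>
     \<Longrightarrow> chain_build (ks @ [k]) H (Ps @ [insert (es ! j) (set fs)]) ws fs"

definition polygon_chain :: "nat list \<Rightarrow> ('v, 'e) mgraph \<Rightarrow> 'e set list \<Rightarrow> bool" where
  "polygon_chain ks G Ps \<longleftrightarrow> (\<exists>vs es. chain_build ks G Ps vs es)"

text \<open>The edge \<open>e\<close> lies in the first or the last of the polygons \<open>Ps\<close>, and in no other one.\<close>

definition free_end_edge :: "'e set list \<Rightarrow> 'e \<Rightarrow> bool" where
  "free_end_edge Ps e \<longleftrightarrow>
     (\<exists>p \<in> {0, length Ps - 1}. p < length Ps \<and> e \<in> Ps ! p \<and>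
        (\<forall>q < length Ps. q \<noteq> p \<longrightarrow> e \<notin> Ps ! q))"

text \<open>
  Let \<open>e\<^sub>i\<close> be the edge of the cycle \<open>v\<^sub>1 e\<^sub>1 v\<^sub>2 \<dots> v\<^sub>l e\<^sub>l v\<^sub>1\<close>. The edge of the chain \<open>PC i\<close> with the ends
  \<open>a i\<close>, \<open>b i\<close> that is to be identified with \<open>e\<^sub>i\<close> is glued such that \<open>a i\<close> becomes \<open>v\<^sub>i\<close> and \<open>b i\<close>
  becomes \<open>v\<^sub>i\<^sub>+\<^sub>1\<close> (both directions are covered, as \<open>a i\<close> and \<open>b i\<close> can be exchanged).
  The vertices of the flower are the \<open>v\<^sub>i = Inl i\<close> and copies \<open>Inr (i, x)\<close> of the other vertices of
  the chains. The edges are the copies \<open>(i, e)\<close> of the edges of the chains: the cycle contributes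
  no further edges because each \<open>e\<^sub>i\<close> is identified with an edge of \<open>PC i\<close>.
\<close>

definition cyc_succ :: "nat \<Rightarrow> nat \<Rightarrow> nat" where
  "cyc_succ l i = (if i = l then 1 else Suc i)"

definition glue :: "nat \<Rightarrow> (nat \<Rightarrow> 'v) \<Rightarrow> (nat \<Rightarrow> 'v) \<Rightarrow> nat \<Rightarrow> 'v \<Rightarrow> nat + nat \<times> 'v" where
  "glue l a b i x =
     (if x = a i then Inl i else if x = b i then Inl (cyc_succ l i) else Inr (i, x))"

definition polygon_flower ::
  "nat \<Rightarrow> (nat \<Rightarrow> ('v, 'e) mgraph) \<Rightarrow> (nat \<Rightarrow> 'v) \<Rightarrow> (nat \<Rightarrow> 'v) \<Rightarrow> (nat + nat \<times> 'v, nat \<times> 'e) mgraph" where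
  "polygon_flower l PC a b =
     \<lparr>verts = (\<Union>i \<in> {1..l}. glue l a b i ` verts (PC i)),
      edges = (SIGMA i : {1..l}. edges (PC i)),
      ends = (\<lambda>(i, e). glue l a b i ` ends (PC i) e)\<rparr>"


section \<open>The numbers \<open>\<omega>\<close> and \<open>\<Delta>\<close>\<close>

definition path_graph_edges :: "nat \<Rightarrow> nat set set" where
  "path_graph_edges n = {{i, Suc i} | i. 1 \<le> i \<and> i < n}"

definition path_matchings :: "nat \<Rightarrow> nat set set set" where
  "path_matchings n = {\<mu>. \<mu> \<subseteq> path_graph_edges n \<and> pairwise disjnt \<mu>}"

text \<open>The list \<open>ks\<close> is indexed from 0, the vertices of the path from 1.\<close>

definition omega :: "nat list \<Rightarrow> int" where
  "omega ks =
     (\<Sum>\<mu> \<in> path_matchings (length ks).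
        (-1) ^ card \<mu> * (\<Prod>v \<in> {1..length ks} - \<Union>\<mu>. int (ks ! (v - 1))))"

text \<open>For chains of polygons, \<open>omega\<close> is positive (all sizes are at least 2), so nothing is cut off by
  \<open>nat\<close>, and \<open>Delta l ks j\<close> divides \<open>Delta l ks (Suc j)\<close> for \<open>j < l\<close>.\<close>

definition Delta :: "nat \<Rightarrow> (nat \<Rightarrow> nat list) \<Rightarrow> nat \<Rightarrow> nat" where
  "Delta l ks j = nat (Gcd {\<Prod>i \<in> I. omega (ks i) | I. I \<subseteq> {1..l} \<and> card I = j})"

end

theory Submission
  imports Defs
begin

text \<open>
  View a polygon chain as an electrical network of unit resistors between the ends of its free edge.
  It arises from a single edge by adding edges in series and in parallel. Let \<open>t\<close> be its number of
  spanning trees and \<open>s\<close> the number of spanning forests with two components that separate the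
  terminals. Then \<open>t = \<omega>\<close>, \<open>s\<close> and \<open>t\<close> are coprime, and there is an integral potential with the
  voltage \<open>s\<close> and the current \<open>t\<close>; up to Laplacians it identifies the vectors of degree 0 on the
  chain with the integers. If \<open>y\<^sub>i\<close> denotes the generator that belongs to the \<open>i\<close>-th chain, then the
  sandpile group of the flower has the relations \<open>t\<^sub>i y\<^sub>i = t\<^sub>j y\<^sub>j\<close> (current is preserved at the vertices of
  the cycle) and \<open>s\<^sub>1 y\<^sub>1 + \<dots> + s\<^sub>l y\<^sub>l = 0\<close> (the voltages around the cycle add up to 0), and the flower has
  \<open>\<Sum>\<^sub>i s\<^sub>i \<Prod>\<^sub>j\<^sub>\<noteq>\<^sub>i t\<^sub>j\<close> spanning trees.

  Two generators with the orders \<open>t\<^sub>i\<close>, \<open>t\<^sub>j\<close> can be replaced by two generators with the orders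
  \<open>gcd t\<^sub>i t\<^sub>j\<close>, \<open>lcm t\<^sub>i t\<^sub>j\<close> such that the \<open>s\<^sub>i\<close> stay coprime to the \<open>t\<^sub>i\<close>. This changes neither the numbers
  \<open>\<Delta>\<^sub>j\<close> nor the number of spanning trees. Once \<open>t\<^sub>1\<close> divides \<open>t\<^sub>2\<close>, \<open>t\<^sub>2\<close> divides \<open>t\<^sub>3\<close> and so on, \<open>\<Delta>\<^sub>j = t\<^sub>1 \<dots> t\<^sub>j\<close>,
  and the last relation, in which \<open>s\<^sub>l\<^sub>-\<^sub>1\<close> is invertible modulo \<open>t\<^sub>l\<^sub>-\<^sub>1\<close>, eliminates one generator.
\<close>


section \<open>Ladder networks and their potentials\<close>

text \<open>The determinantal divisors of the relations mix the weights \<open>s\<close> with the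
  orders \<open>t\<close>, whereas the numbers \<Delta> are made of the \<open>t\<close> alone.
  Hence no minors are compared: unimodular changes of two generators keep the shape of the
  relations, and for a divisibility chain of orders everything can be read off. Coprimality of each
  weight with its order is the invariant behind this; at the start it comes from the networks, whose
  pairs \<open>(s, t)\<close> arise by Euclidean steps. Tree counts and potentials come from two
  inductions over the same networks; the numbers \<open>s\<close>, \<open>t\<close> are what links
  the combinatorial side to the Laplacian. The rules add single edges, not polygons, because the
  free edge may lie in the first polygon. The chain then has to be grown against its direction of
  construction, starting from the last path, and both directions consist of the same elementary
  rules. The rule \<open>swap\<close> lets the series rule act at either terminal.\<close>

inductive ladder_net ::
  "('e \<Rightarrow> 'v set) \<Rightarrow> 'v set \<Rightarrow> 'e set \<Rightarrow> 'v \<Rightarrow> 'v \<Rightarrow> nat \<Rightarrow> nat \<Rightarrow> bool"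
  for en where
  edge: "\<lbrakk>a \<noteq> b; en e = {a, b}\<rbrakk> \<Longrightarrow> ladder_net en {a, b} {e} a b 1 1"
| series: "\<lbrakk>ladder_net en V E a b s t; c \<notin> V; e \<notin> E; en e = {b, c}\<rbrakk>
    \<Longrightarrow> ladder_net en (insert c V) (insert e E) a c (s + t) t"
| parallel: "\<lbrakk>ladder_net en V E a b s t; e \<notin> E; en e = {a, b}\<rbrakk>
    \<Longrightarrow> ladder_net en V (insert e E) a b s (s + t)"
| swap: "ladder_net en V E a b s t \<Longrightarrow> ladder_net en V E b a s t"

lemma ladder_net_terminals:
  assumes "ladder_net en V E a b s t"
  shows "a \<in> V" "b \<in> V" "a \<noteq> b"
  using assms by (induction, auto)

lemma ladder_net_finite:
  assumes "ladder_net en V E a b s t"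
  shows "finite V" "finite E"
  using assms by (induction, auto)

lemma ladder_net_ends:
  assumes "ladder_net en V E a b s t" "e \<in> E"
  shows "card (en e) = 2" "en e \<subseteq> V"
proof -
  have "\<forall>e \<in> E. card (en e) = 2 \<and> en e \<subseteq> V"
    using assms(1) by induction (auto dest: ladder_net_terminals simp: card_insert_if)
  then show "card (en e) = 2" "en e \<subseteq> V"
    using assms(2) by auto
qed

lemma ladder_net_pos:
  assumes "ladder_net en V E a b s t"
  shows "s > 0" "t > 0"
  using assms by (induction, auto)

text \<open>Apart from \<open>swap\<close>, the rules add one entry of \<open>(s, t)\<close> to the
  other, as in the Euclidean algorithm, starting from \<open>(1, 1)\<close>.\<close>

lemma ladder_net_coprime:
  assumes "ladder_net en V E a b s t"
  shows "coprime s t"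
  using assms
proof induction
  case swap
  then show ?case by (simp add: coprime_commute)
qed (simp_all add: coprime_iff_gcd_eq_1)

text \<open>Serves to move a chain into the flower: gluing is injective on each chain
  separately.\<close>

lemma ladder_net_map:
  assumes "ladder_net en V E a b s t" "inj_on f V" "inj_on g E"
    and "\<And>e. e \<in> E \<Longrightarrow> en' (g e) = f ` en e"
  shows "ladder_net en' (f ` V) (g ` E) (f a) (f b) s t"
  using assms
proof induction
  case (edge a b e)
  then show ?case using ladder_net.edge[of "f a" "f b" en' "g e"] by auto
next
  case (series V E a b s t c e)
  have "ladder_net en' (insert (f c) (f ` V)) (insert (g e) (g ` E)) (f a) (f c) (s + t) t"
    using series by (intro ladder_net.series[of _ _ _ _ "f b"]) auto
  then show ?case by simp
next
  case (parallel V E a b s t e)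
  have "ladder_net en' (f ` V) (insert (g e) (g ` E)) (f a) (f b) s (s + t)"
    using parallel by (intro ladder_net.parallel) auto
  then show ?case by simp
next
  case (swap V E a b s t)
  then show ?case by (auto intro: ladder_net.swap)
qed

lemma ladder_net_cong:
  assumes "ladder_net en V E a b s t" "\<And>e. e \<in> E \<Longrightarrow> en' e = en e"
  shows "ladder_net en' V E a b s t"
  using ladder_net_map[of en V E a b s t id id en'] assms by simp


text \<open>An edge with the ends \<open>u\<close>, \<open>w\<close> contributes
  \<open>y u - y w\<close>. As \<open>en e\<close> is an unordered set, this is written as
  \<open>2 * y u - sum y (en e)\<close>, which avoids naming the other end.\<close>

definition lap_op :: "('e \<Rightarrow> 'v set) \<Rightarrow> 'e set \<Rightarrow> ('v \<Rightarrow> int) \<Rightarrow> 'v \<Rightarrow> int" where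
  "lap_op en E y u = (\<Sum>e \<in> E. if u \<in> en e then 2 * y u - sum y (en e) else 0)"

lemma lap_op_insert:
  assumes "finite E" "e \<notin> E" "en e = {p, q}" "p \<noteq> q"
  shows "lap_op en (insert e E) y u =
    lap_op en E y u + (if u = p then y p - y q else if u = q then y q - y p else 0)"
  using assms by (auto simp: lap_op_def)

lemma lap_op_cong:
  assumes "\<forall>e \<in> E. en e \<subseteq> V" "\<And>v. v \<in> V \<Longrightarrow> y v = y' v" "u \<in> V"
  shows "lap_op en E y u = lap_op en E y' u"
proof -
  have "sum y (en e) = sum y' (en e)" if "e \<in> E" for e
    using assms(1,2) that by (intro sum.cong) auto
  then show ?thesis
    unfolding lap_op_def using assms(2,3) by (intro sum.cong) auto
qed

lemma lap_op_outside:
  assumes "\<forall>e \<in> E. en e \<subseteq> V" "u \<notin> V"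
  shows "lap_op en E y u = 0"
  unfolding lap_op_def using assms by (intro sum.neutral) auto

lemma sum_lap_op:
  assumes "finite V" "finite E" "\<forall>e \<in> E. card (en e) = 2 \<and> en e \<subseteq> V"
  shows "(\<Sum>u \<in> V. lap_op en E y u) = 0"
proof -
  have "(\<Sum>u \<in> V. lap_op en E y u) =
      (\<Sum>e \<in> E. \<Sum>u \<in> V. if u \<in> en e then 2 * y u - sum y (en e) else 0)"
    unfolding lap_op_def by (rule sum.swap)
  also have "\<dots> = (\<Sum>e \<in> E. 0)"
  proof (intro sum.cong refl)
    fix e assume e: "e \<in> E"
    then have "V \<inter> {u. u \<in> en e} = en e" using assms(3) by auto
    then have "(\<Sum>u \<in> V. if u \<in> en e then 2 * y u - sum y (en e) else 0) =
        (\<Sum>u \<in> en e. 2 * y u - sum y (en e))"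
      using assms(1) by (simp add: sum.If_cases)
    also have "\<dots> = 0"
      using assms(3) e by (simp add: sum_subtractf sum_distrib_left[symmetric])
    finally show "(\<Sum>u \<in> V. if u \<in> en e then 2 * y u - sum y (en e) else 0) = 0" .
  qed
  finally show ?thesis by simp
qed

lemma sum_two_point:
  fixes h :: "'v \<Rightarrow> int"
  assumes "finite V" "p \<in> V" "q \<in> V" "p \<noteq> q"
  shows "(\<Sum>u \<in> V. h u * (if u = p then d else if u = q then - d else 0)) = (h p - h q) * d"
proof -
  have "(\<Sum>u \<in> V. h u * (if u = p then d else if u = q then - d else 0)) =
      (\<Sum>u \<in> V. (if u = p then h p * d else 0) - (if u = q then h q * d else 0))"
    using assms(4) by (intro sum.cong) auto
  then show ?thesis using assms by (simp add: sum_subtractf left_diff_distrib)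
qed

text \<open>An integral potential with voltage \<open>s\<close> and current \<open>t\<close> between the terminals. By the last
  two clauses it induces an isomorphism from the vectors of degree 0 modulo the Laplacians of the
  vectors that agree on the terminals to the integers.\<close>

definition net_potential ::
  "('e \<Rightarrow> 'v set) \<Rightarrow> 'v set \<Rightarrow> 'e set \<Rightarrow> 'v \<Rightarrow> 'v \<Rightarrow> int \<Rightarrow> int \<Rightarrow> ('v \<Rightarrow> int) \<Rightarrow> bool" where
  "net_potential en V E a b s t h \<longleftrightarrow>
     h a - h b = s \<and> (\<exists>p \<in> V. \<exists>q \<in> V. h p - h q = 1) \<and>
     (\<forall>y. (\<Sum>u \<in> V. h u * lap_op en E y u) = t * (y a - y b)) \<and>
     (\<forall>x z. sum x V = 0 \<longrightarrow> (\<Sum>u \<in> V. h u * x u) = t * z \<longrightarrow>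
        (\<exists>y. (\<forall>u \<in> V. lap_op en E y u = x u) \<and> y a - y b = z))"

text \<open>A series edge has unit resistance and carries the whole current \<open>t\<close>, which
  forces the new value \<open>h b - t\<close>. A parallel edge sees the voltage \<open>s\<close> and
  adds it to the current, so \<open>h\<close> is kept. Exchanging the terminals negates
  \<open>h\<close>. The pair with difference 1 survives from the initial edge.\<close>

lemma ladder_net_potential:
  assumes "ladder_net en V E a b s t"
  shows "\<exists>h. net_potential en V E a b (int s) (int t) h"
  using assms
proof induction
  case (edge a b e)
  let ?h = "\<lambda>u. if u = a then 1 else (0::int)"
  have L: "lap_op en {e} y u = (if u = a then y a - y b else if u = b then y b - y a else 0)" for y u
    using edge by (subst lap_op_insert) (auto simp: lap_op_def)
  have "\<exists>y. (\<forall>u \<in> {a, b}. lap_op en {e} y u = x u) \<and> y a - y b = z"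
    if "sum x {a, b} = 0" "(\<Sum>u \<in> {a, b}. ?h u * x u) = int 1 * z" for x z
    using that edge by (intro exI[of _ "\<lambda>u. if u = a then z else 0"]) (auto simp: L)
  then show ?case
    using edge by (intro exI[of _ ?h]) (auto simp: net_potential_def L)
next
  case (series V E a b s t c e)
  note V = ladder_net_terminals[OF series(1)] ladder_net_finite[OF series(1)]
  obtain h where h: "net_potential en V E a b (int s) (int t) h" using series by blast
  have bc: "b \<noteq> c" "a \<noteq> c" using V series by auto
  note L = lap_op_insert[where en = en and p = b and q = c, OF V(5) series(3,4) bc(1)]
  have sub: "\<forall>e \<in> E. en e \<subseteq> V" using ladder_net_ends[OF series(1)] by auto
  have Lc: "lap_op en E y c = 0" for y
    using lap_op_outside[of E en V c y] sub series by auto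
  let ?h = "h(c := h b - int t)"
  have 1: "?h a - ?h c = int (s + t)"
    using h bc by (simp add: net_potential_def)
  obtain p q where pq: "p \<in> V" "q \<in> V" "h p - h q = 1"
    using h by (auto simp: net_potential_def)
  then have 2: "\<exists>p \<in> insert c V. \<exists>q \<in> insert c V. ?h p - ?h q = 1"
    using series by (intro bexI[of _ p] bexI[of _ q]) auto
  have hV: "(\<Sum>u \<in> V. ?h u * f u) = (\<Sum>u \<in> V. h u * f u)" for f
    using series by (intro sum.cong) auto
  have 3: "(\<Sum>u \<in> insert c V. ?h u * lap_op en (insert e E) y u) = int t * (y a - y c)" for y
  proof -
    have "(\<Sum>u \<in> V. ?h u * lap_op en (insert e E) y u) =
        (\<Sum>u \<in> V. h u * lap_op en E y u + (if u = b then h b * (y b - y c) else 0))"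
      unfolding hV using series bc by (intro sum.cong) (auto simp: L algebra_simps)
    also have "\<dots> = int t * (y a - y b) + h b * (y b - y c)"
      using h V by (simp add: sum.distrib net_potential_def)
    finally show ?thesis
      using V series bc by (simp add: L Lc algebra_simps)
  qed
  have 4: "\<exists>y. (\<forall>u \<in> insert c V. lap_op en (insert e E) y u = x u) \<and> y a - y c = z"
    if x: "sum x (insert c V) = 0" "(\<Sum>u \<in> insert c V. ?h u * x u) = int t * z" for x z
  proof -
    \<comment> \<open>The only edge at \<open>c\<close> must carry the charge \<open>x c\<close>.
      Moving this charge to \<open>b\<close> leaves a problem on the old network, with the voltage
      raised by the drop \<open>x c\<close> along the new edge.\<close>
    let ?x = "\<lambda>u. x u + (if u = b then x c else 0)"
    have "sum ?x V = 0" using x V series by (simp add: sum.distrib)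
    moreover have "(\<Sum>u \<in> V. h u * ?x u) = int t * (z + x c)"
    proof -
      have "(\<Sum>u \<in> V. h u * ?x u) = (\<Sum>u \<in> V. h u * x u + (if u = b then h b * x c else 0))"
        by (intro sum.cong) (auto simp: algebra_simps)
      then have "(\<Sum>u \<in> V. h u * ?x u) = (\<Sum>u \<in> V. h u * x u) + h b * x c"
        using V by (simp add: sum.distrib)
      moreover have "(h b - int t) * x c + (\<Sum>u \<in> V. h u * x u) = int t * z"
        using x(2) V series unfolding hV[symmetric] by simp
      ultimately show ?thesis by (simp add: algebra_simps)
    qed
    ultimately obtain y where y: "\<forall>u \<in> V. lap_op en E y u = ?x u" "y a - y b = z + x c"
      using h unfolding net_potential_def by blast
    let ?y = "y(c := y b + x c)"
    have "lap_op en E ?y u = lap_op en E y u" if "u \<in> V" for u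
      using that sub series by (intro lap_op_cong[of E en V]) auto
    then show ?thesis
      using y V bc Lc[of ?y] series by (intro exI[of _ ?y]) (auto simp: L)
  qed
  show ?case
    using 1 2 3 4 unfolding net_potential_def by blast
next
  case (parallel V E a b s t e)
  note V = ladder_net_terminals[OF parallel(1)] ladder_net_finite[OF parallel(1)]
  obtain h where h: "net_potential en V E a b (int s) (int t) h" using parallel by blast
  let ?d = "\<lambda>d u. if u = a then d else if u = b then - d else (0::int)"
  have L: "lap_op en (insert e E) y u = lap_op en E y u + ?d (y a - y b) u" for y u
    using lap_op_insert[where en = en and p = a and q = b, OF V(5) parallel(2,3) V(3)] by simp
  have d: "(\<Sum>u \<in> V. h u * ?d z u) = int s * z" for z
    using sum_two_point[OF V(4,1,2,3)] h by (simp add: net_potential_def)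
  have d0: "(\<Sum>u \<in> V. ?d z u) = 0" for z
    using sum_two_point[OF V(4,1,2,3), of "\<lambda>_. 1" z] by simp
  have 3: "(\<Sum>u \<in> V. h u * lap_op en (insert e E) y u) = int (s + t) * (y a - y b)" for y
    using h by (simp add: L distrib_left sum.distrib d net_potential_def distrib_right)
  have 4: "\<exists>y. (\<forall>u \<in> V. lap_op en (insert e E) y u = x u) \<and> y a - y b = z"
    if x: "sum x V = 0" "(\<Sum>u \<in> V. h u * x u) = int (s + t) * z" for x z
  proof -
    \<comment> \<open>The voltage \<open>z\<close> fixes the current in the new edge; the old
      network has to supply the rest of \<open>x\<close>.\<close>
    have "sum (\<lambda>u. x u - ?d z u) V = 0" using x d0 by (simp add: sum_subtractf)
    moreover have "(\<Sum>u \<in> V. h u * (x u - ?d z u)) = int t * z"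
      using x by (simp add: right_diff_distrib sum_subtractf d algebra_simps)
    ultimately obtain y where "\<forall>u \<in> V. lap_op en E y u = x u - ?d z u" "y a - y b = z"
      using h unfolding net_potential_def by blast
    then show ?thesis by (intro exI[of _ y]) (auto simp: L)
  qed
  show ?case
    using h 3 4 unfolding net_potential_def by blast
next
  case (swap V E a b s t)
  then obtain h where h: "net_potential en V E a b (int s) (int t) h" by blast
  have 4: "\<exists>y. (\<forall>u \<in> V. lap_op en E y u = x u) \<and> y b - y a = z"
    if x: "sum x V = 0" "(\<Sum>u \<in> V. - h u * x u) = int t * z" for x z
  proof -
    have "(\<Sum>u \<in> V. h u * x u) = int t * (- z)"
      using x by (simp add: sum_negf)
    then obtain y where "\<forall>u \<in> V. lap_op en E y u = x u" "y a - y b = - z"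
      using h x unfolding net_potential_def by blast
    then show ?thesis by (intro exI[of _ y]) auto
  qed
  have "(\<Sum>u \<in> V. - h u * lap_op en E y u) = int t * (y b - y a)" for y
  proof -
    have "(\<Sum>u \<in> V. h u * lap_op en E y u) = int t * (y a - y b)"
      using h unfolding net_potential_def by blast
    then show ?thesis by (simp add: sum_negf algebra_simps)
  qed
  moreover have "\<exists>p \<in> V. \<exists>q \<in> V. - h p - - h q = 1"
  proof -
    obtain p q where "p \<in> V" "q \<in> V" "h p - h q = 1"
      using h by (auto simp: net_potential_def)
    then show ?thesis by (intro bexI[of _ q] bexI[of _ p]) auto
  qed
  ultimately show ?case
    using h 4 by (intro exI[of _ "\<lambda>u. - h u"]) (simp add: net_potential_def)
qed


section \<open>Counting spanning trees\<close>

definition conn :: "('e \<Rightarrow> 'v set) \<Rightarrow> 'e set \<Rightarrow> ('v \<times> 'v) set" where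
  "conn en T = {(x, y). \<exists>e \<in> T. en e = {x, y}}\<^sup>*"

lemma conn_refl [simp]: "(x, x) \<in> conn en T"
  by (simp add: conn_def)

lemma conn_trans: "(x, y) \<in> conn en T \<Longrightarrow> (y, z) \<in> conn en T \<Longrightarrow> (x, z) \<in> conn en T"
  unfolding conn_def by (rule rtrancl_trans)

lemma conn_sym: "(x, y) \<in> conn en T \<Longrightarrow> (y, x) \<in> conn en T"
proof -
  have "sym {(x, y). \<exists>e \<in> T. en e = {x, y}}"
    by (auto simp: sym_def insert_commute)
  then show "(x, y) \<in> conn en T \<Longrightarrow> (y, x) \<in> conn en T"
    unfolding conn_def by (rule symD[OF sym_rtrancl])
qed

lemma conn_mono: "T \<subseteq> T' \<Longrightarrow> (x, y) \<in> conn en T \<Longrightarrow> (x, y) \<in> conn en T'"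
  unfolding conn_def by (rule subsetD[OF rtrancl_mono]) auto

lemma conn_edge: "e \<in> T \<Longrightarrow> en e = {x, y} \<Longrightarrow> (x, y) \<in> conn en T"
  unfolding conn_def by auto

lemma conn_cong: "(\<And>e. e \<in> T \<Longrightarrow> en e = en' e) \<Longrightarrow> conn en T = conn en' T"
  unfolding conn_def by (intro arg_cong[where f = rtrancl]) auto

text \<open>A walk that runs through the new edge repeatedly can be shortened to a single
  passage.\<close>

lemma conn_insert:
  assumes "en e = {p, q}"
  shows "(x, y) \<in> conn en (insert e T) \<longleftrightarrow>
    (x, y) \<in> conn en T \<or> (x, p) \<in> conn en T \<and> (q, y) \<in> conn en T \<or>
    (x, q) \<in> conn en T \<and> (p, y) \<in> conn en T"
    (is "_ \<longleftrightarrow> ?R y")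
proof
  assume "(x, y) \<in> conn en (insert e T)"
  then show "?R y" unfolding conn_def[of en "insert e T"]
  proof (induction rule: rtrancl_induct)
    case (step y z)
    then obtain f where f: "f \<in> insert e T" "en f = {y, z}" by auto
    show ?case
    proof (cases "f = e")
      case True
      then have "y = p \<and> z = q \<or> y = q \<and> z = p" using f assms by (auto simp: doubleton_eq_iff)
      then show ?thesis using step.IH by auto
    next
      case False
      then have "(y, z) \<in> conn en T" using f by (auto intro: conn_edge)
      then have "(w, y) \<in> conn en T \<Longrightarrow> (w, z) \<in> conn en T" for w
        by (rule conn_trans[rotated])
      then show ?thesis using step.IH by blast
    qed
  qed simp
next
  assume R: "?R y"
  have "(p, q) \<in> conn en (insert e T)" "(q, p) \<in> conn en (insert e T)"
    using assms by (auto intro: conn_edge simp: insert_commute)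
  moreover have "(u, v) \<in> conn en (insert e T)" if "(u, v) \<in> conn en T" for u v
    using that by (rule conn_mono[rotated]) auto
  ultimately show "(x, y) \<in> conn en (insert e T)"
    using R conn_trans[of x p en "insert e T" q] conn_trans[of x q en "insert e T" p]
      conn_trans[of x q en "insert e T" y] conn_trans[of x p en "insert e T" y] by blast
qed

lemma conn_in_verts:
  assumes "(x, y) \<in> conn en T" "\<forall>e \<in> T. en e \<subseteq> V"
  shows "x = y \<or> x \<in> V \<and> y \<in> V"
  using assms(1) unfolding conn_def
proof (induction rule: rtrancl_induct)
  case (step y z)
  then have "{y, z} \<subseteq> V" using assms(2) by (smt (verit) case_prodD mem_Collect_eq)
  then show ?case using step by auto
qed simp

text \<open>Acyclicity in the form that every edge is a bridge, which reduces adding an edge to a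
  condition on \<open>conn\<close>. The link to cycles is
  \<open>cycle_iff_not_forest\<close>.\<close>

definition forest :: "('e \<Rightarrow> 'v set) \<Rightarrow> 'e set \<Rightarrow> bool" where
  "forest en T \<longleftrightarrow> (\<forall>e \<in> T. \<forall>x y. en e = {x, y} \<longrightarrow> (x, y) \<notin> conn en (T - {e}))"

lemma forest_empty [simp]: "forest en {}"
  by (simp add: forest_def)

lemma forest_cong: "(\<And>e. e \<in> T \<Longrightarrow> en e = en' e) \<Longrightarrow> forest en T = forest en' T"
proof -
  assume eq: "\<And>e. e \<in> T \<Longrightarrow> en e = en' e"
  then have "conn en (T - {e}) = conn en' (T - {e})" for e by (intro conn_cong) auto
  then show ?thesis unfolding forest_def using eq by simp
qed

text \<open>If an old edge \<open>f\<close> stopped being a bridge, the detour around it would use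
  \<open>e\<close>; closing the detour by \<open>f\<close> would join the ends of \<open>e\<close>
  within \<open>T\<close>.\<close>

lemma forest_insert:
  assumes "e \<notin> T" "en e = {p, q}"
  shows "forest en (insert e T) \<longleftrightarrow> forest en T \<and> (p, q) \<notin> conn en T"
proof
  assume F: "forest en (insert e T)"
  then have "(p, q) \<notin> conn en T"
    using assms unfolding forest_def by auto
  moreover have "(x, y) \<notin> conn en (T - {f})" if "f \<in> T" "en f = {x, y}" for f x y
  proof -
    have "(x, y) \<notin> conn en (insert e T - {f})"
      using F that unfolding forest_def by blast
    then show ?thesis using conn_mono[of "T - {f}" "insert e T - {f}" x y en] by blast
  qed
  ultimately show "forest en T \<and> (p, q) \<notin> conn en T"
    unfolding forest_def by blast
next
  assume R: "forest en T \<and> (p, q) \<notin> conn en T"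
  show "forest en (insert e T)"
    unfolding forest_def
  proof (intro ballI allI impI)
    fix f x y assume f: "f \<in> insert e T" "en f = {x, y}"
    show "(x, y) \<notin> conn en (insert e T - {f})"
    proof (cases "f = e")
      case True
      then have "x = p \<and> y = q \<or> x = q \<and> y = p" using f assms by (auto simp: doubleton_eq_iff)
      then show ?thesis using True assms R by (auto intro: conn_sym)
    next
      case False
      then have fT: "f \<in> T" using f by auto
      have eq: "insert e T - {f} = insert e (T - {f})" using False by auto
      have n: "(x, y) \<notin> conn en (T - {f})" using R f fT unfolding forest_def by blast
      have m: "(u, v) \<in> conn en T" if "(u, v) \<in> conn en (T - {f})" for u v
        using that by (rule conn_mono[rotated]) auto
      have xy: "(x, y) \<in> conn en T" "(y, x) \<in> conn en T"
        using conn_edge[of f T en x y] conn_sym[of x y en T] fT f(2) by blast+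
      show ?thesis
      proof
        assume "(x, y) \<in> conn en (insert e T - {f})"
        then have "(x, p) \<in> conn en T \<and> (q, y) \<in> conn en T \<or>
            (x, q) \<in> conn en T \<and> (p, y) \<in> conn en T"
          unfolding eq conn_insert[of en e p q x y, OF assms(2)] using n m by blast
        then have "(p, q) \<in> conn en T"
        proof
          assume "(x, p) \<in> conn en T \<and> (q, y) \<in> conn en T"
          then show ?thesis using xy(1) conn_trans conn_sym by metis
        next
          assume "(x, q) \<in> conn en T \<and> (p, y) \<in> conn en T"
          then show ?thesis using xy(2) conn_trans by metis
        qed
        then show False using R by blast
      qed
    qed
  qed
qed

section \<open>Spanning trees and separating forests under insertion of an edge\<close>

definition trees :: "('e \<Rightarrow> 'v set) \<Rightarrow> 'v set \<Rightarrow> 'e set \<Rightarrow> 'e set set" where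
  "trees en V E = {T. T \<subseteq> E \<and> forest en T \<and> (\<forall>u \<in> V. \<forall>v \<in> V. (u, v) \<in> conn en T)}"

definition two_forests ::
  "('e \<Rightarrow> 'v set) \<Rightarrow> 'v set \<Rightarrow> 'e set \<Rightarrow> 'v \<Rightarrow> 'v \<Rightarrow> 'e set set" where
  "two_forests en V E a b = {T. T \<subseteq> E \<and> forest en T \<and> (a, b) \<notin> conn en T \<and>
     (\<forall>v \<in> V. (v, a) \<in> conn en T \<or> (v, b) \<in> conn en T)}"

lemma trees_iff:
  assumes "a \<in> V"
  shows "T \<in> trees en V E \<longleftrightarrow> T \<subseteq> E \<and> forest en T \<and> (\<forall>v \<in> V. (v, a) \<in> conn en T)"
proof -
  have "(u, v) \<in> conn en T" if "(u, a) \<in> conn en T" "(v, a) \<in> conn en T" for u v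
    using that(1) conn_sym[OF that(2)] by (rule conn_trans)
  then show ?thesis unfolding trees_def using assms by blast
qed

lemma two_forests_commute: "two_forests en V E a b = two_forests en V E b a"
  unfolding two_forests_def using conn_sym[of a b en] conn_sym[of b a en] by blast

lemma two_forests_same [simp]: "two_forests en V E a a = {}"
  by (simp add: two_forests_def)

lemma trees_cong:
  assumes "\<And>e. e \<in> E \<Longrightarrow> en e = en' e"
  shows "trees en V E = trees en' V E"
proof -
  have "conn en T = conn en' T" "forest en T = forest en' T" if "T \<subseteq> E" for T
    using that assms by (auto intro!: conn_cong forest_cong)
  then show ?thesis unfolding trees_def by auto
qed

lemma two_forests_cong:
  assumes "\<And>e. e \<in> E \<Longrightarrow> en e = en' e"
  shows "two_forests en V E a b = two_forests en' V E a b"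
proof -
  have "conn en T = conn en' T" "forest en T = forest en' T" if "T \<subseteq> E" for T
    using that assms by (auto intro!: conn_cong forest_cong)
  then show ?thesis unfolding two_forests_def by auto
qed

lemma subset_insert_cases:
  assumes "e \<notin> E"
  shows "{T. T \<subseteq> insert e E \<and> P T} =
    {T. T \<subseteq> E \<and> P T} \<union> insert e ` {T. T \<subseteq> E \<and> P (insert e T)}"
proof -
  have "T \<in> insert e ` {T. T \<subseteq> E \<and> P (insert e T)}"
    if "T \<subseteq> insert e E" "P T" "\<not> T \<subseteq> E" for T
  proof (rule image_eqI)
    show "T = insert e (T - {e})" using that by auto
    then show "T - {e} \<in> {T. T \<subseteq> E \<and> P (insert e T)}" using that by auto
  qed
  then show ?thesis by auto
qed

lemma card_subset_insert:
  assumes "e \<notin> E" "finite E"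
  shows "card {T. T \<subseteq> insert e E \<and> P T} =
    card {T. T \<subseteq> E \<and> P T} + card {T. T \<subseteq> E \<and> P (insert e T)}"
proof -
  have fin: "finite {T. T \<subseteq> E \<and> Q T}" for Q
    by (rule finite_subset[of _ "Pow E"]) (use assms in auto)
  have inj: "inj_on (insert e) {T. T \<subseteq> E \<and> P (insert e T)}"
    using assms(1) by (intro inj_onI) (auto dest: insert_ident[THEN iffD1, rotated 2])
  show ?thesis
    unfolding subset_insert_cases[OF assms(1)]
    by (subst card_Un_disjoint) (use assms fin inj in \<open>auto simp: card_image\<close>)
qed

text \<open>A spanning tree that contains the new edge becomes a separating forest without it.\<close>

lemma card_trees_parallel:
  assumes "finite E" "e \<notin> E" "en e = {a, b}" "a \<in> V" "b \<in> V"
  shows "card (trees en V (insert e E)) = card (trees en V E) + card (two_forests en V E a b)"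
proof -
  let ?P = "\<lambda>T. forest en T \<and> (\<forall>v \<in> V. (v, a) \<in> conn en T)"
  have trees: "trees en V E' = {T. T \<subseteq> E' \<and> ?P T}" for E'
    by (intro Set.set_eqI) (simp add: trees_iff[OF assms(4)])
  have "?P (insert e T) \<longleftrightarrow> forest en T \<and> (a, b) \<notin> conn en T \<and>
      (\<forall>v \<in> V. (v, a) \<in> conn en T \<or> (v, b) \<in> conn en T)" if "T \<subseteq> E" for T
  proof -
    have "e \<notin> T" using that assms(2) by blast
    then show ?thesis
      using forest_insert[of e T en a b] conn_insert[of en e a b _ _ T] assms(3) by auto
  qed
  then have "{T. T \<subseteq> E \<and> ?P (insert e T)} = two_forests en V E a b"
    unfolding two_forests_def by blast
  then show ?thesis
    using card_subset_insert[OF assms(2,1), of ?P] unfolding trees by simp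
qed

lemma two_forests_parallel:
  assumes "e \<notin> E" "en e = {a, b}"
  shows "two_forests en V (insert e E) a b = two_forests en V E a b"
proof -
  have "T \<subseteq> E" if "T \<subseteq> insert e E" "(a, b) \<notin> conn en T" for T
    using that assms conn_edge[of e T en a b] by auto
  then show ?thesis unfolding two_forests_def by auto
qed

lemma isolated_conn:
  assumes "\<forall>e \<in> E. en e \<subseteq> V" "c \<notin> V" "T \<subseteq> E"
  shows "(c, v) \<in> conn en T \<longleftrightarrow> v = c" "(v, c) \<in> conn en T \<longleftrightarrow> v = c"
proof -
  have "\<forall>e \<in> T. en e \<subseteq> V" using assms(1,3) by blast
  then show "(c, v) \<in> conn en T \<longleftrightarrow> v = c" "(v, c) \<in> conn en T \<longleftrightarrow> v = c"
    using conn_in_verts[of c v en T V] conn_in_verts[of v c en T V] assms(2) by auto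
qed

lemma trees_isolated:
  assumes "\<forall>e \<in> E. en e \<subseteq> V" "c \<notin> V" "a \<in> V"
  shows "trees en (insert c V) E = {}"
proof -
  have "(a, c) \<notin> conn en T" if "T \<subseteq> E" for T
    using isolated_conn(2)[OF assms(1,2) that, of a] assms(2,3) by auto
  then show ?thesis unfolding trees_def using assms(3) by blast
qed

lemma two_forests_isolated:
  assumes "\<forall>e \<in> E. en e \<subseteq> V" "c \<notin> V" "a \<in> V"
  shows "two_forests en (insert c V) E a c = trees en V E"
proof (rule Set.set_eqI)
  fix T
  have "a \<noteq> c" using assms by auto
  then show "T \<in> two_forests en (insert c V) E a c \<longleftrightarrow> T \<in> trees en V E"
    unfolding two_forests_def trees_iff[OF assms(3)] mem_Collect_eq
    using isolated_conn[OF assms(1,2), of T] assms(2,3) by (cases "T \<subseteq> E") auto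
qed

text \<open>An instance of the parallel rule: before \<open>e\<close> is added, \<open>c\<close> is
  isolated, so there is no spanning tree and the separating forests are the trees on
  \<open>V\<close>.\<close>

lemma card_trees_pendant:
  assumes "finite E" "\<forall>e \<in> E. en e \<subseteq> V" "e \<notin> E" "en e = {b, c}" "b \<in> V" "c \<notin> V"
  shows "card (trees en (insert c V) (insert e E)) = card (trees en V E)"
proof -
  have "card (trees en (insert c V) (insert e E)) =
      card (trees en (insert c V) E) + card (two_forests en (insert c V) E b c)"
    using assms by (intro card_trees_parallel) auto
  then show ?thesis
    using trees_isolated[OF assms(2,6,5)] two_forests_isolated[OF assms(2,6,5)] by simp
qed

text \<open>Without \<open>e\<close>, the vertex \<open>c\<close> is a component of its own and the
  rest is a tree; with \<open>e\<close>, the vertex \<open>c\<close> takes over the role of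
  \<open>b\<close>.\<close>

lemma card_two_forests_pendant:
  assumes "finite E" "\<forall>e \<in> E. en e \<subseteq> V" "e \<notin> E" "en e = {b, c}" "a \<in> V" "b \<in> V" "c \<notin> V"
  shows "card (two_forests en (insert c V) (insert e E) a c) =
    card (two_forests en V E a b) + card (trees en V E)"
proof -
  note iso = isolated_conn[OF assms(2,7)]
  let ?P = "\<lambda>T. forest en T \<and> (a, c) \<notin> conn en T \<and>
     (\<forall>v \<in> insert c V. (v, a) \<in> conn en T \<or> (v, c) \<in> conn en T)"
  have 1: "{T. T \<subseteq> E \<and> ?P T} = trees en V E"
    using two_forests_isolated[OF assms(2,7,5)] by (simp add: two_forests_def)
  have 2: "?P (insert e T) \<longleftrightarrow> forest en T \<and> (a, b) \<notin> conn en T \<and>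
     (\<forall>v \<in> V. (v, a) \<in> conn en T \<or> (v, b) \<in> conn en T)" if T: "T \<subseteq> E" for T
  proof -
    have ne: "e \<notin> T" using T assms(3) by auto
    have "a \<noteq> c" "b \<noteq> c" using assms by auto
    then show ?thesis
      using assms(4-7) iso[OF T] forest_insert[of e T en b c] conn_insert[of en e b c _ _ T] ne by auto
  qed
  have "card (two_forests en (insert c V) (insert e E) a c) =
      card {T. T \<subseteq> E \<and> ?P T} + card {T. T \<subseteq> E \<and> ?P (insert e T)}"
    unfolding two_forests_def by (rule card_subset_insert[OF assms(3,1)])
  also have "{T. T \<subseteq> E \<and> ?P (insert e T)} = two_forests en V E a b"
    unfolding two_forests_def using 2 by blast
  finally show ?thesis using 1 by simp
qed

text \<open>Replacing a network by its defining edge operations moves these one after the other to the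
  rest of the graph.\<close>

lemma card_trees_net:
  assumes "ladder_net en V E a b s t" "finite E0" "\<forall>e \<in> E0. en e \<subseteq> V0"
    "V \<inter> V0 = {a, b}" "E \<inter> E0 = {}"
  shows "card (trees en (V \<union> V0) (E \<union> E0)) =
    s * card (trees en V0 E0) + t * card (two_forests en V0 E0 a b)"
  using assms
proof (induction arbitrary: V0 E0)
  case (edge a b e)
  then have "{a, b} \<union> V0 = V0" by auto
  then show ?case using edge card_trees_parallel[of E0 e en a b V0] by auto
next
  case (series V E a b s t c e)
  note V = ladder_net_terminals[OF series(1)]
  have "b \<noteq> c" using V series by auto
  moreover have "b \<in> V0 \<Longrightarrow> b \<in> {a, c}" using series(8)[symmetric] V by simp
  ultimately have V0: "a \<in> V0" "c \<in> V0" "b \<notin> V0" "e \<notin> E0" using series V by auto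
  \<comment> \<open>The series edge is handed over to the outer graph, where it hangs on
    \<open>c\<close> and has \<open>b\<close> as its pendant end.\<close>
  have eq: "insert c V \<union> V0 = V \<union> insert b V0" "insert e E \<union> E0 = E \<union> insert e E0"
    using V V0 by auto
  have "card (trees en (V \<union> insert b V0) (E \<union> insert e E0)) =
      s * card (trees en (insert b V0) (insert e E0)) +
      t * card (two_forests en (insert b V0) (insert e E0) a b)"
    using series V V0 by (intro series.IH) auto
  also have "card (trees en (insert b V0) (insert e E0)) = card (trees en V0 E0)"
    using series V0 by (intro card_trees_pendant[of _ _ _ _ c]) auto
  also have "card (two_forests en (insert b V0) (insert e E0) a b) =
      card (two_forests en V0 E0 a c) + card (trees en V0 E0)"
    using series V0 by (intro card_two_forests_pendant) auto
  finally show ?case unfolding eq by (simp add: algebra_simps)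
next
  case (parallel V E a b s t e)
  have V0: "a \<in> V0" "b \<in> V0" "e \<notin> E0" using parallel by auto
  have "card (trees en (V \<union> V0) (E \<union> insert e E0)) =
      s * card (trees en V0 (insert e E0)) + t * card (two_forests en V0 (insert e E0) a b)"
    using parallel V0 by (intro parallel.IH) auto
  then show ?case
    using parallel V0 by (simp add: card_trees_parallel two_forests_parallel algebra_simps)
next
  case (swap V E a b s t)
  then have "V \<inter> V0 = {a, b}" by auto
  then show ?case
    using swap.IH[OF swap.prems(1,2) _ swap.prems(4)] two_forests_commute[of en V0 E0 a b] by simp
qed

text \<open>The edge \<open>f\<close> outside of the graph is used to reduce the second equation to the number of
  spanning trees of a graph that contains the network.\<close>

lemma card_trees_attach:
  assumes net: "ladder_net en V E b c s t" and E0: "finite E0" "\<forall>e \<in> E0. en e \<subseteq> V0"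
    and disj: "V \<inter> V0 = {b}" "E \<inter> E0 = {}" and a: "a \<in> V0" and f: "f \<notin> E \<union> E0"
  shows "card (trees en (V \<union> V0) (E \<union> E0)) = t * card (trees en V0 E0)"
    "card (two_forests en (V \<union> V0) (E \<union> E0) a c) =
       s * card (trees en V0 E0) + t * card (two_forests en V0 E0 a b)"
proof -
  note V = ladder_net_terminals[OF net] ladder_net_finite[OF net]
  have b: "b \<in> V0" and c: "c \<notin> V0" and Vc: "V \<inter> insert c V0 = {b, c}" and "a \<noteq> c"
    using disj V a by auto
  have Vun: "V \<union> insert c V0 = V \<union> V0" using V by auto
  have "card (trees en (V \<union> insert c V0) (E \<union> E0)) =
      s * card (trees en (insert c V0) E0) + t * card (two_forests en (insert c V0) E0 b c)"
    using E0 disj Vc by (intro card_trees_net[OF net]) auto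
  then show 1: "card (trees en (V \<union> V0) (E \<union> E0)) = t * card (trees en V0 E0)"
    unfolding Vun trees_isolated[OF E0(2) c a] two_forests_isolated[OF E0(2) c b] by simp
  define en' where "en' = en(f := {a, c})"
  have en': "en' e = en e" if "e \<in> E \<union> E0" for e using that f by (auto simp: en'_def)
  have net': "ladder_net en' V E b c s t"
    by (rule ladder_net_cong[OF net]) (use en' in auto)
  have E0': "\<forall>e \<in> E0. en' e \<subseteq> V0" using E0 en' by auto
  have "card (trees en' (V \<union> insert c V0) (E \<union> insert f E0)) =
      s * card (trees en' (insert c V0) (insert f E0)) +
      t * card (two_forests en' (insert c V0) (insert f E0) b c)"
    using E0 E0' a f disj Vc by (intro card_trees_net[OF net']) (auto simp: en'_def)
  also have "card (trees en' (insert c V0) (insert f E0)) = card (trees en' V0 E0)"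
    using E0 E0' a c f by (intro card_trees_pendant[of _ _ _ _ a]) (auto simp: en'_def)
  also have "card (two_forests en' (insert c V0) (insert f E0) b c) =
      card (two_forests en' V0 E0 b a) + card (trees en' V0 E0)"
    using E0 E0' a b c f by (intro card_two_forests_pendant) (auto simp: en'_def)
  also have "card (trees en' (V \<union> insert c V0) (E \<union> insert f E0)) =
      card (trees en' (V \<union> V0) (E \<union> E0)) + card (two_forests en' (V \<union> V0) (E \<union> E0) a c)"
    unfolding Vun Un_insert_right[of E f E0]
    using V E0 f a by (intro card_trees_parallel) (auto simp: en'_def)
  finally have 2: "card (trees en' (V \<union> V0) (E \<union> E0)) + card (two_forests en' (V \<union> V0) (E \<union> E0) a c)
      = s * card (trees en' V0 E0) +
        t * (card (two_forests en' V0 E0 b a) + card (trees en' V0 E0))" .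
  have cong: "trees en' W D = trees en W D" "two_forests en' W D x y = two_forests en W D x y"
    if "D \<subseteq> E \<union> E0" for W D x y
    using that en' by (intro trees_cong two_forests_cong; blast)+
  show "card (two_forests en (V \<union> V0) (E \<union> E0) a c) =
       s * card (trees en V0 E0) + t * card (two_forests en V0 E0 a b)"
    using 2 1 unfolding cong[OF subset_refl] cong[OF Un_upper2] two_forests_commute[of en V0 E0 b a]
    by (simp add: distrib_left)
qed


section \<open>The numbers \<open>\<omega>\<close>\<close>

lemma path_graph_edges_Suc:
  "path_graph_edges (Suc (Suc n)) = insert {Suc n, Suc (Suc n)} (path_graph_edges (Suc n))"
  unfolding path_graph_edges_def by (auto simp: less_Suc_eq)

lemma path_graph_edges_subset: "x \<in> path_graph_edges n \<Longrightarrow> x \<subseteq> {1..n}"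
  unfolding path_graph_edges_def by auto

lemma path_graph_edges_mono: "m \<le> n \<Longrightarrow> path_graph_edges m \<subseteq> path_graph_edges n"
  unfolding path_graph_edges_def by fastforce

lemma finite_path_graph_edges: "finite (path_graph_edges n)"
  by (rule finite_subset[of _ "Pow {1..n}"]) (use path_graph_edges_subset in auto)

lemma finite_path_matchings: "finite (path_matchings n)"
  by (rule finite_subset[of _ "Pow (path_graph_edges n)"])
    (auto simp: path_matchings_def finite_path_graph_edges)

lemma path_matchings_subset: "\<mu> \<in> path_matchings n \<Longrightarrow> \<Union>\<mu> \<subseteq> {1..n}"
  unfolding path_matchings_def using path_graph_edges_subset by blast

lemma path_matchings_Suc:
  "path_matchings (Suc (Suc n)) =
     path_matchings (Suc n) \<union> insert {Suc n, Suc (Suc n)} ` path_matchings n"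
proof (intro equalityI subsetI)
  let ?e = "{Suc n, Suc (Suc n)}"
  fix \<mu> assume \<mu>: "\<mu> \<in> path_matchings (Suc (Suc n))"
  then have sub: "\<mu> \<subseteq> insert ?e (path_graph_edges (Suc n))" and disj: "pairwise disjnt \<mu>"
    by (auto simp: path_matchings_def path_graph_edges_Suc)
  show "\<mu> \<in> path_matchings (Suc n) \<union> insert ?e ` path_matchings n"
  proof (cases "?e \<in> \<mu>")
    case False
    then show ?thesis using sub disj by (auto simp: path_matchings_def)
  next
    case True
    have "x \<in> path_graph_edges n" if x: "x \<in> \<mu> - {?e}" for x
    proof -
      have "x \<in> path_graph_edges (Suc n)" using x sub by auto
      moreover have "Suc n \<notin> x" using pairwiseD[OF disj _ True, of x] x by (auto simp: disjnt_def)
      ultimately show ?thesis unfolding path_graph_edges_def by (auto simp: less_Suc_eq)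
    qed
    then have "\<mu> - {?e} \<in> path_matchings n"
      using disj by (auto simp: path_matchings_def intro: pairwise_subset)
    moreover have "\<mu> = insert ?e (\<mu> - {?e})" using True by auto
    ultimately show ?thesis by blast
  qed
next
  let ?e = "{Suc n, Suc (Suc n)}"
  fix \<mu> assume "\<mu> \<in> path_matchings (Suc n) \<union> insert ?e ` path_matchings n"
  then show "\<mu> \<in> path_matchings (Suc (Suc n))"
  proof
    assume "\<mu> \<in> path_matchings (Suc n)"
    then show ?thesis by (auto simp: path_matchings_def path_graph_edges_Suc)
  next
    assume "\<mu> \<in> insert ?e ` path_matchings n"
    then obtain \<nu> where \<nu>: "\<nu> \<in> path_matchings n" "\<mu> = insert ?e \<nu>" by auto
    have d: "disjnt x ?e" "disjnt ?e x" if "x \<in> \<nu>" for x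
      using path_matchings_subset[OF \<nu>(1)] that by (auto simp: disjnt_def)
    have "\<mu> \<subseteq> path_graph_edges (Suc (Suc n))"
      using \<nu> path_graph_edges_mono[of n "Suc n"] by (auto simp: path_matchings_def path_graph_edges_Suc)
    moreover have "pairwise disjnt \<mu>"
      using \<nu> d unfolding path_matchings_def by (auto simp: pairwise_insert)
    ultimately show ?thesis by (simp add: path_matchings_def)
  qed
qed

text \<open>The continuant of \<open>w 1, ..., w n\<close>. The weights form a function rather than
  a list, so that all prefixes share them.\<close>

definition matching_sum :: "nat \<Rightarrow> (nat \<Rightarrow> int) \<Rightarrow> int" where
  "matching_sum n w =
     (\<Sum>\<mu> \<in> path_matchings n. (-1) ^ card \<mu> * (\<Prod>v \<in> {1..n} - \<Union>\<mu>. w v))"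

lemma matching_sum_0: "matching_sum 0 w = 1"
proof -
  have "path_matchings 0 = {{}}" by (auto simp: path_matchings_def path_graph_edges_def)
  then show ?thesis by (simp add: matching_sum_def)
qed

lemma matching_sum_1: "matching_sum (Suc 0) w = w 1"
proof -
  have "path_matchings (Suc 0) = {{}}" by (auto simp: path_matchings_def path_graph_edges_def)
  then show ?thesis by (simp add: matching_sum_def)
qed

text \<open>Either the last vertex is unmatched and contributes its weight, or it is matched with
  its predecessor; then both disappear and the sign changes.\<close>

lemma matching_sum_Suc:
  "matching_sum (Suc (Suc n)) w = w (Suc (Suc n)) * matching_sum (Suc n) w - matching_sum n w"
proof -
  let ?e = "{Suc n, Suc (Suc n)}"
  let ?f = "\<lambda>\<mu>. (-1) ^ card \<mu> * (\<Prod>v \<in> {1..Suc (Suc n)} - \<Union>\<mu>. w v)"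
  have e: "?e \<notin> \<mu>" if "\<mu> \<in> path_matchings (Suc n)" for \<mu>
    using path_matchings_subset[OF that] by auto
  have mono: "path_matchings n \<subseteq> path_matchings (Suc n)"
    using path_graph_edges_mono[of n "Suc n"] by (auto simp: path_matchings_def)
  have inj: "inj_on (insert ?e) (path_matchings n)"
  proof (rule inj_onI)
    fix \<mu> \<nu> assume a: "\<mu> \<in> path_matchings n" "\<nu> \<in> path_matchings n" "insert ?e \<mu> = insert ?e \<nu>"
    then have "?e \<notin> \<mu>" "?e \<notin> \<nu>" using mono e by blast+
    then show "\<mu> = \<nu>" using a(3) by (simp add: insert_ident)
  qed
  have "matching_sum (Suc (Suc n)) w =
      sum ?f (path_matchings (Suc n)) + sum ?f (insert ?e ` path_matchings n)"
    unfolding matching_sum_def path_matchings_Suc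
    by (rule sum.union_disjoint) (use finite_path_matchings e in auto)
  also have "sum ?f (path_matchings (Suc n)) = w (Suc (Suc n)) * matching_sum (Suc n) w"
    unfolding matching_sum_def sum_distrib_left
  proof (rule sum.cong[OF refl])
    fix \<mu> assume "\<mu> \<in> path_matchings (Suc n)"
    then have "{1..Suc (Suc n)} - \<Union>\<mu> = insert (Suc (Suc n)) ({1..Suc n} - \<Union>\<mu>)"
      using path_matchings_subset by fastforce
    then show "?f \<mu> = w (Suc (Suc n)) * ((-1) ^ card \<mu> * (\<Prod>v \<in> {1..Suc n} - \<Union>\<mu>. w v))"
      by simp
  qed
  also have "sum ?f (insert ?e ` path_matchings n) = - matching_sum n w"
    unfolding matching_sum_def sum_negf[symmetric] sum.reindex[OF inj] o_def
  proof (rule sum.cong[OF refl])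
    fix \<mu> assume \<mu>: "\<mu> \<in> path_matchings n"
    have "{1..Suc (Suc n)} - \<Union>(insert ?e \<mu>) = {1..n} - \<Union>\<mu>"
      by (auto simp: le_Suc_eq)
    moreover have "finite \<mu>"
      using \<mu> finite_path_graph_edges[of n] finite_subset by (auto simp: path_matchings_def)
    ultimately show "?f (insert ?e \<mu>) = - ((-1) ^ card \<mu> * (\<Prod>v \<in> {1..n} - \<Union>\<mu>. w v))"
      using e[of \<mu>] \<mu> mono by auto
  qed
  finally show ?thesis by simp
qed

lemma matching_sum_cong:
  assumes "\<And>v. v \<in> {1..n} \<Longrightarrow> w v = w' v"
  shows "matching_sum n w = matching_sum n w'"
  unfolding matching_sum_def using assms by (intro sum.cong refl arg_cong2[where f = times] prod.cong) auto

text \<open>The number \<open>\<omega>\<close> of the list without its last element, which is to be read as 0 if there is no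
  last element; this extends the recurrence of the continuants to one-element lists.\<close>

definition omega_pred :: "nat list \<Rightarrow> int" where
  "omega_pred ks = (if ks = [] then 0 else omega (butlast ks))"

lemma omega_Nil [simp]: "omega [] = 1"
  using matching_sum_0 by (simp add: omega_def matching_sum_def)

lemma omega_snoc: "omega (ks @ [k]) = int k * omega ks - omega_pred ks"
proof (cases ks rule: rev_cases)
  case Nil
  have "omega [k] = matching_sum (length [k]) (\<lambda>v. int ([k] ! (v - 1)))"
    unfolding omega_def matching_sum_def by (rule refl)
  then show ?thesis using Nil by (simp add: matching_sum_1 omega_pred_def)
next
  case (snoc js j)
  \<comment> \<open>All lists involved are prefixes of \<open>js @ [j, k]\<close>, so their numbers
    are continuants of one weight function.\<close>
  have om: "omega xs = matching_sum (length xs) (\<lambda>v. int ((js @ [j, k]) ! (v - 1)))"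
    if "xs = take n (js @ [j, k])" for xs n
    unfolding omega_def matching_sum_def[symmetric] that
    by (rule matching_sum_cong) (simp only: length_take nth_take, auto simp: nth_take simp del: take_append)
  have "omega js = matching_sum (length js) (\<lambda>v. int ((js @ [j, k]) ! (v - 1)))"
    by (rule om[of _ "length js"]) simp
  moreover have "omega ks = matching_sum (Suc (length js)) (\<lambda>v. int ((js @ [j, k]) ! (v - 1)))"
    using om[of ks "Suc (length js)"] snoc by simp
  moreover have "omega (ks @ [k]) =
      matching_sum (Suc (Suc (length js))) (\<lambda>v. int ((js @ [j, k]) ! (v - 1)))"
    using om[of "ks @ [k]" "Suc (Suc (length js))"] snoc by simp
  ultimately show ?thesis
    using snoc by (simp add: matching_sum_Suc omega_pred_def nth_append)
qed

lemma omega_pred_snoc [simp]: "omega_pred (ks @ [k]) = omega ks"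
  by (simp add: omega_pred_def)


section \<open>Polygon chains are ladder networks\<close>

lemma ladder_net_extend:
  assumes "ladder_net en V E a (q 0) s t" "inj_on q {..d}" "V \<inter> q ` {1..d} = {}"
    "inj_on g {..<d}" "E \<inter> g ` {..<d} = {}" "\<forall>i < d. en (g i) = {q i, q (Suc i)}"
  shows "ladder_net en (V \<union> q ` {..d}) (E \<union> g ` {..<d}) a (q d) (s + d * t) t"
  using assms
proof (induction d)
  case 0
  then have "V \<union> q ` {..0} = V" using ladder_net_terminals(2)[OF assms(1)] by auto
  then show ?case using 0 by simp
next
  case (Suc d)
  have "ladder_net en (V \<union> q ` {..d}) (E \<union> g ` {..<d}) a (q d) (s + d * t) t"
  proof (rule Suc.IH)
    show "inj_on q {..d}" by (rule inj_on_subset[OF Suc.prems(2)]) auto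
    show "inj_on g {..<d}" by (rule inj_on_subset[OF Suc.prems(4)]) auto
    have "q ` {1..d} \<subseteq> q ` {1..Suc d}" by auto
    then show "V \<inter> q ` {1..d} = {}" using Suc.prems(3) by blast
  qed (use Suc.prems in auto)
  moreover have "q (Suc d) \<notin> V \<union> q ` {..d}"
    using inj_on_eq_iff[OF Suc.prems(2)] Suc.prems(3) by auto
  moreover have "g d \<notin> E \<union> g ` {..<d}"
    using inj_on_eq_iff[OF Suc.prems(4)] Suc.prems(5) by auto
  ultimately have "ladder_net en (insert (q (Suc d)) (V \<union> q ` {..d}))
      (insert (g d) (E \<union> g ` {..<d})) a (q (Suc d)) (s + d * t + t) t"
    using Suc.prems(6) by (intro ladder_net.series) auto
  then show ?case by (simp add: atMost_Suc lessThan_Suc algebra_simps)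
qed

text \<open>The network takes the place of the edge \<open>f m\<close>. Series edges are added at
  the second terminal only, so the part of the path behind \<open>m\<close> comes first and, after a
  swap, the part before \<open>m\<close> is added backwards.\<close>

lemma ladder_net_path:
  assumes net: "ladder_net en V E (p m) (p (Suc m)) s t" and m: "m < r"
    and p: "inj_on p {..r}" and f: "inj_on f {..<r}"
    and en: "\<forall>i < r. i \<noteq> m \<longrightarrow> en (f i) = {p i, p (Suc i)}"
    and V: "V \<inter> p ` {..r} = {p m, p (Suc m)}" and E: "E \<inter> f ` ({..<r} - {m}) = {}"
  shows "ladder_net en (V \<union> p ` {..r}) (E \<union> f ` ({..<r} - {m})) (p 0) (p r) (s + (r - 1) * t) t"
proof -
  note peq = inj_on_eq_iff[OF p] and feq = inj_on_eq_iff[OF f]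
  have notV: "p i \<notin> V" if "i \<le> r" "i \<noteq> m" "i \<noteq> Suc m" for i
  proof
    assume "p i \<in> V"
    then have "p i \<in> {p m, p (Suc m)}" using V that(1) by blast
    then show False using peq that m by auto
  qed
  let ?d = "r - Suc m"
  let ?V = "V \<union> (\<lambda>i. p (Suc m + i)) ` {..?d}" and ?E = "E \<union> (\<lambda>i. f (Suc m + i)) ` {..<?d}"
  have 1: "ladder_net en ?V ?E (p m) (p (Suc m + ?d)) (s + ?d * t) t"
  proof (rule ladder_net_extend)
    show "inj_on (\<lambda>i. p (Suc m + i)) {..?d}" "inj_on (\<lambda>i. f (Suc m + i)) {..<?d}"
      using m by (auto simp: inj_on_def peq feq)
    show "V \<inter> (\<lambda>i. p (Suc m + i)) ` {1..?d} = {}" using notV m by auto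
    show "E \<inter> (\<lambda>i. f (Suc m + i)) ` {..<?d} = {}" using E m by auto
  qed (use net en m in auto)
  \<comment> \<open>The vertices from \<open>p m\<close> down to \<open>p 0\<close> and the edges
    between them, in reverse order.\<close>
  let ?q = "\<lambda>i. p (m - i)" and ?g = "\<lambda>i. f (m - Suc i)"
  have "ladder_net en (?V \<union> ?q ` {..m}) (?E \<union> ?g ` {..<m})
      (p (Suc m + ?d)) (?q m) (s + ?d * t + m * t) t"
  proof (rule ladder_net_extend)
    show "ladder_net en ?V ?E (p (Suc m + ?d)) (?q 0) (s + ?d * t) t"
      using ladder_net.swap[OF 1] by simp
    show "inj_on ?g {..<m}" "inj_on ?q {..m}" using m by (auto simp: inj_on_def peq feq)
    have "p (m - i) \<noteq> p (Suc m + j)" if "1 \<le> i" "j \<le> ?d" for i j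
      using peq that m by auto
    then show "?V \<inter> ?q ` {1..m} = {}" using notV m by auto
    have "f (m - Suc i) \<noteq> f (Suc m + j)" if "i < m" "j < ?d" for i j
      using feq that m by auto
    moreover have "f (m - Suc i) \<in> f ` ({..<r} - {m})" if "i < m" for i
      using that m by (intro imageI) auto
    then have "f (m - Suc i) \<notin> E" if "i < m" for i using E that by blast
    ultimately show "?E \<inter> ?g ` {..<m} = {}" by auto
    show "\<forall>i < m. en (?g i) = {?q i, ?q (Suc i)}"
    proof (intro allI impI)
      fix i assume "i < m"
      then have "Suc (m - Suc i) = m - i" by simp
      then show "en (?g i) = {?q i, ?q (Suc i)}" using en m \<open>i < m\<close> by (auto simp: insert_commute)
    qed
  qed
  moreover have "?V \<union> ?q ` {..m} = V \<union> p ` {..r}"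
  proof -
    have "{..r} = (\<lambda>i. Suc m + i) ` {..?d} \<union> (\<lambda>i. m - i) ` {..m}"
    proof (intro equalityI subsetI)
      fix i assume i: "i \<in> {..r}"
      show "i \<in> (\<lambda>i. Suc m + i) ` {..?d} \<union> (\<lambda>i. m - i) ` {..m}"
      proof (cases "i \<le> m")
        case True
        then show ?thesis by (intro UnI2 image_eqI[of _ _ "m - i"]) auto
      next
        case False
        then show ?thesis using i by (intro UnI1 image_eqI[of _ _ "i - Suc m"]) auto
      qed
    qed (use m in auto)
    then show ?thesis by (simp add: image_Un image_image Un_assoc)
  qed
  moreover have "?E \<union> ?g ` {..<m} = E \<union> f ` ({..<r} - {m})"
  proof -
    have "{..<r} - {m} = (\<lambda>i. Suc m + i) ` {..<?d} \<union> (\<lambda>i. m - Suc i) ` {..<m}"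
    proof (intro equalityI subsetI)
      fix i assume i: "i \<in> {..<r} - {m}"
      show "i \<in> (\<lambda>i. Suc m + i) ` {..<?d} \<union> (\<lambda>i. m - Suc i) ` {..<m}"
      proof (cases "i < m")
        case True
        then show ?thesis by (intro UnI2 image_eqI[of _ _ "m - Suc i"]) auto
      next
        case False
        then show ?thesis using i by (intro UnI1 image_eqI[of _ _ "i - Suc m"]) auto
      qed
    qed (use m in auto)
    then show ?thesis by (simp add: image_Un image_image Un_assoc)
  qed
  moreover have "s + ?d * t + m * t = s + (r - 1) * t"
    using m by (auto dest!: less_imp_Suc_add simp: algebra_simps)
  ultimately have "ladder_net en (V \<union> p ` {..r}) (E \<union> f ` ({..<r} - {m})) (p r) (p 0) (s + (r - 1) * t) t"
    using m by simp
  then show ?thesis by (rule ladder_net.swap)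
qed

lemma bij_betw_rotate:
  fixes k c :: nat
  assumes "k > 0"
  shows "bij_betw (\<lambda>i. (c + i) mod k) {..<k} {..<k}"
proof -
  have "inj_on (\<lambda>i. (c + i) mod k) {..<k}"
  proof (rule inj_onI)
    fix i j assume ij: "i \<in> {..<k}" "j \<in> {..<k}" "(c + i) mod k = (c + j) mod k"
    then obtain q q' where "c + i + k * q = c + j + k * q'"
      unfolding nat_mod_eq_iff by blast
    then have "i + k * q = j + k * q'" by simp
    then have "(i + k * q) mod k = (j + k * q') mod k" by simp
    then show "i = j" using ij by simp
  qed
  moreover from this have "(\<lambda>i. (c + i) mod k) ` {..<k} = {..<k}"
    using assms by (intro endo_inj_surj) auto
  ultimately show ?thesis by (simp add: bij_betw_def)
qed

text \<open>Deleting the edge \<open>f r\<close> of the polygon leaves a path that contains the network.\<close>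

lemma ladder_net_polygon:
  assumes net: "ladder_net en V E (p m) (p (Suc m mod k)) s t"
    and mr: "m < k" "r < k" "r \<noteq> m"
    and p: "inj_on p {..<k}" and f: "inj_on f {..<k}"
    and en: "\<forall>i < k. i \<noteq> m \<longrightarrow> en (f i) = {p i, p (Suc i mod k)}"
    and V: "V \<inter> p ` {..<k} = {p m, p (Suc m mod k)}" and E: "E \<inter> f ` ({..<k} - {m}) = {}"
  shows "ladder_net en (V \<union> p ` {..<k}) (E \<union> f ` ({..<k} - {m})) (p r) (p (Suc r mod k))
    (s + (k - 2) * t) (s + (k - 1) * t)"
proof -
  have k: "k \<ge> 2" using mr by linarith
  \<comment> \<open>The rotation makes the edge \<open>f r\<close> the last one: the remaining path
    starts at the vertex \<open>Suc r mod k\<close> and ends at \<open>r\<close>.\<close>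
  define \<rho> where "\<rho> i = (Suc r + i) mod k" for i
  have \<rho>: "bij_betw \<rho> {..<k} {..<k}"
    unfolding \<rho>_def using k by (intro bij_betw_rotate) simp
  have \<rho>k: "\<rho> (k - 1) = r" using mr k by (simp add: \<rho>_def)
  have \<rho>Suc: "\<rho> (Suc i) = Suc (\<rho> i) mod k" for i by (simp add: \<rho>_def mod_Suc_eq)
  have \<rho>less: "\<rho> i < k" for i using k by (simp add: \<rho>_def)
  obtain n where n: "n < k" "\<rho> n = m"
    using \<rho> mr unfolding bij_betw_def by (metis image_iff lessThan_iff)
  have inj: "\<rho> i = \<rho> j \<longleftrightarrow> i = j" if "i < k" "j < k" for i j
    using \<rho> that unfolding bij_betw_def by (metis inj_on_eq_iff lessThan_iff)
  have "n \<noteq> k - 1" using n \<rho>k mr by auto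
  then have nk: "n < k - 1" using n by linarith
  have atM: "{..k - 1} = {..<k}" using k by auto
  have im: "\<rho> ` ({..<k - 1} - {n}) = {..<k} - {m, r}"
  proof -
    have "\<rho> ` ({..<k} - {n, k - 1}) = \<rho> ` {..<k} - \<rho> ` {n, k - 1}"
      using \<rho> n by (intro inj_on_image_set_diff[of _ "{..<k}"]) (auto simp: bij_betw_def)
    also have "{..<k} - {n, k - 1} = {..<k - 1} - {n}" by auto
    finally show ?thesis using \<rho> n \<rho>k by (simp add: bij_betw_def)
  qed
  have pim: "(\<lambda>i. p (\<rho> i)) ` {..k - 1} = p ` {..<k}"
    unfolding atM using \<rho> by (auto simp: bij_betw_def image_image[symmetric])
  have fim: "(\<lambda>i. f (\<rho> i)) ` ({..<k - 1} - {n}) = f ` ({..<k} - {m, r})"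
    unfolding im[symmetric] by (simp add: image_image)
  have "ladder_net en (V \<union> (\<lambda>i. p (\<rho> i)) ` {..k - 1}) (E \<union> (\<lambda>i. f (\<rho> i)) ` ({..<k - 1} - {n}))
      (p (\<rho> 0)) (p (\<rho> (k - 1))) (s + (k - 1 - 1) * t) t"
  proof (rule ladder_net_path[OF _ nk])
    show "ladder_net en V E (p (\<rho> n)) (p (\<rho> (Suc n))) s t" using net n \<rho>Suc by simp
    show "inj_on (\<lambda>i. p (\<rho> i)) {..k - 1}" "inj_on (\<lambda>i. f (\<rho> i)) {..<k - 1}"
      using inj \<rho>less k unfolding atM
      by (auto simp: inj_on_def inj_on_eq_iff[OF p] inj_on_eq_iff[OF f])
    show "\<forall>i < k - 1. i \<noteq> n \<longrightarrow> en (f (\<rho> i)) = {p (\<rho> i), p (\<rho> (Suc i))}"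
      using en inj n \<rho>less \<rho>Suc by (metis less_imp_diff_less less_trans nat_neq_iff order_less_le_trans diff_le_self)
    show "V \<inter> (\<lambda>i. p (\<rho> i)) ` {..k - 1} = {p (\<rho> n), p (\<rho> (Suc n))}"
      unfolding pim V using n \<rho>Suc by simp
    show "E \<inter> (\<lambda>i. f (\<rho> i)) ` ({..<k - 1} - {n}) = {}"
      unfolding fim using E by auto
  qed
  then have 1: "ladder_net en (V \<union> p ` {..<k}) (E \<union> f ` ({..<k} - {m, r}))
      (p (Suc r mod k)) (p r) (s + (k - 2) * t) t"
    unfolding pim fim \<rho>k using k by (simp add: \<rho>_def numeral_2_eq_2)
  \<comment> \<open>Of the \<open>k - 1\<close> edges of the path, one is the network, hence the
    resistance numerator \<open>s + (k - 2) * t\<close>. Putting \<open>f r\<close> back in parallel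
    adds this number to \<open>t\<close>.\<close>
  have "f r \<notin> E \<union> f ` ({..<k} - {m, r})"
    using E f mr by (auto simp: inj_on_def)
  then have "ladder_net en (V \<union> p ` {..<k}) (insert (f r) (E \<union> f ` ({..<k} - {m, r})))
      (p (Suc r mod k)) (p r) (s + (k - 2) * t) (s + (k - 2) * t + t)"
    using en mr by (intro ladder_net.parallel[OF 1]) (auto simp: insert_commute)
  moreover have "insert (f r) (E \<union> f ` ({..<k} - {m, r})) = E \<union> f ` ({..<k} - {m})"
    using mr by auto
  moreover have "s + (k - 2) * t + t = s + (k - 1) * t"
  proof -
    have "k - 1 = Suc (k - 2)" using k by simp
    then show ?thesis by simp
  qed
  ultimately show ?thesis by (simp add: ladder_net.swap)
qed


section \<open>Networks along the construction of a polygon chain\<close>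

lemma disjoint_imageI: "(\<And>n. n \<in> B \<Longrightarrow> f n \<notin> A) \<Longrightarrow> A \<inter> f ` B = {}"
  by auto

lemma ladder_net_doubleton:
  assumes "ladder_net en V E c d s t" "{a, b} = {c, d}"
  shows "ladder_net en V E a b s t"
  using assms ladder_net.swap[OF assms(1)] by (auto simp: doubleton_eq_iff)

lemma chain_build_shape:
  assumes "chain_build ks G Ps vs es"
  shows "is_path G vs es" "es \<noteq> []" "length ks = length Ps" "Ps \<noteq> [] \<Longrightarrow> set es \<subseteq> last Ps"
    "ks = [] \<Longrightarrow> verts G = set vs \<and> edges G = set es \<and> length es = 1"
  using assms by (induction) (auto simp: is_path_def)

lemma chain_build_single:
  assumes "chain_build ks G Ps vs es" "ks = []"
  shows "set vs = {vs ! 0, vs ! Suc 0} \<and> set es = {es ! 0}"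
  using assms by cases auto

text \<open>The polygon that is added in a step, as a cycle of \<open>k\<close> vertices and edges whose last edge
  is the one of the preceding polygon.\<close>

locale chain_polygon =
  fixes ks G Ps vs es j k and H :: "('v, 'e) mgraph" and ws fs en p f
  assumes G: "chain_build ks G Ps vs es" and j: "j < length es" and k: "k \<ge> 2"
    and path: "is_path H ws fs" and len: "length fs = k - 1"
    and hd: "hd ws = vs ! j" and last: "last ws = vs ! Suc j"
    and vH: "verts H = verts G \<union> set ws" and vG: "verts G \<inter> set ws = {vs ! j, vs ! Suc j}"
    and eH: "edges H = edges G \<union> set fs" and eG: "edges G \<inter> set fs = {}"
    and endsH: "\<forall>e \<in> edges G. ends H e = ends G e"
    and enH: "\<forall>e \<in> edges H. en e = ends H e"
    and p_def: "p = (\<lambda>i. ws ! i)" and f_def: "f = (\<lambda>i. if i < k - 1 then fs ! i else es ! j)"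
begin

lemma enG: "\<forall>e \<in> edges G. en e = ends G e"
  using enH eH endsH by auto

lemma len_ws: "length ws = k"
  using path len k by (simp add: is_path_def)

lemma p_ends: "p 0 = vs ! j" "p (k - 1) = vs ! Suc j"
  using hd last len_ws k unfolding p_def by (metis hd_conv_nth last_conv_nth list.size(3) not_numeral_le_zero)+

lemma inj_p: "inj_on p {..<k}"
  using path len_ws unfolding p_def is_path_def by (auto intro!: inj_onI simp: nth_eq_iff_index_eq)

lemma es_j: "es ! j \<in> edges G" "ends G (es ! j) = {vs ! j, vs ! Suc j}"
  using chain_build_shape(1)[OF G] j unfolding is_path_def by auto

lemma inj_f: "inj_on f {..<k}"
proof (rule inj_onI)
  fix x y assume "x \<in> {..<k}" "y \<in> {..<k}" "f x = f y"
  moreover have "es ! j \<notin> set fs" using es_j eG by auto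
  ultimately show "x = y"
    using path len unfolding f_def is_path_def
    by (auto simp: nth_eq_iff_index_eq split: if_splits) (metis nth_mem)+
qed

lemma image_p: "p ` {..<k} = set ws"
  using len_ws by (auto simp: p_def set_conv_nth)

lemma image_f_path: "f ` {..<k - 1} = set fs"
  using len by (auto simp: f_def set_conv_nth)

lemma image_f: "f ` {..<k} = insert (es ! j) (set fs)"
proof -
  have "{..<k} = insert (k - 1) {..<k - 1}" using k by auto
  then have "f ` {..<k} = insert (f (k - 1)) (f ` {..<k - 1})" by (metis image_insert)
  then show ?thesis using image_f_path by (simp add: f_def)
qed

lemma f_last: "f (k - 1) = es ! j"
  by (simp add: f_def)

lemma en_f: "i < k \<Longrightarrow> en (f i) = {p i, p (Suc i mod k)}"
proof (cases "i < k - 1")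
  case True
  then have "fs ! i \<in> edges H" "ends H (fs ! i) = {ws ! i, ws ! Suc i}"
    using path len by (auto simp: is_path_def)
  then show ?thesis using enH True by (simp add: f_def p_def)
next
  case False
  assume "i < k"
  then have i: "i = k - 1" using False by simp
  then have "Suc i mod k = 0" using k by simp
  then show ?thesis using i p_ends es_j enG f_last by (auto simp: insert_commute)
qed

lemma polygon_net:
  assumes "ladder_net en V E (p m) (p (Suc m mod k)) s t" "m < k" "r < k" "r \<noteq> m"
    "V \<inter> set ws = {p m, p (Suc m mod k)}" "E \<inter> f ` ({..<k} - {m}) = {}"
  shows "ladder_net en (V \<union> set ws) (E \<union> f ` ({..<k} - {m})) (p r) (p (Suc r mod k))
    (s + (k - 2) * t) (s + (k - 1) * t)"
  using ladder_net_polygon[OF assms(1-4) inj_p inj_f _ _ assms(6)] assms(5) en_f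
  unfolding image_p by blast

text \<open>Leaves out the edge \<open>f (k - 1)\<close> shared with the preceding polygon, so the
  new terminals are the vertices where the earlier polygons are attached.\<close>

lemma path_net:
  assumes "ladder_net en V E (p m) (p (Suc m)) s t" "m < k - 1"
    "V \<inter> set ws = {p m, p (Suc m)}" "E \<inter> f ` ({..<k - 1} - {m}) = {}"
  shows "ladder_net en (V \<union> set ws) (E \<union> f ` ({..<k - 1} - {m})) (vs ! j) (vs ! Suc j)
    (s + (k - 2) * t) t"
proof -
  have eq: "{..k - 1} = {..<k}" "k - 1 - 1 = k - 2" using k by auto
  have "ladder_net en (V \<union> p ` {..k - 1}) (E \<union> f ` ({..<k - 1} - {m})) (p 0) (p (k - 1))
      (s + (k - 1 - 1) * t) t"
  proof (rule ladder_net_path[OF assms(1,2)])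
    show "inj_on p {..k - 1}" unfolding eq by (rule inj_p)
    show "inj_on f {..<k - 1}" by (rule inj_on_subset[OF inj_f]) auto
    show "\<forall>i < k - 1. i \<noteq> m \<longrightarrow> en (f i) = {p i, p (Suc i)}" using en_f by auto
    show "V \<inter> p ` {..k - 1} = {p m, p (Suc m)}" unfolding eq image_p by (rule assms(3))
  qed (rule assms(4))
  then show ?thesis unfolding eq image_p p_ends .
qed

end

text \<open>With \<open>t = omega ks\<close> and \<open>s = t - omega_pred ks\<close>, closing a
  polygon of size \<open>k\<close> gives \<open>s + (k - 1) * t = k * t - omega_pred ks\<close>, the
  recurrence of the continuants, and the new \<open>s\<close> is the new \<open>t\<close> minus the
  old one. Every edge of the last path is covered, since the next polygon may use any of
  them.\<close>

lemma chain_last_edge_net: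
  assumes "chain_build ks G Ps vs es" "\<forall>e \<in> edges G. en e = ends G e" "i < length es"
  shows "\<exists>s t. ladder_net en (verts G) (edges G) (vs ! i) (vs ! Suc i) s t \<and>
    int t = omega ks \<and> int s = omega ks - omega_pred ks"
  using assms
proof (induction arbitrary: i)
  case (chain_base G u v e)
  have "ladder_net en {u, v} {e} u v 1 1"
    using chain_base by (intro ladder_net.edge) (auto simp: is_path_def)
  then show ?case using chain_base by (intro exI[of _ 1]) (auto simp: omega_pred_def)
next
  case (chain_step ks G Ps vs es j k H ws fs)
  define p where "p = (\<lambda>i. ws ! i)"
  define f where "f = (\<lambda>i. if i < k - 1 then fs ! i else es ! j)"
  interpret chain_polygon ks G Ps vs es j k H ws fs en p f
    by unfold_locales (use chain_step in \<open>auto simp: p_def f_def\<close>)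
  obtain s t where st: "ladder_net en (verts G) (edges G) (vs ! j) (vs ! Suc j) s t"
    "int t = omega ks" "int s = omega ks - omega_pred ks"
    using chain_step.IH[OF enG j] by blast
  have kk: "Suc (k - 1) = k" "k - 1 < k" using k by auto
  obtain d where d: "k = 2 + d" using k le_Suc_ex by blast
  have fim: "f ` ({..<k} - {k - 1}) = set fs"
    using image_f_path kk by (metis lessThan_Suc Diff_insert_absorb lessThan_iff less_irrefl)
  have "ladder_net en (verts G \<union> set ws) (edges G \<union> f ` ({..<k} - {k - 1}))
      (p i) (p (Suc i mod k)) (s + (k - 2) * t) (s + (k - 1) * t)"
  proof (rule polygon_net)
    show "ladder_net en (verts G) (edges G) (p (k - 1)) (p (Suc (k - 1) mod k)) s t"
      using ladder_net.swap[OF st(1)] p_ends kk by simp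
    show "verts G \<inter> set ws = {p (k - 1), p (Suc (k - 1) mod k)}"
      using vG p_ends kk by auto
    show "edges G \<inter> f ` ({..<k} - {k - 1}) = {}" unfolding fim by (rule eG)
  qed (use chain_step.prems len k in auto)
  then have "ladder_net en (verts H) (edges H) (ws ! i) (ws ! Suc i) (s + (k - 2) * t) (s + (k - 1) * t)"
    unfolding fim vH eH using chain_step.prems len by (simp add: p_def)
  moreover have "int (s + (k - 1) * t) = omega (ks @ [k])"
    using st d by (simp add: omega_snoc algebra_simps)
  moreover have "int (s + (k - 2) * t) = omega (ks @ [k]) - omega_pred (ks @ [k])"
    using st d by (simp add: omega_snoc algebra_simps)
  ultimately show ?case by blast
qed

text \<open>A network that is attached to the last path is first extended along that path, and then
  treated as a network attached to the preceding polygons. This builds the chain backwards.\<close>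

lemma chain_first_edge_net:
  assumes "chain_build ks G Ps vs es" "ks \<noteq> []" "e' \<in> Ps ! 0"
    "\<forall>q < length Ps. q \<noteq> 0 \<longrightarrow> e' \<notin> Ps ! q" "\<forall>e \<in> edges G. en e = ends G e" "en e' = {a, b}"
    "i < length es" "es ! i \<noteq> e'"
    "ladder_net en V E (vs ! i) (vs ! Suc i) s t"
    "V \<inter> verts G = {vs ! i, vs ! Suc i}" "E \<inter> edges G = {}"
  shows "\<exists>s' t'. ladder_net en (V \<union> verts G) (E \<union> edges G) a b s' t' \<and>
    int t' = int s * omega ks + int t * (omega ks - omega_pred ks)"
  using assms
proof (induction arbitrary: i V E s t)
  case (chain_base G u v e)
  then show ?case by simp
next
  case (chain_step ks G Ps vs es j k H ws fs)
  define p where "p = (\<lambda>i. ws ! i)"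
  define f where "f = (\<lambda>i. if i < k - 1 then fs ! i else es ! j)"
  interpret chain_polygon ks G Ps vs es j k H ws fs en p f
    by unfold_locales (use chain_step in \<open>auto simp: p_def f_def\<close>)
  note net = chain_step.prems(8) and V = chain_step.prems(9) and E = chain_step.prems(10)
  note shape = chain_build_shape[OF G]
  have i: "i < k - 1" using chain_step.prems(6) len by simp
  then have i': "Suc i mod k = Suc i" "i < k" "f i = fs ! i" by (auto simp: f_def)
  have fi: "fs ! i \<in> edges H" using i len eH by auto
  \<comment> \<open>The chain edge \<open>fs ! i\<close> joins the terminals of the network and is
    absorbed in parallel, which turns \<open>t\<close> into \<open>s + t\<close>.\<close>
  have par: "ladder_net en V (insert (fs ! i) E) (p i) (p (Suc i)) s (s + t)"
  proof (rule ladder_net.parallel)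
    show "ladder_net en V E (p i) (p (Suc i)) s t" using net by (simp add: p_def)
  qed (use fi E en_f[of i] i' in auto)
  have wsV: "V \<inter> set ws = {p i, p (Suc i)}"
  proof -
    have "p i \<in> set ws" "p (Suc i) \<in> set ws" using i len_ws by (auto simp: p_def)
    moreover have "V \<inter> (verts G \<union> set ws) = {p i, p (Suc i)}" using V vH by (simp add: p_def)
    ultimately show ?thesis by blast
  qed
  have fE: "x \<notin> E" if "x \<in> edges H" for x using that E by auto
  obtain d where d: "k = 2 + d" using k le_Suc_ex by blast
  have fin: "f n \<noteq> fs ! i" if "n < k" "n \<noteq> i" for n
    using inj_on_eq_iff[OF inj_f, of n i] that i i' by auto
  show ?case
  proof (cases "ks = []")
    case True
    then have P: "Ps = []" and vGs: "verts G = set vs" and eGs: "edges G = set es" "length es = 1"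
      using shape by auto
    then have j0: "j = 0" using j by simp
    have eG1: "edges G = {es ! j}" using eGs j0 chain_build_single[OF G True] by simp
    have vG1: "verts G = {vs ! j, vs ! Suc j}"
      using vGs chain_build_single[OF G True] j0 by simp
    have vHs: "verts H = set ws" using vH vG vG1 by auto
    have "e' \<in> f ` {..<k}" using chain_step.prems(2) P image_f by simp
    then obtain r where r: "r < k" "e' = f r" by auto
    have "r \<noteq> i" using r chain_step.prems(7) i' by auto
    have "ladder_net en (V \<union> set ws) (insert (fs ! i) E \<union> f ` ({..<k} - {i}))
        (p r) (p (Suc r mod k)) (s + (k - 2) * (s + t)) (s + (k - 1) * (s + t))"
    proof (rule polygon_net)
      show "V \<inter> set ws = {p i, p (Suc i mod k)}" using wsV i' by simp
      have "f n \<in> edges H" if "n < k" for n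
        using imageI[of n "{..<k}" f] that unfolding image_f eH eG1 by auto
      then show "insert (fs ! i) E \<inter> f ` ({..<k} - {i}) = {}"
        using fin fE by (intro disjoint_imageI) auto
    qed (use par i' r \<open>r \<noteq> i\<close> in auto)
    moreover have "insert (fs ! i) E \<union> f ` ({..<k} - {i}) = E \<union> edges H"
    proof -
      have "insert (fs ! i) (f ` ({..<k} - {i})) = f ` {..<k}" using i'(2) unfolding i'(3)[symmetric] by blast
      also have "\<dots> = edges H" unfolding image_f eH eG1 by simp
      finally show ?thesis by auto
    qed
    moreover have "{a, b} = {p r, p (Suc r mod k)}"
      using chain_step.prems(5) en_f[OF r(1)] r(2) by simp
    ultimately have "ladder_net en (V \<union> verts H) (E \<union> edges H) a b
        (s + (k - 2) * (s + t)) (s + (k - 1) * (s + t))"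
      unfolding vHs using ladder_net_doubleton by fastforce
    moreover have "int (s + (k - 1) * (s + t)) =
        int s * omega (ks @ [k]) + int t * (omega (ks @ [k]) - omega_pred (ks @ [k]))"
      using True d omega_snoc[of "[]" k] omega_pred_snoc[of "[]" k]
      by (simp add: omega_pred_def[of "[]"] algebra_simps)
    ultimately show ?thesis by blast
  next
    case False
    then have P: "Ps \<noteq> []" using shape by auto
    have "ladder_net en (V \<union> set ws) (insert (fs ! i) E \<union> f ` ({..<k - 1} - {i}))
        (vs ! j) (vs ! Suc j) (s + (k - 2) * (s + t)) (s + t)"
    proof (rule path_net[OF par i wsV])
      have "f n \<in> edges H" if "n < k - 1" for n
        using imageI[of n "{..<k - 1}" f] that unfolding image_f_path eH by auto
      then show "insert (fs ! i) E \<inter> f ` ({..<k - 1} - {i}) = {}"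
        using fin fE by (intro disjoint_imageI) auto
    qed
    moreover have "insert (fs ! i) E \<union> f ` ({..<k - 1} - {i}) = E \<union> set fs"
    proof -
      have "insert (fs ! i) (f ` ({..<k - 1} - {i})) = f ` {..<k - 1}" using i unfolding i'(3)[symmetric] by blast
      then show ?thesis unfolding image_f_path by auto
    qed
    ultimately have net': "ladder_net en (V \<union> set ws) (E \<union> set fs)
        (vs ! j) (vs ! Suc j) (s + (k - 2) * (s + t)) (s + t)"
      by simp
    have "\<exists>s' t'. ladder_net en (V \<union> set ws \<union> verts G) (E \<union> set fs \<union> edges G) a b s' t' \<and>
      int t' = int (s + (k - 2) * (s + t)) * omega ks + int (s + t) * (omega ks - omega_pred ks)"
    proof (rule chain_step.IH[OF False _ _ enG chain_step.prems(5) j _ net'])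
      show "e' \<in> Ps ! 0" using chain_step.prems(2) P by (simp add: nth_append)
      show "\<forall>q < length Ps. q \<noteq> 0 \<longrightarrow> e' \<notin> Ps ! q"
      proof (intro allI impI)
        fix q assume "q < length Ps" "q \<noteq> 0"
        then show "e' \<notin> Ps ! q"
          using chain_step.prems(3)[rule_format, of q] by (simp add: nth_append)
      qed
      have "e' \<notin> insert (es ! j) (set fs)"
        using chain_step.prems(3) P by (auto dest: spec[of _ "length Ps"])
      then show "es ! j \<noteq> e'" by auto
      show "(V \<union> set ws) \<inter> verts G = {vs ! j, vs ! Suc j}"
      proof -
        have "V \<inter> (verts G \<union> set ws) = {p i, p (Suc i)}" using V vH by (simp add: p_def)
        then have "V \<inter> verts G \<subseteq> set ws" unfolding wsV[symmetric] by auto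
        then have "(V \<union> set ws) \<inter> verts G = verts G \<inter> set ws" by auto
        then show ?thesis unfolding vG .
      qed
      show "(E \<union> set fs) \<inter> edges G = {}" using E eH eG by blast
    qed
    moreover have "V \<union> set ws \<union> verts G = V \<union> verts H" "E \<union> set fs \<union> edges G = E \<union> edges H"
      using vH eH by auto
    \<comment> \<open>The expression \<open>s * omega + t * (omega - omega_pred)\<close> is the tree
      count of the network glued to the chain along an edge of its last path. Pushing the network
      across a polygon does not change it.\<close>
    moreover have "int (s + (k - 2) * (s + t)) * omega ks + int (s + t) * (omega ks - omega_pred ks) =
        int s * omega (ks @ [k]) + int t * (omega (ks @ [k]) - omega_pred (ks @ [k]))"
      using d by (simp add: omega_snoc algebra_simps)
    ultimately show ?thesis by simp
  qed
qed

text \<open>A free edge of the last polygon is reached by following the construction, one of the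
  first polygon by starting from the last path. For a single polygon the free edge may be the
  initial edge itself, so this case is treated directly.\<close>

lemma polygon_chain_net:
  assumes "polygon_chain ks G Ps" "free_end_edge Ps e'" "ends G e' = {a, b}"
  shows "\<exists>s t. ladder_net (ends G) (verts G) (edges G) a b s t \<and> int t = omega ks"
proof -
  obtain q where q: "q \<in> {0, length Ps - 1}" "q < length Ps" "e' \<in> Ps ! q"
    "\<forall>q' < length Ps. q' \<noteq> q \<longrightarrow> e' \<notin> Ps ! q'"
    using assms(2) by (auto simp: free_end_edge_def)
  obtain ws fs where chain: "chain_build ks G Ps ws fs"
    using assms(1) by (auto simp: polygon_chain_def)
  from chain show ?thesis
  proof cases
    case chain_base
    then show ?thesis using q by simp
  next
    case (chain_step ks0 G0 Ps0 vs es j k)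
    define p where "p = (\<lambda>i. ws ! i)"
    define f where "f = (\<lambda>i. if i < k - 1 then fs ! i else es ! j)"
    interpret chain_polygon ks0 G0 Ps0 vs es j k G ws fs "ends G" p f
      by unfold_locales (use chain_step in \<open>auto simp: p_def f_def\<close>)
    note shape = chain_build_shape[OF G]
    have pne: "p i \<noteq> p (Suc i mod k)" if "i < k" for i
    proof -
      have "i \<noteq> Suc i mod k" using that k by (cases "Suc i = k") auto
      then show ?thesis using inj_on_eq_iff[OF inj_p, of i "Suc i mod k"] that k by auto
    qed
    show ?thesis
    proof (cases "ks0 = []")
      case True
      then have P: "Ps0 = []" and vGs: "verts G0 = set vs" and eGs: "edges G0 = set es" "length es = 1"
        using shape by auto
      then have j0: "j = 0" using j by simp
      have eG1: "edges G0 = {es ! j}" using eGs j0 chain_build_single[OF G True] by simp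
      have vG1: "verts G0 = {vs ! j, vs ! Suc j}"
        using vGs chain_build_single[OF G True] j0 by simp
      have vHs: "verts G = set ws" using vH vG vG1 by auto
      have "e' \<in> f ` {..<k}" using q P chain_step(2) image_f by simp
      then obtain r where r: "r < k" "e' = f r" by auto
      \<comment> \<open>Any edge of the polygon other than the free one can serve as the initial
        network.\<close>
      define m where "m = (if r = 0 then 1 else 0 :: nat)"
      have m: "m < k" "m \<noteq> r" using k by (auto simp: m_def)
      have "ladder_net (ends G) {p m, p (Suc m mod k)} {f m} (p m) (p (Suc m mod k)) 1 1"
        using pne en_f m by (intro ladder_net.edge) auto
      then have "ladder_net (ends G) ({p m, p (Suc m mod k)} \<union> set ws)
          ({f m} \<union> f ` ({..<k} - {m})) (p r) (p (Suc r mod k)) (1 + (k - 2) * 1) (1 + (k - 1) * 1)"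
      proof (rule polygon_net)
        have "p m \<in> set ws" "p (Suc m mod k) \<in> set ws" using m len_ws by (auto simp: p_def intro!: nth_mem mod_less_divisor)
        then show "{p m, p (Suc m mod k)} \<inter> set ws = {p m, p (Suc m mod k)}" by auto
        show "{f m} \<inter> f ` ({..<k} - {m}) = {}"
          using inj_on_eq_iff[OF inj_f] m by (auto simp del: if_split) 
      qed (use m r in auto)
      moreover have "{f m} \<union> f ` ({..<k} - {m}) = edges G"
      proof -
        have "{f m} \<union> f ` ({..<k} - {m}) = f ` {..<k}" using m by blast
        also have "\<dots> = edges G" unfolding image_f eH eG1 by simp
        finally show ?thesis .
      qed
      moreover have "{p m, p (Suc m mod k)} \<union> set ws = verts G"
        unfolding vHs using m len_ws by (auto simp: p_def intro!: nth_mem mod_less_divisor)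
      moreover have "{a, b} = {p r, p (Suc r mod k)}"
        using assms(3) en_f[OF r(1)] r(2) by simp
      ultimately have "ladder_net (ends G) (verts G) (edges G) a b (1 + (k - 2)) k"
        using k ladder_net_doubleton by fastforce
      then show ?thesis
        using True chain_step(1) omega_snoc[of "[]" k] by (auto simp: omega_pred_def)
    next
      case False
      then have P: "Ps0 \<noteq> []" using shape by auto
      show ?thesis
      proof (cases "q = 0")
        case True
        have ne: "e' \<notin> insert (es ! j) (set fs)"
          using q(4) P True chain_step(2) by (auto dest: spec[of _ "length Ps0"])
        have k1: "0 < k - 1" using k by simp
        then have f0: "Suc 0 mod k = Suc 0" using k by simp
        \<comment> \<open>The last path, grown from its first edge, is the network to start from: a
          path with \<open>k - 1\<close> edges has one spanning tree and \<open>k - 1\<close>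
          separating forests.\<close>
        have "ladder_net (ends G) {p 0, p (Suc 0)} {f 0} (p 0) (p (Suc 0)) 1 1"
          using pne[of 0] en_f[of 0] k f0 by (intro ladder_net.edge) auto
        then have "ladder_net (ends G) ({p 0, p (Suc 0)} \<union> set ws) ({f 0} \<union> f ` ({..<k - 1} - {0}))
            (vs ! j) (vs ! Suc j) (1 + (k - 2) * 1) 1"
        proof (rule path_net[OF _ k1])
          have "p 0 \<in> set ws" "p (Suc 0) \<in> set ws" using k len_ws by (auto simp: p_def intro!: nth_mem)
          then show "{p 0, p (Suc 0)} \<inter> set ws = {p 0, p (Suc 0)}" by auto
          show "{f 0} \<inter> f ` ({..<k - 1} - {0}) = {}"
            using inj_on_eq_iff[OF inj_f] k by (auto simp del: if_split)
        qed
        moreover have "{p 0, p (Suc 0)} \<union> set ws = set ws" using k len_ws by (auto simp: p_def intro!: nth_mem)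
        moreover have "{f 0} \<union> f ` ({..<k - 1} - {0}) = set fs"
        proof -
          have "{f 0} \<union> f ` ({..<k - 1} - {0}) = f ` {..<k - 1}" using k1 by blast
          then show ?thesis unfolding image_f_path .
        qed
        moreover have "1 + (k - 2) * 1 = k - 1" using k by simp
        ultimately have net: "ladder_net (ends G) (set ws) (set fs) (vs ! j) (vs ! Suc j) (k - 1) 1"
          by (simp only:)
        have "\<exists>s' t'. ladder_net (ends G) (set ws \<union> verts G0) (set fs \<union> edges G0) a b s' t' \<and>
          int t' = int (k - 1) * omega ks0 + int 1 * (omega ks0 - omega_pred ks0)"
        proof (rule chain_first_edge_net[OF G False _ _ enG assms(3) j _ net])
          show "e' \<in> Ps0 ! 0" using q(3) True P chain_step(2) by (simp add: nth_append)
          show "\<forall>q < length Ps0. q \<noteq> 0 \<longrightarrow> e' \<notin> Ps0 ! q"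
          proof (intro allI impI)
          fix i assume "i < length Ps0" "i \<noteq> 0"
          then show "e' \<notin> Ps0 ! i"
            using q(4)[rule_format, of i] True chain_step(2) by (simp add: nth_append)
        qed
        qed (use ne vG eG in auto)
        moreover have "set ws \<union> verts G0 = verts G" "set fs \<union> edges G0 = edges G"
          using vH eH by auto
        ultimately show ?thesis
          using chain_step(1) k by (simp add: omega_snoc of_nat_diff algebra_simps)
      next
        case False
        then have "q = length Ps0" using q(1) chain_step(2) by simp
        then have e'in: "e' \<in> insert (es ! j) (set fs)" using q(3) chain_step(2) by simp
        obtain n where n: "n < length Ps0" "last Ps0 = Ps0 ! n"
          using P by (metis diff_less last_conv_nth length_greater_0_conv zero_less_one)
        then have "e' \<notin> last Ps0"
          using q(4)[rule_format, of n] \<open>q = length Ps0\<close> chain_step(2) by (simp add: nth_append)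
        \<comment> \<open>The shared edge \<open>es ! j\<close> also lies in the preceding polygon,
          so a free edge of the last polygon must lie on the path added last.\<close>
        then have "e' \<noteq> es ! j" using shape(4)[OF P] nth_mem[OF j] by blast
        then obtain i where i: "i < length fs" "e' = fs ! i" using e'in by (auto simp: in_set_conv_nth)
        obtain s t where st: "ladder_net (ends G) (verts G) (edges G) (ws ! i) (ws ! Suc i) s t"
          "int t = omega ks"
          using chain_last_edge_net[OF chain _ i(1), of "ends G"] by blast
        have "{a, b} = {ws ! i, ws ! Suc i}"
          using assms(3) path i by (simp add: is_path_def)
        then show ?thesis using st(2) ladder_net_doubleton[OF st(1)] by blast
      qed
    qed
  qed
qed


section \<open>A group given by generators and relations\<close>

text \<open>The number \<open>k\<close> counts the relation \<open>s\<close>; the vectors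
  \<open>z\<close> of sum 0 produce the combinations of the differences between \<open>t i\<close>
  times generator \<open>i\<close> and \<open>t j\<close> times generator \<open>j\<close>.\<close>

definition relation_lattice :: "nat \<Rightarrow> (nat \<Rightarrow> int) \<Rightarrow> (nat \<Rightarrow> int) \<Rightarrow> (nat \<Rightarrow> int) set" where
  "relation_lattice l s t = {m. \<exists>k z. (\<Sum>i=1..l. z i) = 0 \<and> (\<forall>i \<in> {1..l}. m i = k * s i + z i * t i)}"

text \<open>The group with the generators \<open>1, \<dots>, l\<close> and these relations is the direct sum of the cyclic
  groups of orders \<open>n 1, \<dots>, n (l - 1)\<close>; an isomorphism is induced by an integral matrix.\<close>

definition presents :: "nat \<Rightarrow> (nat \<Rightarrow> int) \<Rightarrow> (nat \<Rightarrow> int) \<Rightarrow> (nat \<Rightarrow> int) \<Rightarrow> bool" where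
  "presents l s t n \<longleftrightarrow> (\<exists>c :: nat \<Rightarrow> nat \<Rightarrow> int.
     (\<forall>m. m \<in> relation_lattice l s t \<longleftrightarrow> (\<forall>j \<in> {1..l - 1}. n j dvd (\<Sum>i=1..l. c j i * m i))) \<and>
     (\<forall>y. \<exists>m. \<forall>j \<in> {1..l - 1}. n j dvd (\<Sum>i=1..l. c j i * m i) - y j))"

lemma presents_cong:
  assumes "presents l s t n" "\<And>j. j \<in> {1..l - 1} \<Longrightarrow> n' j = n j"
  shows "presents l s t n'"
proof -
  have "(\<forall>j \<in> {1..l - 1}. n' j dvd x j) \<longleftrightarrow> (\<forall>j \<in> {1..l - 1}. n j dvd x j)" for x
    by (intro ball_cong refl) (simp only: assms(2))
  then show ?thesis using assms(1) unfolding presents_def by simp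
qed

text \<open>Up to sign the determinant of the \<open>l\<close> relations, and for the flower its
  number of spanning trees.\<close>

definition det_sum :: "nat \<Rightarrow> (nat \<Rightarrow> int) \<Rightarrow> (nat \<Rightarrow> int) \<Rightarrow> int" where
  "det_sum l s t = (\<Sum>i=1..l. s i * (\<Prod>j \<in> {1..l} - {i}. t j))"

definition det_div :: "nat \<Rightarrow> (nat \<Rightarrow> int) \<Rightarrow> nat \<Rightarrow> int" where
  "det_div l t j = Gcd {\<Prod>i \<in> I. t i | I. I \<subseteq> {1..l} \<and> card I = j}"

definition coprime_weights :: "nat \<Rightarrow> (nat \<Rightarrow> int) \<Rightarrow> (nat \<Rightarrow> int) \<Rightarrow> bool" where
  "coprime_weights l s t \<longleftrightarrow> (\<forall>i \<in> {1..l}. t i > 0 \<and> coprime (s i) (t i))"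

text \<open>A diagonal form is found for the simplified data and then pulled back, hence the
  direction of the implication.\<close>

definition reduces_to ::
  "nat \<Rightarrow> (nat \<Rightarrow> int) \<Rightarrow> (nat \<Rightarrow> int) \<Rightarrow> (nat \<Rightarrow> int) \<Rightarrow> (nat \<Rightarrow> int) \<Rightarrow> bool" where
  "reduces_to l s t s' t' \<longleftrightarrow>
     (\<forall>n. presents l s' t' n \<longrightarrow> presents l s t n) \<and> det_sum l s t = det_sum l s' t' \<and>
     det_div l t = det_div l t'"

lemma reduces_to_refl: "reduces_to l s t s t"
  by (simp add: reduces_to_def)

lemma reduces_to_trans:
  "reduces_to l s t s' t' \<Longrightarrow> reduces_to l s' t' s'' t'' \<Longrightarrow> reduces_to l s t s'' t''"
  by (simp add: reduces_to_def)

section \<open>Merging the orders of two generators into their gcd and lcm\<close>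

lemma sum_pick_two:
  fixes f :: "nat \<Rightarrow> int"
  assumes "finite A" "p \<in> A" "q \<in> A" "p \<noteq> q"
  shows "sum f A = f p + f q + sum f (A - {p, q})"
proof -
  have "sum f A = f p + sum f (A - {p})" using assms by (simp add: sum.remove)
  also have "sum f (A - {p}) = f q + sum f (A - {p} - {q})" using assms by (intro sum.remove) auto
  also have "A - {p} - {q} = A - {p, q}" by auto
  finally show ?thesis by simp
qed

text \<open>Splits \<open>g\<close> into the part built from primes of \<open>T\<close> and the part
  prime to \<open>T\<close>. Splitting off \<open>gcd g T\<close> again and again achieves this
  without factorisation into primes.\<close>

lemma coprime_decomposition:
  fixes g T :: int
  assumes "g > 0" "T > 0"
  shows "\<exists>g' g'' k. g = g' * g'' \<and> g' dvd T ^ k \<and> coprime g'' T"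
  using assms(1)
proof (induction "nat g" arbitrary: g rule: less_induct)
  case less
  show ?case
  proof (cases "coprime g T")
    case True
    then show ?thesis by (intro exI[of _ 1] exI[of _ g] exI[of _ 0]) auto
  next
    case False
    let ?d = "gcd g T"
    have d1: "?d \<noteq> 1" using False by (simp add: coprime_iff_gcd_eq_1)
    have "?d > 0" using less.prems by simp
    then have d: "?d > 1" using d1 by linarith
    obtain h where h: "g = ?d * h" by (meson dvd_def gcd_dvd1)
    have "h > 0" using h less.prems \<open>?d > 0\<close> by (metis zero_less_mult_pos)
    moreover from this have "h < g" using h d by (metis mult.commute mult_less_cancel_left_pos mult_1_right)
    ultimately obtain h' h'' k where hh: "h = h' * h''" "h' dvd T ^ k" "coprime h'' T"
      using less.hyps[of h] by auto
    have "?d * h' dvd T ^ Suc k" using hh(2) by (simp add: mult_dvd_mono)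
    moreover have "g = ?d * h' * h''" using h hh(1) by (simp add: mult.assoc)
    ultimately show ?thesis using hh(3) by blast
  qed
qed

lemma coprime_add_mult:
  fixes x y g :: int
  assumes "coprime x g" "g dvd y"
  shows "coprime (x + y) g"
proof (rule coprimeI)
  fix c assume c: "c dvd x + y" "c dvd g"
  then have "c dvd x" using assms(2) by (meson dvd_add_left_iff dvd_trans)
  then show "is_unit c" using coprime_common_divisor[OF assms(1)] c(2) by blast
qed

text \<open>The unimodular substitution that turns the orders \<open>t\<^sub>1\<close>, \<open>t\<^sub>2\<close> of two generators into their gcd
  and their lcm. Its coefficients are chosen such that the weights stay coprime to the orders: a
  common prime of \<open>g\<close> and \<open>t\<^sub>1 / g\<close> has to divide \<open>A\<close>, any other prime of \<open>g\<close> has to divide \<open>C\<close>.\<close>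

lemma merge_coefficients:
  fixes s1 s2 t1 t2 :: int
  assumes t: "t1 > 0" "t2 > 0" and st: "coprime s1 t1" "coprime s2 t2"
  defines "T1 \<equiv> t1 div gcd t1 t2" and "T2 \<equiv> t2 div gcd t1 t2"
  shows "\<exists>A C. A * T1 - C * T2 = 1 \<and> coprime (A * s1 + C * s2) (gcd t1 t2) \<and>
    coprime (T2 * (1 - A * T1) * s1 + T1 * (1 - C * T2) * s2) (lcm t1 t2)"
proof -
  let ?g = "gcd t1 t2"
  have g: "?g > 0" using t by simp
  have t1: "t1 = ?g * T1" and t2: "t2 = ?g * T2" by (simp_all add: T1_def T2_def)
  have T: "T1 > 0" "T2 > 0" using t g t1 t2 by (metis zero_less_mult_pos)+
  have T12: "coprime T1 T2"
    unfolding T1_def T2_def using t by (intro div_gcd_coprime) auto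
  obtain g' g'' k where gg: "?g = g' * g''" "g' dvd T1 ^ k" "coprime g'' T1"
    using coprime_decomposition[OF g T(1)] by blast
  have via: "coprime x g'" if "coprime x T1" for x
    using that gg(2) by (meson coprime_divisors coprime_power_right_iff dvd_refl)
  have g'T2: "coprime T2 g'" using T12 by (intro via) (simp add: coprime_commute)
  have g'g'': "coprime g'' g'" using gg(3) by (rule via)
  \<comment> \<open>Applying Bezout to these products, not to \<open>T1\<close> and
    \<open>T2\<close>, makes \<open>A\<close> a multiple of \<open>g'\<close> and \<open>C\<close> a
    multiple of \<open>g''\<close>.\<close>
  have "coprime (g' * T1) (g'' * T2)"
    using g'T2 g'g'' gg(3) T12 by (simp add: coprime_commute)
  then obtain x y where "x * (g' * T1) + y * (g'' * T2) = 1"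
    using bezout_int[of "g' * T1" "g'' * T2"] by (auto simp: coprime_iff_gcd_eq_1)
  define A where "A = x * g'"
  define C where "C = - y * g''"
  have AC: "A * T1 - C * T2 = 1"
    using \<open>x * (g' * T1) + y * (g'' * T2) = 1\<close> by (simp add: A_def C_def algebra_simps)
  have dvd: "g' dvd t1" "g'' dvd t1" "g' dvd t2" "g'' dvd t2" "T1 dvd t1" "T2 dvd t2"
    using gg(1) t1 t2 by (metis dvd_triv_left dvd_triv_right dvd_trans)+
  have s: "coprime s1 g''" "coprime s2 g'" "coprime s2 g''" "coprime s1 T1" "coprime s2 T2"
    using st dvd by (meson coprime_divisors dvd_refl)+
  have "coprime A g''"
  proof -
    have "coprime (1 + C * T2) g''" by (intro coprime_add_mult) (auto simp: C_def)
    then have "coprime (A * T1) g''" using AC by (simp add: algebra_simps)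
    then show ?thesis by simp
  qed
  moreover have "coprime C g'"
  proof -
    have "coprime (-1 + A * T1) g'" by (intro coprime_add_mult) (auto simp: A_def)
    then have "coprime (C * T2) g'" using AC by (simp add: algebra_simps)
    then show ?thesis by simp
  qed
  ultimately have "coprime (A * s1 + C * s2) g''" "coprime (C * s2 + A * s1) g'"
    by (rule_tac [!] coprime_add_mult) (use s in \<open>simp_all add: A_def C_def\<close>)
  then have 1: "coprime (A * s1 + C * s2) ?g"
    unfolding gg(1) by (simp add: add.commute)
  let ?s = "T2 * (1 - A * T1) * s1 + T1 * (1 - C * T2) * s2"
  \<comment> \<open>The lcm is the product of \<open>T1\<close>, \<open>T2\<close>,
    \<open>g'\<close> and \<open>g''\<close>. The weight is congruent to \<open>T2 * s1\<close>
    modulo \<open>T1\<close> and to \<open>T1 * s2\<close> modulo \<open>T2\<close>; it is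
    \<open>T1 * s2\<close> modulo \<open>g''\<close> as well, because \<open>g''\<close> divides
    \<open>C\<close>. The factor \<open>g'\<close> has only primes of \<open>T1\<close>.\<close>
  have "coprime (T2 * s1 + T1 * ((1 - C * T2) * s2 - A * T2 * s1)) T1"
    using s T12 by (intro coprime_add_mult) (auto simp: coprime_commute)
  then have sT1: "coprime ?s T1" by (simp add: algebra_simps)
  have "coprime (T1 * s2 + T2 * ((1 - A * T1) * s1 - C * T1 * s2)) T2"
    using s T12 by (intro coprime_add_mult) (auto simp: coprime_commute)
  then have sT2: "coprime ?s T2" by (simp add: algebra_simps)
  have AT: "1 - A * T1 = - (C * T2)" using AC by simp
  have eq: "?s = T1 * s2 + C * (- T2 * T2 * s1 - T1 * T2 * s2)"
    unfolding AT by (simp add: algebra_simps)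
  have "coprime ?s g''"
    unfolding eq using s gg(3) by (intro coprime_add_mult) (auto simp: coprime_commute C_def)
  moreover have "lcm t1 t2 = (g' * T1) * (g'' * T2)"
  proof -
    have "?g * lcm t1 t2 = t1 * t2" using t by (simp add: prod_gcd_lcm_int abs_mult)
    also have "\<dots> = ?g * (?g * T1 * T2)" using t1 t2 by (metis mult.assoc mult.left_commute)
    finally have "lcm t1 t2 = ?g * T1 * T2" using g unfolding mult_cancel_left by linarith
    then show ?thesis unfolding gg(1) by (simp only: mult_ac)
  qed
  ultimately have "coprime ?s (lcm t1 t2)" using sT1 sT2 via[OF sT1] by simp
  then show ?thesis using AC 1 by blast
qed

text \<open>Groups the index sets by their trace on \<open>{p, q}\<close>. Then \<open>t p\<close>
  and \<open>t q\<close> enter only through their gcd and their product, and merging preserves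
  both.\<close>

lemma dvd_products_iff:
  fixes t :: "nat \<Rightarrow> int"
  assumes "finite U" "p \<in> U" "q \<in> U" "p \<noteq> q"
  shows "(\<forall>I. I \<subseteq> U \<and> card I = j \<longrightarrow> d dvd prod t I) \<longleftrightarrow>
    (\<forall>K. K \<subseteq> U - {p, q} \<longrightarrow> (card K = j \<longrightarrow> d dvd prod t K) \<and>
       (Suc (card K) = j \<longrightarrow> d dvd gcd (t p) (t q) * prod t K) \<and>
       (Suc (Suc (card K)) = j \<longrightarrow> d dvd t p * t q * prod t K))"
    (is "?L \<longleftrightarrow> (\<forall>K. K \<subseteq> U - {p, q} \<longrightarrow> ?R K)")
proof (intro iffI allI impI)
  fix K assume L: ?L and K: "K \<subseteq> U - {p, q}"
  have fin: "finite K" using K assms(1) finite_subset by blast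
  have n: "p \<notin> K" "q \<notin> K" "p \<notin> insert q K" using K assms by auto
  have P: "prod t (insert p K) = t p * prod t K" "prod t (insert q K) = t q * prod t K"
    "prod t (insert p (insert q K)) = t p * t q * prod t K"
    using fin n by (simp_all add: mult.assoc)
  have C: "card (insert p K) = Suc (card K)" "card (insert q K) = Suc (card K)"
    "card (insert p (insert q K)) = Suc (Suc (card K))"
    using fin n by simp_all
  have S: "K \<subseteq> U" "insert p K \<subseteq> U" "insert q K \<subseteq> U" "insert p (insert q K) \<subseteq> U"
    using K assms by auto
  show "?R K"
  proof (intro conjI impI)
    assume "card K = j"
    then show "d dvd prod t K" using L S by blast
  next
    assume "Suc (card K) = j"
    then have "d dvd t p * prod t K" "d dvd t q * prod t K" using L S C P by metis+
    then have "d dvd gcd (t p * prod t K) (t q * prod t K)" by simp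
    also have "gcd (t p * prod t K) (t q * prod t K) = normalize (gcd (t p) (t q) * prod t K)"
      by (simp add: gcd_mult_right gcd.commute)
    finally show "d dvd gcd (t p) (t q) * prod t K" by simp
  next
    assume "Suc (Suc (card K)) = j"
    then show "d dvd t p * t q * prod t K" using L S C P by metis
  qed
next
  fix I assume R: "\<forall>K. K \<subseteq> U - {p, q} \<longrightarrow> ?R K" and I: "I \<subseteq> U \<and> card I = j"
  let ?K = "I - {p, q}"
  have fin: "finite I" using I assms(1) finite_subset by blast
  have "?K \<subseteq> U - {p, q}" using I by auto
  then have K: "?R ?K" by (rule mp[OF spec[OF R]])
  show "d dvd prod t I"
  proof (cases "p \<in> I"; cases "q \<in> I")
    assume pq: "p \<in> I" "q \<in> I"
    then have "insert p (insert q ?K) = I" by auto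
    moreover have "prod t (insert p (insert q ?K)) = t p * t q * prod t ?K"
      "card (insert p (insert q ?K)) = Suc (Suc (card ?K))"
      using fin assms(4) by (simp_all add: mult.assoc)
    ultimately have "prod t I = t p * t q * prod t ?K" "Suc (Suc (card ?K)) = j" using I by auto
    then show ?thesis using K by simp
  next
    assume pq: "p \<in> I" "q \<notin> I"
    then have "insert p ?K = I" by auto
    moreover have "prod t (insert p ?K) = t p * prod t ?K" "card (insert p ?K) = Suc (card ?K)"
      using fin by simp_all
    ultimately have I': "prod t I = t p * prod t ?K" "Suc (card ?K) = j" using I by auto
    have "d dvd gcd (t p) (t q) * prod t ?K" using K I'(2) by blast
    also have "\<dots> dvd prod t I" unfolding I'(1) by (intro mult_dvd_mono) auto
    finally show ?thesis .
  next
    assume pq: "p \<notin> I" "q \<in> I"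
    then have "insert q ?K = I" by auto
    moreover have "prod t (insert q ?K) = t q * prod t ?K" "card (insert q ?K) = Suc (card ?K)"
      using fin by simp_all
    ultimately have I': "prod t I = t q * prod t ?K" "Suc (card ?K) = j" using I by auto
    have "d dvd gcd (t p) (t q) * prod t ?K" using K I'(2) by blast
    also have "\<dots> dvd prod t I" unfolding I'(1) by (intro mult_dvd_mono) auto
    finally show ?thesis .
  next
    assume pq: "p \<notin> I" "q \<notin> I"
    then have "?K = I" by auto
    then show ?thesis using K I by simp
  qed
qed

lemma det_div_merge:
  assumes "p \<in> {1..l}" "q \<in> {1..l}" "p \<noteq> q" "t p > 0" "t q > 0"
  shows "det_div l t = det_div l (t(p := gcd (t p) (t q), q := lcm (t p) (t q)))"
proof (rule ext)
  fix j
  let ?t = "t(p := gcd (t p) (t q), q := lcm (t p) (t q))"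
  have "gcd (t p) (t q) dvd lcm (t p) (t q)" by (meson dvd_lcm1 dvd_trans gcd_dvd1)
  then have gl: "gcd (?t p) (?t q) = gcd (t p) (t q)" "?t p * ?t q = t p * t q"
    using assms by (simp_all add: gcd_proj1_if_dvd prod_gcd_lcm_int abs_mult)
  have K: "prod ?t K = prod t K" if "K \<subseteq> {1..l} - {p, q}" for K
    using that by (intro prod.cong) auto
  have dvd: "(\<forall>I. I \<subseteq> {1..l} \<and> card I = j \<longrightarrow> d dvd prod t I) \<longleftrightarrow>
      (\<forall>I. I \<subseteq> {1..l} \<and> card I = j \<longrightarrow> d dvd prod ?t I)" for d
    unfolding dvd_products_iff[OF finite_atLeastAtMost assms(1-3)] gl using K by auto
  have same: "d dvd det_div l t j \<longleftrightarrow> d dvd det_div l ?t j" for d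
  proof -
    have "(\<forall>y \<in> {\<Prod>i \<in> I. u i | I. I \<subseteq> {1..l} \<and> card I = j}. d dvd y) \<longleftrightarrow>
        (\<forall>I. I \<subseteq> {1..l} \<and> card I = j \<longrightarrow> d dvd prod u I)" for u :: "nat \<Rightarrow> int"
      by blast
    then show ?thesis using dvd[of d] unfolding det_div_def dvd_Gcd_iff by simp
  qed
  show "det_div l t j = det_div l ?t j"
  proof (rule associated_eqI)
    show "det_div l t j dvd det_div l ?t j" using same[of "det_div l t j"] by simp
    show "det_div l ?t j dvd det_div l t j" using same[of "det_div l ?t j"] by simp
  qed (simp_all add: det_div_def)
qed


text \<open>Merging two generators acts on the coordinate vectors of \<open>z\<close> and of \<open>m\<close> by matrices of
  determinant \<open>A T\<^sub>1 - C T\<^sub>2 = 1\<close>.\<close>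

lemma reduces_to_merge:
  assumes w: "coprime_weights l s t" and pq: "p \<in> {1..l}" "q \<in> {1..l}" "p \<noteq> q"
  defines "t' \<equiv> t(p := gcd (t p) (t q), q := lcm (t p) (t q))"
  shows "\<exists>s'. coprime_weights l s' t' \<and> reduces_to l s t s' t'"
proof -
  define g where "g = gcd (t p) (t q)"
  define T1 where "T1 = t p div g"
  define T2 where "T2 = t q div g"
  have t: "t p > 0" "t q > 0" and st: "coprime (s p) (t p)" "coprime (s q) (t q)"
    using w pq by (auto simp: coprime_weights_def)
  have g: "g > 0" using t by (simp add: g_def)
  have t1: "t p = g * T1" and t2: "t q = g * T2" by (simp_all add: T1_def T2_def g_def)
  have L: "lcm (t p) (t q) = g * T1 * T2"
  proof -
    have "g * lcm (t p) (t q) = t p * t q" using t by (simp add: g_def prod_gcd_lcm_int abs_mult)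
    also have "\<dots> = g * (g * T1 * T2)" using t1 t2 by (metis mult.assoc mult.left_commute)
    finally show ?thesis using g by simp
  qed
  obtain A C where AC: "A * T1 - C * T2 = 1" "coprime (A * s p + C * s q) g"
    "coprime (T2 * (1 - A * T1) * s p + T1 * (1 - C * T2) * s q) (lcm (t p) (t q))"
    using merge_coefficients[OF t st] unfolding T1_def T2_def g_def by blast
  \<comment> \<open>\<open>B\<close> and \<open>D\<close> are determined by the lattice: with them
    the new coordinates at \<open>p\<close> and \<open>q\<close> are the new orders times numbers
    that have the sum \<open>z p + z q\<close>, so the condition on the sum of \<open>z\<close>
    persists.\<close>
  define B where "B = T2 * (1 - A * T1)"
  define D where "D = T1 * (1 - C * T2)"
  define M where "M m = m(p := A * m p + C * m q, q := B * m p + D * m q)" for m :: "nat \<Rightarrow> int"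
  define N where "N m = m(p := D * m p - C * m q, q := A * m q - B * m p)" for m :: "nat \<Rightarrow> int"
  have AT: "A * T1 = 1 + C * T2" using AC(1) by simp
  have B': "B = - C * T2 * T2" unfolding B_def AT by simp
  have det: "A * D - B * C = 1"
  proof -
    have "A * D - B * C = (A * T1) * (1 - C * T2) + C * T2 * (C * T2)"
      unfolding B' D_def by (simp add: algebra_simps)
    then show ?thesis unfolding AT by (simp add: algebra_simps)
  qed
  have MN: "M (N m) = m" for m
  proof -
    have "A * (D * m p - C * m q) + C * (A * m q - B * m p) = (A * D - B * C) * m p"
      "B * (D * m p - C * m q) + D * (A * m q - B * m p) = (A * D - B * C) * m q"
      by (simp_all add: algebra_simps)
    then show ?thesis using pq det by (auto simp: M_def N_def)
  qed
  have NM: "N (M m) = m" for m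
  proof -
    have "D * (A * m p + C * m q) - C * (B * m p + D * m q) = (A * D - B * C) * m p"
      "A * (B * m p + D * m q) - B * (A * m p + C * m q) = (A * D - B * C) * m q"
      by (simp_all add: algebra_simps)
    then show ?thesis using pq det by (auto simp: M_def N_def)
  qed
  let ?s = "M s"
  have split: "sum f {1..l} = f p + f q + sum f ({1..l} - {p, q})" for f :: "nat \<Rightarrow> int"
    using pq by (intro sum_pick_two) auto
  have rest: "sum (f(p := x, q := y)) ({1..l} - {p, q}) = sum f ({1..l} - {p, q})" for f :: "nat \<Rightarrow> int" and x y
    by (intro sum.cong) auto
  have t': "t' p = g" "t' q = g * T1 * T2" using pq L by (auto simp: t'_def g_def)
  have in1: "M m \<in> relation_lattice l ?s t'" if "m \<in> relation_lattice l s t" for m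
  proof -
    obtain k z where z: "(\<Sum>i=1..l. z i) = 0" "\<forall>i \<in> {1..l}. m i = k * s i + z i * t i"
      using \<open>m \<in> relation_lattice l s t\<close> by (auto simp: relation_lattice_def)
    let ?z = "z(p := A * T1 * z p + C * T2 * z q, q := (1 - A * T1) * z p + (1 - C * T2) * z q)"
    have "A * T1 * z p + C * T2 * z q + ((1 - A * T1) * z p + (1 - C * T2) * z q) = z p + z q"
      by (simp add: algebra_simps)
    then have "(\<Sum>i=1..l. ?z i) = 0" using z(1) pq unfolding split[of ?z] split[of z] rest by simp
    moreover have "M m i = k * ?s i + ?z i * t' i" if i: "i \<in> {1..l}" for i
    proof -
      have m: "m p = k * s p + z p * (g * T1)" "m q = k * s q + z q * (g * T2)"
        using z(2) pq t1 t2 by auto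
      consider "i = p" | "i = q" | "i \<noteq> p" "i \<noteq> q" by blast
      then show ?thesis
      proof cases
        case 1
        then show ?thesis using pq m t' by (simp add: M_def algebra_simps)
      next
        case 2
        then show ?thesis using pq m t' by (simp add: M_def B_def D_def algebra_simps)
      next
        case 3
        then show ?thesis using z(2) i by (simp add: M_def t'_def)
      qed
    qed
    ultimately show ?thesis unfolding relation_lattice_def by blast
  qed
  have in2: "N m \<in> relation_lattice l s t" if "m \<in> relation_lattice l ?s t'" for m
  proof -
    obtain k z where z: "(\<Sum>i=1..l. z i) = 0" "\<forall>i \<in> {1..l}. m i = k * ?s i + z i * t' i"
      using \<open>m \<in> relation_lattice l ?s t'\<close> by (auto simp: relation_lattice_def)
    \<comment> \<open>The inverse of the substitution of \<open>z\<close> used for the other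
      inclusion.\<close>
    let ?z = "z(p := (1 - C * T2) * z p - C * T2 * z q, q := A * T1 * z q - (1 - A * T1) * z p)"
    have "(1 - C * T2) * z p - C * T2 * z q + (A * T1 * z q - (1 - A * T1) * z p) = z p + z q"
      unfolding AT by (simp add: algebra_simps)
    then have "(\<Sum>i=1..l. ?z i) = 0" using z(1) pq unfolding split[of ?z] split[of z] rest by simp
    moreover have "N m i = k * s i + ?z i * t i" if i: "i \<in> {1..l}" for i
    proof -
      have m: "m p = k * ?s p + z p * g" "m q = k * ?s q + z q * (g * T1 * T2)"
        using z(2) pq t' by auto
      have s: "s p = D * ?s p - C * ?s q" "s q = A * ?s q - B * ?s p"
        using fun_cong[OF NM[of s], of p] fun_cong[OF NM[of s], of q] pq by (simp_all add: N_def)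
      consider "i = p" | "i = q" | "i \<noteq> p" "i \<noteq> q" by blast
      then show ?thesis
      proof cases
        case 1
        have "N m p = k * (D * ?s p - C * ?s q) + ((1 - C * T2) * z p - C * T2 * z q) * (g * T1)"
          using pq m by (simp add: N_def D_def algebra_simps)
        then show ?thesis using 1 pq t1 s(1) by simp
      next
        case 2
        have "N m q = k * (A * ?s q - B * ?s p) + (A * T1 * z q - (1 - A * T1) * z p) * (g * T2)"
          using pq m by (simp add: N_def B_def algebra_simps)
        then show ?thesis using 2 pq t2 s(2) by simp
      next
        case 3
        then show ?thesis using z(2) i by (simp add: N_def M_def t'_def)
      qed
    qed
    ultimately show ?thesis unfolding relation_lattice_def by blast
  qed
  have lattice: "m \<in> relation_lattice l s t \<longleftrightarrow> M m \<in> relation_lattice l ?s t'" for m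
    using in1[of m] in2[of "M m"] NM by auto
  have "presents l s t n" if pres: "presents l ?s t' n" for n
  proof -
    obtain c where c: "\<And>m. m \<in> relation_lattice l ?s t' \<longleftrightarrow> (\<forall>j \<in> {1..l - 1}. n j dvd (\<Sum>i=1..l. c j i * m i))"
      "\<And>y. \<exists>m. \<forall>j \<in> {1..l - 1}. n j dvd (\<Sum>i=1..l. c j i * m i) - y j"
      using pres unfolding presents_def by blast
    define c' where "c' j = (c j)(p := c j p * A + c j q * B, q := c j p * C + c j q * D)" for j
    have c': "(\<Sum>i=1..l. c' j i * m i) = (\<Sum>i=1..l. c j i * M m i)" for j m
    proof -
      have "(\<Sum>i\<in>{1..l} - {p, q}. c' j i * m i) = (\<Sum>i\<in>{1..l} - {p, q}. c j i * M m i)"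
        by (intro sum.cong) (auto simp: c'_def M_def)
      then show ?thesis
        using pq unfolding split[of "\<lambda>i. c' j i * m i"] split[of "\<lambda>i. c j i * M m i"]
        by (simp add: c'_def M_def algebra_simps)
    qed
    have "\<exists>m. \<forall>j \<in> {1..l - 1}. n j dvd (\<Sum>i=1..l. c' j i * m i) - y j" for y
    proof -
      obtain m where m: "\<forall>j \<in> {1..l - 1}. n j dvd (\<Sum>i=1..l. c j i * m i) - y j" using c(2) by blast
      then show ?thesis by (intro exI[of _ "N m"]) (simp only: c' MN)
    qed
    then show ?thesis
      unfolding presents_def by (intro exI[of _ c']) (simp only: lattice c(1) c', blast)
  qed
  moreover have "det_sum l s t = det_sum l ?s t'"
  proof -
    let ?R = "{1..l} - {p, q}"
    have prodR: "prod t' X = prod t X" if "X \<subseteq> ?R" for X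
      using that by (intro prod.cong) (auto simp: t'_def)
    have P: "prod u ({1..l} - {p}) = u q * prod u ?R" "prod u ({1..l} - {q}) = u p * prod u ?R"
      for u :: "nat \<Rightarrow> int"
    proof -
      have eq: "{1..l} - {p} = insert q ?R" "{1..l} - {q} = insert p ?R" using pq by auto
      show "prod u ({1..l} - {p}) = u q * prod u ?R" "prod u ({1..l} - {q}) = u p * prod u ?R"
        unfolding eq by simp_all
    qed
    have Pi: "prod u ({1..l} - {i}) = u p * u q * prod u (?R - {i})" if "i \<in> ?R" for u :: "nat \<Rightarrow> int" and i
    proof -
      have "{1..l} - {i} = insert p (insert q (?R - {i}))" using pq that by auto
      moreover have "prod u (insert p (insert q (?R - {i}))) = u p * (u q * prod u (?R - {i}))"
        using pq by simp
      ultimately show ?thesis by simp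
    qed
    have tt: "t' p * t' q = t p * t q" using t1 t2 t' by (metis mult.assoc mult.left_commute)
    have rest': "(\<Sum>i \<in> ?R. ?s i * prod t' ({1..l} - {i})) = (\<Sum>i \<in> ?R. s i * prod t ({1..l} - {i}))"
      using tt by (intro sum.cong refl) (auto simp: Pi prodR M_def simp del: One_nat_def)
    \<comment> \<open>The terms with \<open>A\<close> and \<open>C\<close> cancel, which leaves the
      old expression.\<close>
    have "?s p * t' q + ?s q * t' p = s p * t q + s q * t p"
    proof -
      have "?s p * t' q + ?s q * t' p = s p * (g * T2) + s q * (g * T1)"
        using pq t' by (simp add: M_def B_def D_def algebra_simps)
      then show ?thesis using t1 t2 by simp
    qed
    then have "(?s p * t' q + ?s q * t' p) * prod t ?R = (s p * t q + s q * t p) * prod t ?R" by simp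
    then show ?thesis
      unfolding det_sum_def split[of "\<lambda>i. s i * prod t ({1..l} - {i})"]
        split[of "\<lambda>i. ?s i * prod t' ({1..l} - {i})"] rest' P prodR[OF subset_refl]
      by (simp add: algebra_simps)
  qed
  moreover have "det_div l t = det_div l t'"
    unfolding t'_def using pq t by (rule det_div_merge)
  moreover have "lcm (t p) (t q) > 0" using t by (intro lcm_pos_int) auto
  then have "coprime_weights l ?s t'"
    using w pq AC(2,3) g unfolding coprime_weights_def
    by (auto simp: M_def t'_def B_def D_def g_def)
  ultimately show ?thesis unfolding reduces_to_def by blast
qed


section \<open>Orders that form a divisibility chain\<close>

definition dvd_chain :: "nat \<Rightarrow> nat \<Rightarrow> (nat \<Rightarrow> int) \<Rightarrow> bool" where
  "dvd_chain l m t \<longleftrightarrow> (\<forall>i \<in> {1..m}. \<forall>j \<in> {i<..l}. t i dvd t j)"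

text \<open>A selection sort with gcd and lcm as the comparator: one round turns entry
  \<open>Suc m\<close> into a divisor of all later ones. Earlier entries divide both arguments of
  each merge, hence also both results.\<close>

lemma reduces_to_dvd_chain:
  assumes "coprime_weights l s t" "m \<le> l"
  shows "\<exists>s' t'. coprime_weights l s' t' \<and> reduces_to l s t s' t' \<and> dvd_chain l m t'"
  using assms(2)
proof (induction m)
  case 0
  then show ?case
    using assms(1) reduces_to_refl[of l s t]
    by (intro exI[of _ s] exI[of _ t]) (simp add: dvd_chain_def)
next
  case (Suc m)
  then obtain s1 t1 where 1: "coprime_weights l s1 t1" "reduces_to l s t s1 t1" "dvd_chain l m t1"
    by auto
  have "\<exists>s' t'. coprime_weights l s' t' \<and> reduces_to l s t s' t' \<and> dvd_chain l m t' \<and>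
      (\<forall>j \<in> {Suc m<..k}. t' (Suc m) dvd t' j)" if "Suc m \<le> k" "k \<le> l" for k
    using that
  proof (induction k rule: dec_induct)
    case base
    then show ?case using 1 by auto
  next
    case (step k)
    then obtain s' t' where IH: "coprime_weights l s' t'" "reduces_to l s t s' t'" "dvd_chain l m t'"
      "\<forall>j \<in> {Suc m<..k}. t' (Suc m) dvd t' j" by auto
    let ?p = "Suc m" and ?q = "Suc k"
    let ?t = "t'(?p := gcd (t' ?p) (t' ?q), ?q := lcm (t' ?p) (t' ?q))"
    have pq: "?p \<in> {1..l}" "?q \<in> {1..l}" "?p \<noteq> ?q" using step Suc by auto
    obtain s'' where s'': "coprime_weights l s'' ?t" "reduces_to l s' t' s'' ?t"
      using reduces_to_merge[OF IH(1) pq] by blast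
    have old: "t' i dvd t' j" if "i \<in> {1..m}" "j \<in> {i<..l}" for i j
      using IH(3) that unfolding dvd_chain_def by blast
    have "dvd_chain l m ?t"
      unfolding dvd_chain_def
    proof (intro ballI)
      fix i j assume ij: "i \<in> {1..m}" "j \<in> {i<..l}"
      have i: "?t i = t' i" using ij step by auto
      have "t' i dvd gcd (t' ?p) (t' ?q)"
        using old[of i ?p] old[of i ?q] ij pq step by auto
      moreover from this have "t' i dvd lcm (t' ?p) (t' ?q)"
        by (meson dvd_lcm1 dvd_trans gcd_dvd1)
      ultimately show "?t i dvd ?t j" using old[OF ij] unfolding i by simp
    qed
    moreover have "?t ?p dvd ?t j" if j: "j \<in> {?p<..?q}" for j
    proof (cases "j = ?q")
      case True
      have "gcd (t' ?p) (t' ?q) dvd lcm (t' ?p) (t' ?q)" by (meson dvd_lcm1 dvd_trans gcd_dvd1)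
      then show ?thesis using True pq by simp
    next
      case False
      then have "t' ?p dvd t' j" using IH(4) j by auto
      then have "gcd (t' ?p) (t' ?q) dvd t' j" by (meson dvd_trans gcd_dvd1)
      then show ?thesis using False j pq by simp
    qed
    ultimately show ?case using s'' reduces_to_trans[OF IH(2) s''(2)] by blast
  qed
  from this[of l] obtain s' t' where 2: "coprime_weights l s' t'" "reduces_to l s t s' t'"
    "dvd_chain l m t'" "\<forall>j \<in> {Suc m<..l}. t' (Suc m) dvd t' j"
    using Suc.prems by auto
  then have "dvd_chain l (Suc m) t'"
    unfolding dvd_chain_def by (auto simp: le_Suc_eq)
  then show ?case using 2 by blast
qed

lemma dvd_chain_mono: "dvd_chain l l t \<Longrightarrow> i \<in> {1..l} \<Longrightarrow> j \<in> {i..l} \<Longrightarrow> t i dvd t j"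
  unfolding dvd_chain_def by (cases "i = j") auto

text \<open>The largest element of \<open>I\<close> is at least \<open>card I\<close>, so its factor
  is a multiple of \<open>t (card I)\<close>; then it is removed.\<close>

lemma prod_initial_dvd:
  assumes "dvd_chain l l t" "I \<subseteq> {1..l}"
  shows "(\<Prod>i=1..card I. t i) dvd prod t I"
  using assms(2)
proof (induction "card I" arbitrary: I)
  case 0
  then show ?case by simp
next
  case (Suc j)
  have fin: "finite I" using Suc.prems finite_subset by blast
  let ?x = "Max I"
  have x: "?x \<in> I" using Suc.hyps(2) fin by (metis Max_in card.empty Zero_not_Suc)
  have I': "card (I - {?x}) = j" "I - {?x} \<subseteq> {1..l}" using x Suc fin by auto
  have "I \<subseteq> {1..?x}" using Suc.prems fin by auto
  then have "Suc j \<le> ?x" using card_mono[of "{1..?x}" I] Suc.hyps(2) by simp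
  then have "t (Suc j) dvd t ?x"
    using x Suc.prems by (intro dvd_chain_mono[OF assms(1)]) auto
  moreover have "(\<Prod>i=1..j. t i) dvd prod t (I - {?x})"
    using Suc.hyps(1)[of "I - {?x}"] I' by simp
  ultimately have "(\<Prod>i=1..j. t i) * t (Suc j) dvd prod t (I - {?x}) * t ?x"
    by (intro mult_dvd_mono)
  also have "prod t (I - {?x}) * t ?x = prod t I"
    using prod.remove[OF fin x, of t] by (simp add: mult.commute)
  finally show ?case unfolding Suc.hyps(2)[symmetric] by simp
qed

lemma det_div_chain:
  assumes "dvd_chain l l t" "\<And>i. i \<in> {1..l} \<Longrightarrow> t i > 0" "j \<le> l"
  shows "det_div l t j = (\<Prod>i=1..j. t i)"
proof (rule associated_eqI)
  show "det_div l t j dvd (\<Prod>i=1..j. t i)"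
    unfolding det_div_def by (rule Gcd_dvd) (use assms(3) in \<open>auto intro!: exI[of _ "{1..j}"]\<close>)
  show "(\<Prod>i=1..j. t i) dvd det_div l t j"
    unfolding det_div_def by (rule Gcd_greatest) (use prod_initial_dvd[OF assms(1)] in blast)
  have "(\<Prod>i=1..j. t i) > 0" using assms by (intro prod_pos) auto
  then show "normalize (\<Prod>i=1..j. t i) = (\<Prod>i=1..j. t i)" by simp
qed (simp add: det_div_def)

text \<open>The functional \<open>D\<close> turns \<open>k * s i + z i * t i\<close> into
  \<open>k * c\<close>, since the \<open>z i\<close> add up to 0. So membership means
  \<open>m i\<close> congruent to \<open>k * s i\<close> modulo \<open>t i\<close> for
  \<open>i < l\<close>, together with \<open>D m = k * c\<close>. As \<open>\<rho>\<close> inverts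
  \<open>s (l - 1)\<close> modulo \<open>t (l - 1)\<close>, the multiplier \<open>k\<close> is
  \<open>\<rho> * m (l - 1)\<close> up to a multiple of \<open>t (l - 1)\<close>; eliminating it
  leaves \<open>l - 1\<close> congruences.\<close>

lemma presents_dvd_chain:
  assumes l: "l \<ge> 2" and w: "coprime_weights l s t" and chain: "dvd_chain l l t"
  defines "c \<equiv> \<Sum>i=1..l. s i * (t l div t i)"
  shows "presents l s t (\<lambda>j. if j < l - 1 then t j else t (l - 1) * c)"
    "det_sum l s t = t (l - 1) * c * (\<Prod>i=1..l - 2. t i)"
proof -
  let ?k = "l - 1"
  have k: "?k \<in> {1..l}" "Suc ?k = l" "?k \<noteq> l" using l by auto
  have pos: "t i > 0" if "i \<in> {1..l}" for i using w that by (simp add: coprime_weights_def)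
  have quot: "t l div t i * t i = t l" if "i \<in> {1..l}" for i
    using dvd_chain_mono[OF chain that, of l] that by simp
  have split: "sum f {1..l} = sum f {1..?k} + f l" for f :: "nat \<Rightarrow> int"
    using sum.cl_ivl_Suc[of f 1 ?k] k by simp
  have "coprime (s ?k) (t ?k)" using w k by (simp add: coprime_weights_def)
  then obtain \<rho> where "\<exists>y. \<rho> * s ?k + y * t ?k = 1"
    using bezout_int[of "s ?k" "t ?k"] by (auto simp: coprime_iff_gcd_eq_1)
  then obtain y where "\<rho> * s ?k + y * t ?k = 1" by blast
  then have \<rho>: "1 - \<rho> * s ?k = t ?k * y" by (simp add: algebra_simps)
  define D where "D m = (\<Sum>i=1..l. (t l div t i) * m i)" for m :: "nat \<Rightarrow> int"
  define C :: "nat \<Rightarrow> nat \<Rightarrow> int" where "C j i =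
    (if j < ?k then (if i = j then 1 else 0) - (if i = ?k then \<rho> * s j else 0)
     else t l div t i - (if i = ?k then c * \<rho> else 0))" for j i
  let ?n = "\<lambda>j. if j < ?k then t j else t ?k * c"
  have C1: "(\<Sum>i=1..l. C j i * m i) = m j - \<rho> * s j * m ?k" if "j \<in> {1..?k}" "j < ?k" for j m
  proof -
    have "(\<Sum>i=1..l. C j i * m i) = (\<Sum>i=1..l. (if i = j then m i else 0) - (if i = ?k then \<rho> * s j * m i else 0))"
      using that by (intro sum.cong) (auto simp: C_def)
    then show ?thesis using that k by (simp add: sum_subtractf del: One_nat_def)
  qed
  have C2: "(\<Sum>i=1..l. C ?k i * m i) = D m - c * \<rho> * m ?k" for m
  proof -
    have "(\<Sum>i=1..l. C ?k i * m i) = (\<Sum>i=1..l. (t l div t i) * m i - (if i = ?k then c * \<rho> * m i else 0))"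
      by (intro sum.cong) (auto simp: C_def algebra_simps)
    then show ?thesis using k by (simp add: sum_subtractf D_def del: One_nat_def)
  qed
  have Dz: "D (\<lambda>i. k * s i + z i * t i) = k * c + t l * sum z {1..l}" for k z
  proof -
    have "D (\<lambda>i. k * s i + z i * t i) = (\<Sum>i=1..l. k * (s i * (t l div t i)) + t l * z i)"
      unfolding D_def
    proof (intro sum.cong refl)
      fix i assume "i \<in> {1..l}"
      have "t l div t i * (k * s i + z i * t i) = k * (s i * (t l div t i)) + (t l div t i * t i) * z i"
        by (simp add: algebra_simps)
      then show "t l div t i * (k * s i + z i * t i) = k * (s i * (t l div t i)) + t l * z i"
        unfolding quot[OF \<open>i \<in> {1..l}\<close>] .
    qed
    then show ?thesis by (simp add: sum.distrib sum_distrib_left c_def)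
  qed
  have D_cong: "D m = D m'" if "\<And>i. i \<in> {1..l} \<Longrightarrow> m i = m' i" for m m'
    unfolding D_def using that by (intro sum.cong) auto
  have in1: "?n j dvd (\<Sum>i=1..l. C j i * m i)" if m: "m \<in> relation_lattice l s t" and j: "j \<in> {1..?k}" for m j
  proof -
    obtain k z where z: "(\<Sum>i=1..l. z i) = 0" "\<forall>i \<in> {1..l}. m i = k * s i + z i * t i"
      using m by (auto simp: relation_lattice_def)
    have mk: "m ?k = k * s ?k + z ?k * t ?k" using z(2) k by blast
    show ?thesis
    proof (cases "j < ?k")
      case True
      have "m j - \<rho> * s j * m ?k = k * s j * (1 - \<rho> * s ?k) + t j * z j - \<rho> * s j * z ?k * t ?k"
        using z(2) mk j by (auto simp: algebra_simps)
      moreover have "t j dvd t ?k" using dvd_chain_mono[OF chain, of j ?k] True j k by auto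
      ultimately have "t j dvd m j - \<rho> * s j * m ?k" unfolding \<rho> by simp
      then show ?thesis using True C1[OF j True] by simp
    next
      case False
      then have jk: "j = ?k" using j by auto
      have "D m = k * c" using D_cong[of m "\<lambda>i. k * s i + z i * t i"] z Dz[of k z] by simp
      then have "D m - c * \<rho> * m ?k = c * (k * (1 - \<rho> * s ?k) - \<rho> * z ?k * t ?k)"
        unfolding mk by (simp add: algebra_simps)
      also have "\<dots> = t ?k * c * (k * y - \<rho> * z ?k)" unfolding \<rho> by (simp add: algebra_simps)
      finally show ?thesis using jk C2 by simp
    qed
  qed
  have in2: "m \<in> relation_lattice l s t"
    if m: "\<forall>j \<in> {1..?k}. ?n j dvd (\<Sum>i=1..l. C j i * m i)" for m
  proof -
    have "?n ?k dvd (\<Sum>i=1..l. C ?k i * m i)" using m k l by (intro bspec[OF m]) auto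
    then obtain x where "D m - c * \<rho> * m ?k = t ?k * c * x" unfolding C2 by auto
    then have Dm: "D m = c * (\<rho> * m ?k + t ?k * x)" by (simp add: algebra_simps)
    \<comment> \<open>The multiplier of the relation \<open>s\<close>, recovered from the last
      congruence.\<close>
    define r where "r = \<rho> * m ?k + t ?k * x"
    have "t i dvd m i - r * s i" if i: "i \<in> {1..?k}" for i
    proof (cases "i = ?k")
      case True
      have "m ?k - r * s ?k = m ?k * (1 - \<rho> * s ?k) - t ?k * x * s ?k"
        by (simp add: r_def algebra_simps)
      then show ?thesis using True unfolding \<rho> by simp
    next
      case False
      then have ik: "i < ?k" using i by auto
      then have "t i dvd m i - \<rho> * s i * m ?k" using bspec[OF m i] unfolding C1[OF i ik] by simp
      moreover have "t i dvd t ?k" using dvd_chain_mono[OF chain, of i ?k] i k by auto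
      ultimately have "t i dvd m i - \<rho> * s i * m ?k - t ?k * (x * s i)"
        by (rule dvd_diff[OF _ dvd_mult2])
      moreover have "m i - r * s i = m i - \<rho> * s i * m ?k - t ?k * (x * s i)"
        by (simp add: r_def algebra_simps)
      ultimately show ?thesis by (simp only:)
    qed
    then have "\<forall>i \<in> {1..?k}. \<exists>z. m i = r * s i + z * t i"
      by (metis add_diff_cancel_left' add_diff_eq dvdE mult.commute)
    then obtain z0 where z0: "\<forall>i \<in> {1..?k}. m i = r * s i + z0 i * t i" by metis
    \<comment> \<open>The last entry makes the sum 0. The coordinate \<open>m l\<close> then agrees
      automatically, because it has the coefficient 1 in \<open>D\<close> and the values of
      \<open>D\<close> coincide.\<close>
    define z where "z = z0(l := - sum z0 {1..?k})"
    have zk: "z i = z0 i" if "i \<in> {1..?k}" for i using that k by (auto simp: z_def)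
    have sz: "sum z {1..l} = 0"
      unfolding split using zk by (simp add: z_def)
    let ?m = "\<lambda>i. r * s i + z i * t i"
    have mm: "m i = ?m i" if "i \<in> {1..?k}" for i using z0 zk that by simp
    have "D ?m = D m" unfolding Dz sz Dm r_def by simp
    then have "(t l div t l) * ?m l = (t l div t l) * m l"
      unfolding D_def split using mm by simp
    then have "?m l = m l" using pos[of l] l by simp
    then have "\<forall>i \<in> {1..l}. m i = ?m i" using mm k by (metis atLeastAtMost_iff le_Suc_eq)
    then show ?thesis unfolding relation_lattice_def using sz by blast
  qed
  have "\<exists>m. \<forall>j \<in> {1..?k}. ?n j dvd (\<Sum>i=1..l. C j i * m i) - y j" for y
  proof -
    \<comment> \<open>The coordinate \<open>l - 1\<close> is set to 0, so that all corrections by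
      \<open>\<rho>\<close> vanish; the coordinate \<open>l\<close> adjusts the value of
      \<open>D\<close>.\<close>
    define m0 where "m0 i = (if i < ?k then y i else 0)" for i
    define m where "m = m0(l := y ?k - (\<Sum>i=1..?k. (t l div t i) * m0 i))"
    have "(\<Sum>i=1..?k. (t l div t i) * m i) = (\<Sum>i=1..?k. (t l div t i) * m0 i)"
      using k by (intro sum.cong) (auto simp: m_def)
    moreover have "t l div t l = 1" "m l = y ?k - (\<Sum>i=1..?k. (t l div t i) * m0 i)"
      using pos[of l] l by (simp_all add: m_def)
    ultimately have "D m = y ?k" unfolding D_def split by simp
    moreover have "m ?k = 0" "\<And>j. j < ?k \<Longrightarrow> m j = y j" using k by (auto simp: m_def m0_def)
    ultimately have "(\<Sum>i=1..l. C j i * m i) = y j" if "j \<in> {1..?k}" for j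
      using that C1[of j m] C2[of m] by (cases "j < ?k") auto
    then show ?thesis by (intro exI[of _ m]) simp
  qed
  then show "presents l s t ?n"
    unfolding presents_def using in1 in2 by blast
  show "det_sum l s t = t ?k * c * (\<Prod>i=1..l - 2. t i)"
  proof -
    let ?P = "\<Prod>i=1..?k. t i"
    have all: "prod t {1..l} = ?P * t l"
      using prod.cl_ivl_Suc[of t 1 ?k] k by simp
    have "prod t ({1..l} - {i}) = (t l div t i) * ?P" if i: "i \<in> {1..l}" for i
    proof -
      have "t i * prod t ({1..l} - {i}) = ?P * t l"
        unfolding all[symmetric] using i by (intro prod.remove[symmetric]) auto
      also have "\<dots> = t i * ((t l div t i) * ?P)"
        using quot[OF i] by (metis mult.commute mult.left_commute)
      finally show ?thesis using pos[OF i] by simp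
    qed
    then have "det_sum l s t = c * ?P"
      unfolding det_sum_def c_def sum_distrib_right by (intro sum.cong) (auto simp: mult.assoc)
    moreover have "?P = (\<Prod>i=1..l - 2. t i) * t ?k"
      using prod.cl_ivl_Suc[of t 1 "l - 2"] l by (simp add: numeral_2_eq_2 Suc_diff_Suc)
    ultimately show ?thesis by simp
  qed
qed

lemma presents_det_div:
  assumes l: "l \<ge> 3" and w: "coprime_weights l s t" and "det_sum l s t > 0"
  defines "n \<equiv> \<lambda>j. if j = 1 then det_div l t 1
    else if j \<le> l - 2 then det_div l t j div det_div l t (j - 1)
    else det_sum l s t div det_div l t (l - 2)"
  shows "presents l s t n" "\<And>j. j \<in> {1..l - 1} \<Longrightarrow> n j > 0"
proof -
  obtain s' t' where r: "coprime_weights l s' t'" "reduces_to l s t s' t'" "dvd_chain l l t'"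
    using reduces_to_dvd_chain[OF w order_refl] by blast
  let ?c = "\<Sum>i=1..l. s' i * (t' l div t' i)"
  have pos: "t' i > 0" if "i \<in> {1..l}" for i using r(1) that by (simp add: coprime_weights_def)
  have pp: "(\<Prod>i=1..j. t' i) > 0" if "j \<le> l" for j using pos that by (intro prod_pos) auto
  have dd: "det_div l t j = (\<Prod>i=1..j. t' i)" if "j \<le> l" for j
    using det_div_chain[OF r(3) pos that] r(2) by (simp add: reduces_to_def)
  have ds: "det_sum l s t = t' (l - 1) * ?c * (\<Prod>i=1..l - 2. t' i)"
    using presents_dvd_chain(2)[OF _ r(1,3)] l r(2) by (simp add: reduces_to_def)
  have "presents l s' t' (\<lambda>j. if j < l - 1 then t' j else t' (l - 1) * ?c)"
    using presents_dvd_chain(1)[OF _ r(1,3)] l by simp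
  then have P: "presents l s t (\<lambda>j. if j < l - 1 then t' j else t' (l - 1) * ?c)"
    using r(2) by (simp add: reduces_to_def)
  have n: "n j = (if j < l - 1 then t' j else t' (l - 1) * ?c)" if j: "j \<in> {1..l - 1}" for j
  proof -
    consider "j = 1" | "j \<noteq> 1" "j < l - 1" | "j \<noteq> 1" "j = l - 1" using j by force
    then show ?thesis
    proof cases
      case 1
      moreover have "1 < l - 1" using l by linarith
      ultimately show ?thesis using dd[of 1] by (simp add: n_def)
    next
      case 2
      then obtain i where i: "j = Suc i" "i \<ge> 1" using j by (cases j) auto
      have "det_div l t j = det_div l t i * t' j" using dd[of j] dd[of i] i 2 by simp
      moreover have "det_div l t i > 0" using dd[of i] pp[of i] i 2 by simp
      moreover have "j \<le> l - 2" using 2 by linarith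
      ultimately show ?thesis using 2 i by (simp add: n_def)
    next
      case 3
      have "det_div l t (l - 2) > 0" "det_sum l s t = t' (l - 1) * ?c * det_div l t (l - 2)"
        using dd[of "l - 2"] pp[of "l - 2"] ds by auto
      then show ?thesis using 3 l by (simp add: n_def)
    qed
  qed
  then show "presents l s t n" by (rule presents_cong[OF P])
  fix j assume j: "j \<in> {1..l - 1}"
  \<comment> \<open>The weights \<open>s'\<close> may have become negative; the sign of the last
    order is recovered from the invariant \<open>det_sum\<close>.\<close>
  have "t' (l - 1) * ?c > 0"
    using ds assms(3) pp[of "l - 2"] by (simp add: zero_less_mult_iff)
  then show "n j > 0" unfolding n[OF j] using pos[of j] j by auto
qed


section \<open>Cycles, trees and Laplacians of multigraphs\<close>

lemma conn_simple_path:
  assumes "(x, y) \<in> conn en T"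
  shows "\<exists>n p f. inj_on p {..n} \<and> p 0 = x \<and> p n = y \<and>
    (\<forall>i < n. f i \<in> T \<and> en (f i) = {p i, p (Suc i)})"
  using assms unfolding conn_def
proof (induction rule: rtrancl_induct)
  case base
  then show ?case by (intro exI[of _ 0] exI[of _ "\<lambda>_. x"]) simp
next
  case (step y z)
  then obtain n p f where path: "inj_on p {..n}" "p 0 = x" "p n = y"
    "\<forall>i < n. f i \<in> T \<and> en (f i) = {p i, p (Suc i)}" by blast
  obtain e where e: "e \<in> T" "en e = {y, z}" using step.hyps(2) by auto
  show ?case
  proof (cases "z \<in> p ` {..n}")
    case True
    then obtain k where k: "k \<le> n" "z = p k" by auto
    have "inj_on p {..k}" by (rule inj_on_subset[OF path(1)]) (use k in auto)
    then show ?thesis using path k by (intro exI[of _ k] exI[of _ p] exI[of _ f]) auto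
  next
    case False
    let ?p = "p(Suc n := z)" and ?f = "f(n := e)"
    have "inj_on ?p {..Suc n}"
      using False path(1) unfolding atMost_Suc by (auto simp: inj_on_def)
    moreover have "?f i \<in> T \<and> en (?f i) = {?p i, ?p (Suc i)}" if "i < Suc n" for i
      using path(3,4) e that by (cases "i = n") auto
    moreover have "?p 0 = x" "?p (Suc n) = z" using path(2) by simp_all
    ultimately show ?thesis by blast
  qed
qed

text \<open>A cycle is an edge together with a simple path between its ends that avoids it. A path
  with one edge gives the cycles formed by two parallel edges.\<close>

lemma cycle_iff_not_forest:
  assumes T: "\<forall>e \<in> T. card (en e) = 2 \<and> en e \<subseteq> V"
    and G: "verts G = V" "edges G = T" "ends G = en"
  shows "(\<exists>vs es. is_cycle G vs es) \<longleftrightarrow> \<not> forest en T"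
proof
  assume "\<exists>vs es. is_cycle G vs es"
  then obtain vs es where C: "is_cycle G vs es" by blast
  define n where "n = length es"
  have n: "length vs = n" "n > 0" "length es = n"
    using C by (auto simp: is_cycle_def n_def)
  have dist: "distinct es" and esT: "set es \<subseteq> T"
    and en: "\<And>i. i < n \<Longrightarrow> en (es ! i) = {vs ! i, vs ! (Suc i mod n)}"
    using C n unfolding is_cycle_def G by auto
  let ?e = "es ! (n - 1)"
  have e: "?e \<in> T" using esT n by auto
  have en_e: "en ?e = {vs ! (n - 1), vs ! 0}" using en[of "n - 1"] n by simp
  have "(vs ! 0, vs ! i) \<in> conn en (T - {?e})" if "i < n" for i
    using that
  proof (induction i)
    case (Suc i)
    have "es ! i \<in> T - {?e}"
      using Suc.prems esT dist n by (auto simp: nth_eq_iff_index_eq)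
    moreover have "en (es ! i) = {vs ! i, vs ! Suc i}" using en[of i] Suc.prems by simp
    ultimately have "(vs ! i, vs ! Suc i) \<in> conn en (T - {?e})" by (rule conn_edge)
    then show ?case using Suc conn_trans by (metis Suc_lessD)
  qed simp
  then have "(vs ! (n - 1), vs ! 0) \<in> conn en (T - {?e})" using n by (simp add: conn_sym)
  then show "\<not> forest en T" unfolding forest_def using e en_e by blast
next
  assume "\<not> forest en T"
  then obtain e x y where e: "e \<in> T" "en e = {x, y}" "(x, y) \<in> conn en (T - {e})"
    by (auto simp: forest_def)
  obtain n p f where path: "inj_on p {..n}" "p 0 = x" "p n = y"
    "\<forall>i < n. f i \<in> T - {e} \<and> en (f i) = {p i, p (Suc i)}"
    using conn_simple_path[OF e(3)] by blast
  have xy: "x \<noteq> y" using T e by (auto simp: card_insert_if)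
  note peq = inj_on_eq_iff[OF path(1)]
  define vs where "vs = map p [0..<Suc n]"
  define es where "es = map f [0..<n] @ [e]"
  have inj_f: "inj_on f {..<n}"
  proof (rule inj_onI)
    fix i j assume "i \<in> {..<n}" "j \<in> {..<n}" "f i = f j"
    moreover from this have "{p i, p (Suc i)} = {p j, p (Suc j)}"
      using path(4) by (metis lessThan_iff)
    ultimately have "i = j \<and> Suc i = Suc j \<or> i = Suc j \<and> Suc i = j"
      by (auto simp: doubleton_eq_iff peq)
    then show "i = j" by linarith
  qed
  have pV: "p i \<in> V" if "i \<le> n" for i
  proof (cases "i = n")
    case True
    then show ?thesis using T e path(3) by blast
  next
    case False
    then have "f i \<in> T" "p i \<in> en (f i)" using path(4) that by auto
    then show ?thesis using T by blast
  qed
  have "is_cycle G vs es"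
    unfolding is_cycle_def G
  proof (intro conjI allI impI)
    have "inj_on p (set [0..<Suc n])" by (rule inj_on_subset[OF path(1)]) auto
    then show "distinct vs" unfolding vs_def distinct_map using distinct_upt by blast
    have "e \<notin> f ` {..<n}" using path(4) by blast
    then show "distinct es" using inj_f unfolding es_def by (auto simp: distinct_map atLeast0LessThan)
    show "set vs \<subseteq> V" using pV by (auto simp: vs_def simp del: upt_Suc)
    show "set es \<subseteq> T" using path(4) e(1) by (auto simp: es_def)
    fix i assume "i < length es"
    then have "i \<le> n" by (simp add: es_def)
    then show "en (es ! i) = {vs ! i, vs ! (Suc i mod length vs)}"
    proof (cases "i = n")
      case True
      then show ?thesis using e(2) path(2,3) by (auto simp: es_def vs_def nth_append simp del: upt_Suc)
    next
      case False
      then show ?thesis using path(4) \<open>i \<le> n\<close> by (simp add: es_def vs_def nth_append del: upt_Suc)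
    qed
  qed (auto simp: vs_def es_def)
  then show "\<exists>vs es. is_cycle G vs es" by blast
qed

lemma num_spanning_trees_eq:
  assumes "\<forall>e \<in> edges G. card (ends G e) = 2 \<and> ends G e \<subseteq> verts G"
  shows "num_spanning_trees G = card (trees (ends G) (verts G) (edges G))"
proof -
  have "is_tree (G\<lparr>edges := T\<rparr>) \<longleftrightarrow>
      forest (ends G) T \<and> (\<forall>u \<in> verts G. \<forall>v \<in> verts G. (u, v) \<in> conn (ends G) T)"
    if "T \<subseteq> edges G" for T
  proof -
    have "(\<nexists>vs es. is_cycle (G\<lparr>edges := T\<rparr>) vs es) \<longleftrightarrow> forest (ends G) T"
    proof -
      have "\<forall>e \<in> T. card (ends G e) = 2 \<and> ends G e \<subseteq> verts G" using assms that by auto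
      then show ?thesis using cycle_iff_not_forest[of T "ends G" "verts G" "G\<lparr>edges := T\<rparr>"] by auto
    qed
    then show ?thesis unfolding is_tree_def is_connected_def conn_def by auto
  qed
  then have "{T. T \<subseteq> edges G \<and> is_tree (G\<lparr>edges := T\<rparr>)} = trees (ends G) (verts G) (edges G)"
    unfolding trees_def by blast
  then show ?thesis by (simp add: num_spanning_trees_def)
qed

lemma laplacian_sum:
  assumes "finite (verts G)" "finite (edges G)"
    "\<forall>e \<in> edges G. card (ends G e) = 2 \<and> ends G e \<subseteq> verts G" "u \<in> verts G"
  shows "(\<Sum>v \<in> verts G. laplacian G u v * y v) = lap_op (ends G) (edges G) y u"
proof -
  let ?E = "edges G" and ?V = "verts G"
  let ?c = "\<lambda>e v. if u = v then (if v \<in> ends G e then 1 else 0)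
    else - (if ends G e = {u, v} then 1 else (0::int))"
  have card: "int (card {e \<in> ?E. Q e}) = (\<Sum>e \<in> ?E. if Q e then 1 else 0)" for Q
    using assms(2) by (simp add: sum.If_cases Int_def)
  have "laplacian G u v = (\<Sum>e \<in> ?E. ?c e v)" for v
    unfolding laplacian_def card by (simp add: sum_negf)
  then have "(\<Sum>v \<in> ?V. laplacian G u v * y v) = (\<Sum>v \<in> ?V. \<Sum>e \<in> ?E. ?c e v * y v)"
    by (simp add: sum_distrib_right)
  also have "\<dots> = (\<Sum>e \<in> ?E. \<Sum>v \<in> ?V. ?c e v * y v)" by (rule sum.swap)
  also have "\<dots> = lap_op (ends G) ?E y u"
    unfolding lap_op_def
  proof (intro sum.cong refl)
    fix e assume e: "e \<in> ?E"
    show "(\<Sum>v \<in> ?V. ?c e v * y v) = (if u \<in> ends G e then 2 * y u - sum y (ends G e) else 0)"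
    proof (cases "u \<in> ends G e")
      case False
      then have "?c e v = 0" for v by auto
      then show ?thesis using False by simp
    next
      case True
      obtain w where w: "ends G e = {u, w}" "u \<noteq> w"
        using assms(3) e True unfolding card_2_iff by (metis (no_types, lifting) doubleton_eq_iff insertE singletonD)
      then have wV: "w \<in> ?V" using assms(3) e by auto
      have "(\<Sum>v \<in> ?V. ?c e v * y v) = (\<Sum>v \<in> ?V. (if v = u then y u else 0) - (if v = w then y w else 0))"
        using w by (intro sum.cong) (auto simp: doubleton_eq_iff)
      also have "\<dots> = y u - y w" using assms(1,4) wV by (simp add: sum_subtractf)
      finally show ?thesis using w by simp
    qed
  qed
  finally show ?thesis .
qed

lemma lap_op_add_const:
  assumes "\<forall>e \<in> E. card (en e) = 2"
  shows "lap_op en E (\<lambda>u. y u + d) u = lap_op en E y u"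
  unfolding lap_op_def using assms by (intro sum.cong refl) (simp add: sum.distrib)


section \<open>Cycles of networks\<close>

lemma ladder_net_edges_nonempty: "ladder_net en V E a b s t \<Longrightarrow> E \<noteq> {}"
  by (induction rule: ladder_net.induct) auto

lemma det_sum_Suc:
  "det_sum (Suc n) s t = s (Suc n) * (\<Prod>j=1..n. t j) + t (Suc n) * det_sum n s t"
proof -
  have "(\<Sum>i=1..n. s i * prod t ({1..Suc n} - {i})) = (\<Sum>i=1..n. t (Suc n) * (s i * prod t ({1..n} - {i})))"
  proof (intro sum.cong refl)
    fix i assume "i \<in> {1..n}"
    then have "{1..Suc n} - {i} = insert (Suc n) ({1..n} - {i})" by auto
    then show "s i * prod t ({1..Suc n} - {i}) = t (Suc n) * (s i * prod t ({1..n} - {i}))" by simp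
  qed
  moreover have "{1..Suc n} - {Suc n} = {1..n}" by auto
  ultimately show ?thesis by (simp add: det_sum_def sum_distrib_left)
qed

text \<open>\<open>v (Suc l)\<close> is a second name of \<open>v 1\<close>, so that every network
  runs from \<open>v i\<close> to \<open>v (Suc i)\<close> without reduction modulo
  \<open>l\<close>.\<close>

locale net_cycle =
  fixes l :: nat and en :: "'e \<Rightarrow> 'v set" and W :: "nat \<Rightarrow> 'v set" and D :: "nat \<Rightarrow> 'e set"
    and v :: "nat \<Rightarrow> 'v" and s t :: "nat \<Rightarrow> nat"
  assumes l: "l \<ge> 2"
    and net: "\<And>i. i \<in> {1..l} \<Longrightarrow> ladder_net en (W i) (D i) (v i) (v (Suc i)) (s i) (t i)"
    and v_inj: "inj_on v {1..l}" and v_last: "v (Suc l) = v 1"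
    and W_v: "\<And>i. i \<in> {1..l} \<Longrightarrow> W i \<inter> v ` {1..l} = {v i, v (Suc i)}"
    and W_disj: "\<And>i j. i \<in> {1..l} \<Longrightarrow> j \<in> {1..l} \<Longrightarrow> i \<noteq> j \<Longrightarrow> W i \<inter> W j \<subseteq> v ` {1..l}"
    and D_disj: "\<And>i j. i \<in> {1..l} \<Longrightarrow> j \<in> {1..l} \<Longrightarrow> i \<noteq> j \<Longrightarrow> D i \<inter> D j = {}"
begin

abbreviation "VF \<equiv> \<Union>i \<in> {1..l}. W i"
abbreviation "EF \<equiv> \<Union>i \<in> {1..l}. D i"

lemma v_eq: "i \<in> {1..l} \<Longrightarrow> j \<in> {1..l} \<Longrightarrow> v i = v j \<longleftrightarrow> i = j"
  using inj_on_eq_iff[OF v_inj] .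

lemma v_in: "i \<in> {1..l} \<Longrightarrow> v i \<in> W i" "i \<in> {1..l} \<Longrightarrow> v (Suc i) \<in> W i"
  using ladder_net_terminals[OF net] by auto

lemma finite_W: "i \<in> {1..l} \<Longrightarrow> finite (W i)" and finite_D: "i \<in> {1..l} \<Longrightarrow> finite (D i)"
  using ladder_net_finite[OF net] by auto

lemma ends_D: "i \<in> {1..l} \<Longrightarrow> \<forall>e \<in> D i. card (en e) = 2 \<and> en e \<subseteq> W i"
  using ladder_net_ends[OF net] by blast

lemma W_meet:
  assumes "i \<in> {1..l}" "j \<in> {1..l}" "i \<noteq> j" "u \<in> W i" "u \<in> W j"
  shows "u \<in> {v i, v (Suc i)} \<inter> {v j, v (Suc j)}"
  using W_disj[OF assms(1-3)] W_v[OF assms(1)] W_v[OF assms(2)] assms(4,5) by blast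

text \<open>The networks in a row, before the cycle is closed. The vertex \<open>v 1\<close> is
  listed separately so that the empty row is a single vertex.\<close>

lemma card_trees_prefix:
  assumes "i \<le> l - 1"
  shows "card (trees en ({v 1} \<union> (\<Union>j \<in> {1..i}. W j)) (\<Union>j \<in> {1..i}. D j)) = (\<Prod>j=1..i. t j) \<and>
    int (card (two_forests en ({v 1} \<union> (\<Union>j \<in> {1..i}. W j)) (\<Union>j \<in> {1..i}. D j) (v 1) (v (Suc i)))) =
      det_sum i (\<lambda>j. int (s j)) (\<lambda>j. int (t j))"
  using assms
proof (induction i)
  case 0
  have "trees en {v 1} {} = {{}}" by (auto simp: trees_def)
  then show ?case by (simp add: det_sum_def)
next
  case (Suc i)
  let ?V = "{v 1} \<union> (\<Union>j \<in> {1..i}. W j)" and ?E = "\<Union>j \<in> {1..i}. D j"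
  have IH: "card (trees en ?V ?E) = (\<Prod>j=1..i. t j)"
    "int (card (two_forests en ?V ?E (v 1) (v (Suc i)))) = det_sum i (\<lambda>j. int (s j)) (\<lambda>j. int (t j))"
    using Suc by auto
  have i: "Suc i \<in> {1..l}" "Suc i < l" using Suc.prems l by auto
  have fin: "finite ?E" using i by (intro finite_UN_I finite_D) auto
  have sub: "\<forall>e \<in> ?E. en e \<subseteq> ?V" using ends_D i by fastforce
  have "W (Suc i) \<inter> ?V = {v (Suc i)}"
  proof (intro equalityI subsetI)
    fix u assume u: "u \<in> W (Suc i) \<inter> ?V"
    have "u \<noteq> v (Suc (Suc i))"
    proof
      assume eq: "u = v (Suc (Suc i))"
      consider "u = v 1" | j where "j \<in> {1..i}" "u \<in> W j" using u by blast
      then show False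
      proof cases
        case 1
        then show False using eq v_eq[of "Suc (Suc i)" 1] i l by auto
      next
        case 2
        then have j: "j \<in> {1..l}" "j \<noteq> Suc i" using i by auto
        have "u \<in> {v j, v (Suc j)}" using W_meet[OF i(1) j(1)] 2 j u by blast
        then show False using eq v_eq[of "Suc (Suc i)" j] v_eq[of "Suc (Suc i)" "Suc j"] i j 2 by auto
      qed
    qed
    moreover have "u \<in> {v (Suc i), v (Suc (Suc i))}"
    proof -
      consider "u = v 1" | j where "j \<in> {1..i}" "u \<in> W j" using u by blast
      then show ?thesis
      proof cases
        case 1
        then show ?thesis using W_v[OF i(1)] u l by auto
      next
        case 2
        then have j: "j \<in> {1..l}" "Suc i \<noteq> j" using i by auto
        show ?thesis using W_meet[OF i(1) j] 2 u by blast
      qed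
    qed
    ultimately show "u \<in> {v (Suc i)}" by blast
  next
    fix u assume "u \<in> {v (Suc i)}"
    moreover have "v (Suc i) \<in> ?V" using v_in(2)[of i] i by (cases "i = 0") auto
    ultimately show "u \<in> W (Suc i) \<inter> ?V" using v_in(1)[OF i(1)] by blast
  qed
  moreover have "D (Suc i) \<inter> ?E = {}"
  proof -
    have "D (Suc i) \<inter> D j = {}" if "j \<in> {1..i}" for j using D_disj[OF i(1), of j] that i by auto
    then show ?thesis by blast
  qed
  \<comment> \<open>\<open>card_trees_attach\<close> wants the name of an edge outside the row; the
    last network has not been used yet and provides one.\<close>
  moreover obtain f where f: "f \<in> D l" using ladder_net_edges_nonempty[OF net[of l]] l by auto
  have "f \<notin> D j" if "j \<in> {1..Suc i}" for j
    using D_disj[of l j] f that i l by auto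
  then have "f \<notin> D (Suc i) \<union> ?E" by auto
  ultimately have att:
    "card (trees en (W (Suc i) \<union> ?V) (D (Suc i) \<union> ?E)) = t (Suc i) * card (trees en ?V ?E)"
    "card (two_forests en (W (Suc i) \<union> ?V) (D (Suc i) \<union> ?E) (v 1) (v (Suc (Suc i)))) =
      s (Suc i) * card (trees en ?V ?E) + t (Suc i) * card (two_forests en ?V ?E (v 1) (v (Suc i)))"
    using card_trees_attach[OF net[OF i(1)] fin sub, of "v 1" f] by auto
  have eq: "{v 1} \<union> (\<Union>j \<in> {1..Suc i}. W j) = W (Suc i) \<union> ?V" "(\<Union>j \<in> {1..Suc i}. D j) = D (Suc i) \<union> ?E"
  proof -
    have ins: "{1..Suc i} = insert (Suc i) {1..i}" by auto
    show "{v 1} \<union> (\<Union>j \<in> {1..Suc i}. W j) = W (Suc i) \<union> ?V"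
      "(\<Union>j \<in> {1..Suc i}. D j) = D (Suc i) \<union> ?E"
      unfolding ins by (simp_all only: UN_insert Un_left_commute)
  qed
  show ?case
    unfolding eq att IH using IH(2) by (simp add: det_sum_Suc)
qed


text \<open>The last network meets the row in both of its terminals, so it is a network replaced
  inside a graph and not one attached at a single vertex.\<close>

lemma card_trees_cycle:
  "int (card (trees en VF EF)) = det_sum l (\<lambda>j. int (s j)) (\<lambda>j. int (t j))"
proof -
  let ?V = "{v 1} \<union> (\<Union>j \<in> {1..l - 1}. W j)" and ?E = "\<Union>j \<in> {1..l - 1}. D j"
  have pre: "card (trees en ?V ?E) = (\<Prod>j=1..l - 1. t j)"
    "int (card (two_forests en ?V ?E (v 1) (v l))) = det_sum (l - 1) (\<lambda>j. int (s j)) (\<lambda>j. int (t j))"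
    using card_trees_prefix[OF order_refl] l by auto
  have ll: "l \<in> {1..l}" "Suc (l - 1) = l" "l - 1 \<in> {1..l}" using l by auto
  have fin: "finite ?E" by (intro finite_UN_I finite_D) auto
  have sub: "\<forall>e \<in> ?E. en e \<subseteq> ?V"
  proof
    fix e assume "e \<in> ?E"
    then obtain j where j: "j \<in> {1..l - 1}" "e \<in> D j" by blast
    then have "j \<in> {1..l}" by auto
    then have "en e \<subseteq> W j" using ends_D j(2) by blast
    then show "en e \<subseteq> ?V" using j(1) by blast
  qed
  have V: "W l \<inter> ?V = {v l, v (Suc l)}"
  proof (intro equalityI subsetI)
    fix u assume u: "u \<in> W l \<inter> ?V"
    show "u \<in> {v l, v (Suc l)}"
    proof (cases "u = v 1")
      case True
      then show ?thesis using v_last by simp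
    next
      case False
      then obtain j where j: "j \<in> {1..l - 1}" "u \<in> W j" using u by blast
      then have "j \<in> {1..l}" "l \<noteq> j" using l by auto
      then show ?thesis using W_meet[OF ll(1)] j(2) u by blast
    qed
  next
    fix u assume u: "u \<in> {v l, v (Suc l)}"
    have "v l \<in> W (l - 1)" using v_in(2)[OF ll(3)] ll(2) by simp
    then have "v l \<in> ?V" using l by auto
    then show "u \<in> W l \<inter> ?V" using u v_in[OF ll(1)] v_last by auto
  qed
  have D: "D l \<inter> ?E = {}"
  proof -
    have "D l \<inter> D j = {}" if "j \<in> {1..l - 1}" for j
    proof -
      have "j \<in> {1..l}" "l \<noteq> j" using that l by auto
      then show ?thesis by (rule D_disj[OF ll(1)])
    qed
    then show ?thesis by blast
  qed
  have "card (trees en (W l \<union> ?V) (D l \<union> ?E)) =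
      s l * card (trees en ?V ?E) + t l * card (two_forests en ?V ?E (v l) (v (Suc l)))"
    using card_trees_net[OF net[OF ll(1)] fin sub V D] .
  also have "two_forests en ?V ?E (v l) (v (Suc l)) = two_forests en ?V ?E (v 1) (v l)"
    unfolding v_last by (rule two_forests_commute)
  finally have "int (card (trees en (W l \<union> ?V) (D l \<union> ?E))) =
      int (s l) * int (card (trees en ?V ?E)) +
      int (t l) * int (card (two_forests en ?V ?E (v 1) (v l)))"
    by (simp only: of_nat_add of_nat_mult)
  then have "int (card (trees en (W l \<union> ?V) (D l \<union> ?E))) =
      int (s l) * (\<Prod>j=1..l - 1. int (t j)) + int (t l) * det_sum (l - 1) (\<lambda>j. int (s j)) (\<lambda>j. int (t j))"
    by (simp only: pre of_nat_prod)
  moreover have ins: "{1..l} = insert l {1..l - 1}" using l by auto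
  have "v 1 \<in> (\<Union>j \<in> {1..l - 1}. W j)" using v_in(1)[of 1] l by (intro UN_I[of 1]) auto
  then have "W l \<union> ?V = VF" "D l \<union> ?E = EF" unfolding ins UN_insert by auto
  ultimately show ?thesis
    using det_sum_Suc[of "l - 1" "\<lambda>j. int (s j)" "\<lambda>j. int (t j)"] ll(2) by simp
qed

section \<open>Potentials around the cycle\<close>

definition pot :: "nat \<Rightarrow> 'v \<Rightarrow> int" where
  "pot i = (SOME h. net_potential en (W i) (D i) (v i) (v (Suc i)) (int (s i)) (int (t i)) h)"

lemma pot: "i \<in> {1..l} \<Longrightarrow> net_potential en (W i) (D i) (v i) (v (Suc i)) (int (s i)) (int (t i)) (pot i)"
  unfolding pot_def using ladder_net_potential[OF net] by (rule someI_ex)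

text \<open>Assigns each vertex to one network: \<open>v i\<close> to the network that starts there,
  any other vertex to the only network that contains it.\<close>

definition part :: "'v \<Rightarrow> nat" where
  "part u = (if u \<in> v ` {1..l} then inv_into {1..l} v u else SOME i. i \<in> {1..l} \<and> u \<in> W i)"

lemma part_v [simp]: "i \<in> {1..l} \<Longrightarrow> part (v i) = i"
  using v_inj by (simp add: part_def)

lemma part_in:
  assumes "u \<in> VF"
  shows "part u \<in> {1..l}" "u \<in> W (part u)"
proof -
  have "part u \<in> {1..l} \<and> u \<in> W (part u)"
  proof (cases "u \<in> v ` {1..l}")
    case True
    then show ?thesis using v_in by auto
  next
    case False
    then have "part u = (SOME i. i \<in> {1..l} \<and> u \<in> W i)" by (simp add: part_def)
    then show ?thesis using assms by (metis (mono_tags, lifting) UN_E someI)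
  qed
  then show "part u \<in> {1..l}" "u \<in> W (part u)" by auto
qed

lemma part_cases:
  assumes "k \<in> {1..l}" "u \<in> W k"
  shows "part u = k \<or> u = v (Suc k)"
proof (rule ccontr)
  assume n: "\<not> (part u = k \<or> u = v (Suc k))"
  have "u \<in> VF" using assms by blast
  note u = part_in[OF this]
  then have "u \<in> {v k, v (Suc k)}" using W_meet[OF assms(1) u(1)] n assms(2) by blast
  then have "u = v k" using n by blast
  then show False using n assms(1) by simp
qed

text \<open>The coordinates of a potential on the cycle with values in the presented group. Going once
  around the cycle changes it by the relation \<open>s\<close>; the values are cut open at \<open>v 1\<close>.\<close>

definition Phi :: "'v \<Rightarrow> nat \<Rightarrow> int" where
  "Phi u i = (if i < part u then 0
     else if i = part u then pot i u - pot i (v (Suc i)) else int (s i))"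

lemma pot_drop: "i \<in> {1..l} \<Longrightarrow> pot i (v i) - pot i (v (Suc i)) = int (s i)"
  using pot by (auto simp: net_potential_def)

text \<open>The extra term is the effect of the cut: as the end of the last network
  \<open>v 1\<close> would get the value 0, but it belongs to network 1 and has the value of a full
  round.\<close>

lemma Phi_in:
  assumes k: "k \<in> {1..l}" and u: "u \<in> W k" and i: "i \<in> {1..l}"
  shows "Phi u i = (if i < k then 0 else if i = k then pot k u - pot k (v (Suc k)) else int (s i)) +
    (if k = l \<and> u = v 1 then int (s i) else 0)"
proof -
  consider "part u = k" "u \<noteq> v (Suc k)" | "u = v (Suc k)" "k < l" | "u = v (Suc k)" "k = l"
    using part_cases[OF k u] k by force
  then show ?thesis
  proof cases
    case 1
    then show ?thesis using v_last by (auto simp: Phi_def)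
  next
    case 2
    then have "part u = Suc k" using k by simp
    then show ?thesis using 2 i pot_drop[of "Suc k"] by (auto simp: Phi_def)
  next
    case 3
    then have "part u = 1" "u = v 1" using v_last l part_v[of 1] by auto
    then show ?thesis using 3 i pot_drop[of 1] v_last by (auto simp: Phi_def)
  qed
qed

text \<open>On \<open>W k\<close> coordinate \<open>i\<close> of \<open>Phi\<close> is constant up
  to the network's own potential and the jump at \<open>v 1\<close>. Constants are killed by vectors
  of degree 0.\<close>

lemma sum_Phi:
  assumes supp: "\<And>k u. k \<in> {1..l} \<Longrightarrow> u \<notin> W k \<Longrightarrow> x k u = 0"
    and deg: "\<And>k. k \<in> {1..l} \<Longrightarrow> (\<Sum>u \<in> W k. x k u) = 0" and i: "i \<in> {1..l}"
  shows "(\<Sum>u \<in> VF. Phi u i * (\<Sum>k=1..l. x k u)) = (\<Sum>u \<in> W i. pot i u * x i u) + int (s i) * x l (v 1)"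
proof -
  have fin: "finite VF" by (intro finite_UN_I finite_W) auto
  have part: "(\<Sum>u \<in> VF. Phi u i * x k u) =
      (if k = i then \<Sum>u \<in> W i. pot i u * x i u else 0) + (if k = l then int (s i) * x l (v 1) else 0)"
    if k: "k \<in> {1..l}" for k
  proof -
    let ?c = "if i < k then 0 else if i = k then - pot k (v (Suc k)) else int (s i)"
    have "(\<Sum>u \<in> VF. Phi u i * x k u) = (\<Sum>u \<in> W k. Phi u i * x k u)"
      by (rule sum.mono_neutral_right[OF fin]) (use k supp in auto)
    also have "\<dots> = (\<Sum>u \<in> W k. ((if i = k then pot k u * x k u else 0) + ?c * x k u) +
        (if u = v 1 then (if k = l then int (s i) * x k u else 0) else 0))"
      using Phi_in[OF k _ i] by (intro sum.cong refl) (auto simp: algebra_simps)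
    also have "\<dots> = (\<Sum>u \<in> W k. if i = k then pot k u * x k u else 0) + ?c * (\<Sum>u \<in> W k. x k u) +
        (if v 1 \<in> W k then (if k = l then int (s i) * x k (v 1) else 0) else 0)"
      using finite_W[OF k] by (simp add: sum.distrib sum_distrib_left del: sum.If_cases)
    also have "(\<Sum>u \<in> W k. x k u) = 0" by (rule deg[OF k])
    also have "(if v 1 \<in> W k then (if k = l then int (s i) * x k (v 1) else 0) else 0) =
        (if k = l then int (s i) * x l (v 1) else 0)"
      using v_in(2)[OF k] v_last by auto
    finally show ?thesis by auto
  qed
  have "(\<Sum>u \<in> VF. Phi u i * (\<Sum>k=1..l. x k u)) = (\<Sum>k=1..l. \<Sum>u \<in> VF. Phi u i * x k u)"
    unfolding sum_distrib_left by (rule sum.swap)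
  also have "\<dots> = (\<Sum>k=1..l. (if k = i then \<Sum>u \<in> W i. pot i u * x i u else 0) +
      (if k = l then int (s i) * x l (v 1) else 0))"
    by (rule sum.cong[OF refl part])
  also have "\<dots> = (\<Sum>u \<in> W i. pot i u * x i u) + int (s i) * x l (v 1)"
    using i l by (simp add: sum.distrib)
  finally show ?thesis .
qed

lemma lap_op_EF: "lap_op en EF y u = (\<Sum>k=1..l. lap_op en (D k) y u)"
  unfolding lap_op_def using finite_D D_disj by (intro sum.UNION_disjoint) auto

lemma lap_op_D:
  assumes "k \<in> {1..l}"
  shows "u \<notin> W k \<Longrightarrow> lap_op en (D k) y u = 0" "(\<Sum>u \<in> W k. lap_op en (D k) y u) = 0"
proof -
  show "u \<notin> W k \<Longrightarrow> lap_op en (D k) y u = 0"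
    using ends_D[OF assms] by (intro lap_op_outside[of "D k" en "W k"]) auto
  show "(\<Sum>u \<in> W k. lap_op en (D k) y u) = 0"
    using ends_D[OF assms] finite_W[OF assms] finite_D[OF assms] by (intro sum_lap_op)
qed

lemma telescope: "(\<Sum>i=1..n. f i - f (Suc i)) = f 1 - f (Suc n)" for f :: "nat \<Rightarrow> int"
  by (induction n) auto

abbreviation "cyc_lattice \<equiv> relation_lattice l (\<lambda>i. int (s i)) (\<lambda>i. int (t i))"

text \<open>The current through network \<open>i\<close> is \<open>t i\<close> times its voltage,
  and the voltages telescope to 0 around the cycle. The jump at the cut contributes a multiple of
  \<open>s\<close>.\<close>

lemma sum_Phi_lap_op: "(\<lambda>i. \<Sum>u \<in> VF. Phi u i * lap_op en EF y u) \<in> cyc_lattice"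
proof -
  let ?z = "\<lambda>i. y (v i) - y (v (Suc i))"
  have "(\<Sum>u \<in> VF. Phi u i * lap_op en EF y u) =
      lap_op en (D l) y (v 1) * int (s i) + ?z i * int (t i)" if i: "i \<in> {1..l}" for i
  proof -
    have "(\<Sum>u \<in> VF. Phi u i * lap_op en EF y u) =
        (\<Sum>u \<in> W i. pot i u * lap_op en (D i) y u) + int (s i) * lap_op en (D l) y (v 1)"
      unfolding lap_op_EF by (rule sum_Phi[OF _ _ i]) (use lap_op_D in auto)
    also have "(\<Sum>u \<in> W i. pot i u * lap_op en (D i) y u) = int (t i) * ?z i"
      using pot[OF i] unfolding net_potential_def by blast
    finally show ?thesis by (simp add: mult.commute)
  qed
  moreover have "(\<Sum>i=1..l. ?z i) = 0"
    using telescope[of "\<lambda>i. y (v i)" l] v_last by simp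
  ultimately show ?thesis unfolding relation_lattice_def by blast
qed

text \<open>In each network a charge \<open>m k\<close> is moved between two vertices of potential
  difference 1. The error \<open>K\<close> comes from the cut and vanishes in the presented
  group.\<close>

lemma sum_Phi_surj: "\<exists>x K. sum x VF = 0 \<and> (\<forall>i \<in> {1..l}. (\<Sum>u \<in> VF. Phi u i * x u) = m i + K * int (s i))"
proof -
  have "\<forall>k \<in> {1..l}. \<exists>p q. p \<in> W k \<and> q \<in> W k \<and> pot k p - pot k q = 1"
    using pot unfolding net_potential_def by blast
  then obtain p q where pq: "\<And>k. k \<in> {1..l} \<Longrightarrow> p k \<in> W k" "\<And>k. k \<in> {1..l} \<Longrightarrow> q k \<in> W k"
    "\<And>k. k \<in> {1..l} \<Longrightarrow> pot k (p k) - pot k (q k) = 1" by metis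
  define x where "x k u = (if u = p k then m k else if u = q k then - m k else 0)" for k u
  have ne: "p k \<noteq> q k" if "k \<in> {1..l}" for k using pq(3)[OF that] by auto
  have supp: "x k u = 0" if "k \<in> {1..l}" "u \<notin> W k" for k u using pq that by (auto simp: x_def)
  have deg: "(\<Sum>u \<in> W k. x k u) = 0" if "k \<in> {1..l}" for k
    using sum_two_point[OF finite_W pq(1,2) ne, OF that that that that, of "\<lambda>_. 1"] by (simp add: x_def)
  have pw: "(\<Sum>u \<in> W k. pot k u * x k u) = m k" if "k \<in> {1..l}" for k
    using sum_two_point[OF finite_W pq(1,2) ne, OF that that that that, of "pot k"] pq(3)[OF that]
    by (simp add: x_def)
  have fin: "finite VF" by (intro finite_UN_I finite_W) auto
  have "(\<Sum>u \<in> VF. \<Sum>k=1..l. x k u) = (\<Sum>k=1..l. \<Sum>u \<in> VF. x k u)" by (rule sum.swap)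
  also have "\<dots> = (\<Sum>k=1..l. \<Sum>u \<in> W k. x k u)"
    by (intro sum.cong[OF refl] sum.mono_neutral_right[OF fin]) (use supp in auto)
  also have "\<dots> = 0" using deg by simp
  finally have "(\<Sum>u \<in> VF. \<Sum>k=1..l. x k u) = 0" .
  moreover have "(\<Sum>u \<in> VF. Phi u i * (\<Sum>k=1..l. x k u)) = m i + x l (v 1) * int (s i)"
    if i: "i \<in> {1..l}" for i
    using sum_Phi[of x i] supp deg i pw[OF i] by simp
  ultimately show ?thesis by (intro exI[of _ "\<lambda>u. \<Sum>k=1..l. x k u"] exI[of _ "x l (v 1)"]) blast
qed

end


context net_cycle begin

text \<open>The vector is distributed over the networks, each part is corrected to degree 0 by
  passing charge on through the vertices \<open>v k\<close>, and the problem is solved in each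
  network. A constant charge \<open>r\<close> sent around the cycle is still free; it changes
  coordinate \<open>i\<close> by \<open>r * s i\<close> and absorbs the relation \<open>s\<close>.
  The prescribed voltages \<open>z i\<close> add up to 0, so the local solutions fit
  together.\<close>

lemma sum_Phi_kernel:
  assumes deg: "sum x VF = 0" and m: "(\<lambda>i. \<Sum>u \<in> VF. Phi u i * x u) \<in> cyc_lattice"
  shows "\<exists>y. \<forall>u \<in> VF. lap_op en EF y u = x u"
proof -
  have fin: "finite VF" by (intro finite_UN_I finite_W) auto
  define xp where "xp k u = (if u \<in> VF \<and> part u = k then x u else 0)" for k u
  define d where "d k = (\<Sum>u \<in> W k. xp k u)" for k
  \<comment> \<open>\<open>e k\<close> is the total degree of the first \<open>k\<close> parts.
    Network \<open>k\<close> receives \<open>e (k - 1) + r\<close> at \<open>v k\<close> and passes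
    \<open>e k + r\<close> on at \<open>v (Suc k)\<close>.\<close>
  define e where "e k = (\<Sum>j=1..k. d j)" for k
  define f where "f r u k = (if u = v k then e (k - 1) + r else 0)" for r u k
  define X where "X r k u = xp k u + (f r u k - f r u (Suc k))" for r k u
  have xp_supp: "xp k u = 0" if "u \<notin> W k" for k u
    using that part_in by (auto simp: xp_def)
  have sum_xp: "(\<Sum>k=1..l. xp k u) = x u" if "u \<in> VF" for u
    using that part_in(1)[OF that] by (simp add: xp_def)
  have "e l = (\<Sum>k=1..l. \<Sum>u \<in> VF. xp k u)"
    unfolding e_def d_def by (intro sum.cong[OF refl] sum.mono_neutral_left[OF fin]) (use xp_supp in auto)
  also have "\<dots> = (\<Sum>u \<in> VF. \<Sum>k=1..l. xp k u)" by (rule sum.swap)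
  also have "\<dots> = 0" using sum_xp deg by simp
  finally have el: "e l = 0" .
  have supp: "X r k u = 0" if "k \<in> {1..l}" "u \<notin> W k" for r k u
    using that v_in[OF that(1)] xp_supp[OF that(2)] by (auto simp: X_def f_def)
  have sum_f: "(\<Sum>u \<in> W k. g u * (f r u k - f r u (Suc k))) = g (v k) * (e (k - 1) + r) - g (v (Suc k)) * (e k + r)"
    if k: "k \<in> {1..l}" for g :: "'v \<Rightarrow> int" and r k
  proof -
    have "(\<Sum>u \<in> W k. g u * (f r u k - f r u (Suc k))) =
        (\<Sum>u \<in> W k. (if u = v k then g (v k) * (e (k - 1) + r) else 0) -
          (if u = v (Suc k) then g (v (Suc k)) * (e k + r) else 0))"
      by (intro sum.cong) (auto simp: f_def algebra_simps)
    then show ?thesis using finite_W[OF k] v_in[OF k] by (simp add: sum_subtractf)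
  qed
  have X_deg: "(\<Sum>u \<in> W k. X r k u) = 0" if k: "k \<in> {1..l}" for r k
  proof -
    obtain k' where k': "k = Suc k'" using k by (cases k) auto
    have "(\<Sum>u \<in> W k. X r k u) = d k + (e (k - 1) + r - (e k + r))"
      using sum_f[OF k, of "\<lambda>_. 1" r] by (simp add: X_def sum.distrib d_def)
    also have "e k = e (k - 1) + d k" unfolding k' e_def by simp
    finally show ?thesis by simp
  qed
  have sum_X: "(\<Sum>k=1..l. X r k u) = x u" if "u \<in> VF" for r u
  proof -
    have "f r u 1 = f r u (Suc l)" using v_last el by (simp add: f_def e_def)
    then have "(\<Sum>k=1..l. f r u k - f r u (Suc k)) = 0" using telescope[of "f r u" l] by simp
    then show ?thesis unfolding X_def sum.distrib sum_xp[OF that] by simp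
  qed
  have pX: "(\<Sum>u \<in> W i. pot i u * X r i u) = (\<Sum>u \<in> W i. pot i u * X 0 i u) + r * int (s i)"
    if i: "i \<in> {1..l}" for r i
  proof -
    have X: "(\<Sum>u \<in> W i. pot i u * X r i u) = (\<Sum>u \<in> W i. pot i u * xp i u) +
        (pot i (v i) * (e (i - 1) + r) - pot i (v (Suc i)) * (e i + r))" for r
      unfolding X_def distrib_left sum.distrib sum_f[OF i] by (rule refl)
    show ?thesis using X[of r] X[of 0] unfolding pot_drop[OF i, symmetric] by (simp add: algebra_simps)
  qed
  obtain k z where z: "(\<Sum>i=1..l. z i) = 0"
    "\<forall>i \<in> {1..l}. (\<Sum>u \<in> VF. Phi u i * x u) = k * int (s i) + z i * int (t i)"
    using m unfolding relation_lattice_def by blast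
  \<comment> \<open>Cancels both the jump at the cut and the multiple \<open>k\<close> of the
    relation \<open>s\<close>.\<close>
  define r where "r = X 0 l (v 1) - k"
  have Xz: "(\<Sum>u \<in> W i. pot i u * X r i u) = int (t i) * z i" if i: "i \<in> {1..l}" for i
  proof -
    have "(\<Sum>u \<in> VF. Phi u i * (\<Sum>k=1..l. X 0 k u)) =
        (\<Sum>u \<in> W i. pot i u * X 0 i u) + int (s i) * X 0 l (v 1)"
      by (rule sum_Phi[OF supp X_deg i])
    moreover have "(\<Sum>u \<in> VF. Phi u i * (\<Sum>k=1..l. X 0 k u)) = (\<Sum>u \<in> VF. Phi u i * x u)"
      using sum_X by (intro sum.cong) auto
    ultimately have "(\<Sum>u \<in> W i. pot i u * X 0 i u) = z i * int (t i) - r * int (s i)"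
      using z(2) i unfolding r_def by (simp add: algebra_simps)
    then show ?thesis using pX[OF i, of r] by simp
  qed
  have "\<forall>i \<in> {1..l}. \<exists>y. (\<forall>u \<in> W i. lap_op en (D i) y u = X r i u) \<and> y (v i) - y (v (Suc i)) = z i"
  proof
    fix i assume i: "i \<in> {1..l}"
    show "\<exists>y. (\<forall>u \<in> W i. lap_op en (D i) y u = X r i u) \<and> y (v i) - y (v (Suc i)) = z i"
      using pot[OF i] X_deg[OF i, of r] Xz[OF i] unfolding net_potential_def by blast
  qed
  then obtain Y where Y: "\<And>i u. i \<in> {1..l} \<Longrightarrow> u \<in> W i \<Longrightarrow> lap_op en (D i) (Y i) u = X r i u"
    "\<And>i. i \<in> {1..l} \<Longrightarrow> Y i (v i) - Y i (v (Suc i)) = z i"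
    by metis
  \<comment> \<open>The values of the glued solution at the vertices \<open>v k\<close>, normalised
    to 0 at \<open>v 1\<close>; \<open>cl\<close> says that one round leads back to 0.\<close>
  define c where "c k = - (\<Sum>j \<in> {1..<k}. z j)" for k
  have c1: "c 1 = 0" by (simp add: c_def)
  have cl: "c (Suc l) = 0" using z(1) by (simp add: c_def atLeastLessThanSuc_atLeastAtMost)
  have cS: "c (Suc k) = c k - z k" if "k \<in> {1..l}" for k using that by (simp add: c_def)
  define y where "y u = Y (part u) u - Y (part u) (v (part u)) + c (part u)" for u
  have y: "y u = Y k u + (c k - Y k (v k))" if k: "k \<in> {1..l}" "u \<in> W k" for k u
  proof (cases "part u = k")
    case True
    then show ?thesis by (simp add: y_def)
  next
    case False
    then have u: "u = v (Suc k)" using part_cases[OF k] by blast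
    have "y u = c (Suc k)"
    proof (cases "k = l")
      case True
      then have "u = v 1" "part u = 1" using u v_last l part_v[of 1] by auto
      then show ?thesis using True cl c1 by (simp add: y_def)
    next
      case False
      then have "part u = Suc k" using u k by simp
      then show ?thesis using u by (simp add: y_def)
    qed
    then show ?thesis using cS[OF k(1)] Y(2)[OF k(1)] u by simp
  qed
  have "lap_op en (D k) y u = X r k u" if k: "k \<in> {1..l}" for k u
  proof (cases "u \<in> W k")
    case True
    have "lap_op en (D k) y u = lap_op en (D k) (\<lambda>u. Y k u + (c k - Y k (v k))) u"
      using ends_D[OF k] y[OF k] True by (intro lap_op_cong[of "D k" en "W k"]) auto
    also have "\<dots> = lap_op en (D k) (Y k) u"
      using ends_D[OF k] by (intro lap_op_add_const) auto
    finally show ?thesis using Y(1)[OF k True] by simp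
  next
    case False
    then show ?thesis using lap_op_D(1)[OF k] supp[OF k] by simp
  qed
  then have "lap_op en EF y u = x u" if "u \<in> VF" for u
    using sum_X[OF that, of r] unfolding lap_op_EF by simp
  then show ?thesis by blast
qed

text \<open>\<open>P\<close> composes \<open>Phi\<close> with the diagonalising matrix of the
  presentation.\<close>

lemma cokernel_lap_op:
  assumes "presents l (\<lambda>i. int (s i)) (\<lambda>i. int (t i)) n"
  shows "\<exists>P. (\<forall>x. sum x VF = 0 \<longrightarrow> ((\<exists>y. \<forall>u \<in> VF. lap_op en EF y u = x u) \<longleftrightarrow>
      (\<forall>j \<in> {1..l - 1}. n j dvd (\<Sum>u \<in> VF. P j u * x u)))) \<and>
    (\<forall>y. \<exists>x. sum x VF = 0 \<and> (\<forall>j \<in> {1..l - 1}. n j dvd (\<Sum>u \<in> VF. P j u * x u) - y j))"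
proof -
  obtain c where c: "\<And>m. m \<in> cyc_lattice \<longleftrightarrow> (\<forall>j \<in> {1..l - 1}. n j dvd (\<Sum>i=1..l. c j i * m i))"
    "\<And>y. \<exists>m. \<forall>j \<in> {1..l - 1}. n j dvd (\<Sum>i=1..l. c j i * m i) - y j"
    using assms unfolding presents_def by blast
  define P where "P j u = (\<Sum>i=1..l. c j i * Phi u i)" for j u
  have P: "(\<Sum>u \<in> VF. P j u * x u) = (\<Sum>i=1..l. c j i * (\<Sum>u \<in> VF. Phi u i * x u))" for j x
    unfolding P_def sum_distrib_left sum_distrib_right by (subst sum.swap) (simp only: mult.assoc)
  have "(\<exists>y. \<forall>u \<in> VF. lap_op en EF y u = x u) \<longleftrightarrow> (\<forall>j \<in> {1..l - 1}. n j dvd (\<Sum>u \<in> VF. P j u * x u))"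
    if x: "sum x VF = 0" for x
  proof
    assume "\<exists>y. \<forall>u \<in> VF. lap_op en EF y u = x u"
    then obtain y where y: "\<forall>u \<in> VF. lap_op en EF y u = x u" by blast
    then have "(\<Sum>u \<in> VF. Phi u i * lap_op en EF y u) = (\<Sum>u \<in> VF. Phi u i * x u)" for i
      by (intro sum.cong) auto
    then show "\<forall>j \<in> {1..l - 1}. n j dvd (\<Sum>u \<in> VF. P j u * x u)"
      using sum_Phi_lap_op[of y] unfolding P c(1) by simp
  next
    assume "\<forall>j \<in> {1..l - 1}. n j dvd (\<Sum>u \<in> VF. P j u * x u)"
    then show "\<exists>y. \<forall>u \<in> VF. lap_op en EF y u = x u"
      using sum_Phi_kernel[OF x] unfolding P c(1) by blast
  qed
  moreover have "\<exists>x. sum x VF = 0 \<and> (\<forall>j \<in> {1..l - 1}. n j dvd (\<Sum>u \<in> VF. P j u * x u) - y j)" for y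
  proof -
    obtain m where m: "\<forall>j \<in> {1..l - 1}. n j dvd (\<Sum>i=1..l. c j i * m i) - y j" using c(2) by blast
    obtain x K where x: "sum x VF = 0" "\<forall>i \<in> {1..l}. (\<Sum>u \<in> VF. Phi u i * x u) = m i + K * int (s i)"
      using sum_Phi_surj by blast
    have "(\<lambda>i. K * int (s i)) \<in> cyc_lattice"
      unfolding relation_lattice_def by (auto intro!: exI[of _ K] exI[of _ "\<lambda>_. 0"])
    then have K: "\<forall>j \<in> {1..l - 1}. n j dvd (\<Sum>i=1..l. c j i * (K * int (s i)))" unfolding c(1) .
    have "n j dvd (\<Sum>u \<in> VF. P j u * x u) - y j" if j: "j \<in> {1..l - 1}" for j
    proof -
      have "(\<Sum>u \<in> VF. P j u * x u) = (\<Sum>i=1..l. c j i * m i + c j i * (K * int (s i)))"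
        unfolding P using x(2) by (intro sum.cong refl) (simp add: distrib_left)
      then have "(\<Sum>u \<in> VF. P j u * x u) - y j =
          ((\<Sum>i=1..l. c j i * m i) - y j) + (\<Sum>i=1..l. c j i * (K * int (s i)))"
        by (simp add: sum.distrib)
      also have "n j dvd \<dots>" using bspec[OF m j] bspec[OF K j] by (rule dvd_add)
      finally show ?thesis .
    qed
    then show ?thesis using x(1) by blast
  qed
  ultimately show ?thesis by blast
qed

end


section \<open>The sandpile group as a cokernel\<close>

lemma carrier_free_Z: "carrier (free_Z V) = extensional V"
  by (auto simp: free_Z_def PiE_def)

lemma mult_free_Z: "x \<otimes>\<^bsub>free_Z V\<^esub> y = (\<lambda>u \<in> V. x u + y u)"
  by (simp add: free_Z_def)

lemma one_free_Z: "\<one>\<^bsub>free_Z V\<^esub> = (\<lambda>u \<in> V. 0)"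
  by (simp add: free_Z_def)

lemma comm_group_free_Z: "comm_group (free_Z V)"
proof (rule group.group_comm_groupI)
  show "group (free_Z V)" by (simp add: free_Z_def)
qed (simp add: mult_free_Z add.commute)

lemma pow_free_Z:
  assumes "x \<in> carrier (free_Z V)"
  shows "x [^]\<^bsub>free_Z V\<^esub> (k :: nat) = (\<lambda>u \<in> V. int k * x u)"
proof (induction k)
  case 0
  then show ?case by (simp add: nat_pow_def one_free_Z)
next
  case (Suc k)
  have "x [^]\<^bsub>free_Z V\<^esub> Suc k = x [^]\<^bsub>free_Z V\<^esub> k \<otimes>\<^bsub>free_Z V\<^esub> x"
    by (simp add: nat_pow_def)
  then show ?case unfolding Suc mult_free_Z by (auto simp: algebra_simps restrict_def)
qed

text \<open>Laplacians have degree 0, so a class of nonzero degree has infinite order. The vectors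
  of degree 0 have finite order modulo Laplacians, hence they form the torsion part, and the map
  \<open>h\<close> identifies their quotient with the product.\<close>

lemma sandpile_group_iso:
  fixes n :: "nat \<Rightarrow> nat"
  assumes fin: "finite (verts G)" "finite (edges G)" "finite J"
    and wf: "\<forall>e \<in> edges G. card (ends G e) = 2 \<and> ends G e \<subseteq> verts G"
    and pos: "\<And>j. j \<in> J \<Longrightarrow> n j > 0"
    and ker: "\<And>x. sum x (verts G) = 0 \<Longrightarrow>
      (\<exists>y. \<forall>u \<in> verts G. lap_op (ends G) (edges G) y u = x u) \<longleftrightarrow>
      (\<forall>j \<in> J. int (n j) dvd (\<Sum>u \<in> verts G. P j u * x u))"
    and surj: "\<And>b. \<exists>x. sum x (verts G) = 0 \<and> (\<forall>j \<in> J. int (n j) dvd (\<Sum>u \<in> verts G. P j u * x u) - b j)"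
  shows "sandpile_group G \<cong> product_group J (\<lambda>j. integer_mod_group (n j))"
proof -
  let ?V = "verts G" and ?L = "lap_op (ends G) (edges G)"
  let ?B = "product_group J (\<lambda>j. integer_mod_group (n j))"
  define A where "A = free_Z ?V"
  define N where "N = laplacian_image G"
  define Z where "Z = {x \<in> carrier A. sum x ?V = 0}"
  define h where "h x = (\<lambda>j \<in> J. (\<Sum>u \<in> ?V. P j u * x u) mod int (n j))" for x
  interpret A: comm_group A unfolding A_def by (rule comm_group_free_Z)
  have carA: "x \<in> carrier A \<longleftrightarrow> x \<in> extensional ?V" for x by (simp add: A_def carrier_free_Z)
  have multA: "x \<otimes>\<^bsub>A\<^esub> y = (\<lambda>u \<in> ?V. x u + y u)" for x y by (simp add: A_def mult_free_Z)
  have N: "x \<in> N \<longleftrightarrow> x \<in> extensional ?V \<and> (\<exists>y. \<forall>u \<in> ?V. ?L y u = x u)" for x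
  proof
    assume "x \<in> N"
    then obtain y where "x = (\<lambda>u \<in> ?V. \<Sum>w \<in> ?V. laplacian G u w * y w)"
      by (auto simp: N_def laplacian_image_def)
    then show "x \<in> extensional ?V \<and> (\<exists>y. \<forall>u \<in> ?V. ?L y u = x u)"
      using laplacian_sum[OF fin(1,2) wf, of _ y] by auto
  next
    assume "x \<in> extensional ?V \<and> (\<exists>y. \<forall>u \<in> ?V. ?L y u = x u)"
    then obtain y where y: "x \<in> extensional ?V" "\<forall>u \<in> ?V. ?L y u = x u" by blast
    let ?y = "restrict y ?V"
    have "x = (\<lambda>u \<in> ?V. \<Sum>w \<in> ?V. laplacian G u w * ?y w)"
    proof (rule extensionalityI[OF y(1) restrict_extensional])
      fix u assume u: "u \<in> ?V"
      have "(\<Sum>w \<in> ?V. laplacian G u w * ?y w) = (\<Sum>w \<in> ?V. laplacian G u w * y w)"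
        by (intro sum.cong) auto
      then show "x u = (\<lambda>u \<in> ?V. \<Sum>w \<in> ?V. laplacian G u w * ?y w) u"
        using u y(2) laplacian_sum[OF fin(1,2) wf u, of y] by simp
    qed
    moreover have "?y \<in> carrier (free_Z ?V)" by (simp add: carrier_free_Z)
    ultimately show "x \<in> N" unfolding N_def laplacian_image_def by blast
  qed
  have NZ: "N \<subseteq> Z"
  proof
    fix x assume "x \<in> N"
    then obtain y where "x \<in> extensional ?V" "\<forall>u \<in> ?V. ?L y u = x u" using N by blast
    moreover from this have "sum x ?V = 0"
      using sum_lap_op[OF fin(1,2) wf, of y] by (simp cong: sum.cong)
    ultimately show "x \<in> Z" by (simp add: Z_def carA)
  qed
  have Nh: "x \<in> N \<longleftrightarrow> h x = \<one>\<^bsub>?B\<^esub>" if x: "x \<in> Z" for x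
  proof -
    have "x \<in> N \<longleftrightarrow> (\<forall>j \<in> J. int (n j) dvd (\<Sum>u \<in> ?V. P j u * x u))"
      using x ker[of x] by (simp add: N Z_def carA)
    also have "\<dots> \<longleftrightarrow> h x = \<one>\<^bsub>?B\<^esub>"
      unfolding h_def one_product_group one_integer_mod_group
      by (auto simp: fun_eq_iff restrict_def dvd_eq_mod_eq_0)
    finally show ?thesis .
  qed
  have subZ: "subgroup Z A"
  proof (rule A.subgroupI)
    show "Z \<subseteq> carrier A" by (auto simp: Z_def)
    show "Z \<noteq> {}" using NZ N[of "\<lambda>u \<in> ?V. 0"] by (auto simp: Z_def carA intro!: exI[of _ "\<lambda>u \<in> ?V. 0"])
    fix x assume x: "x \<in> Z"
    have "inv\<^bsub>A\<^esub> x = (\<lambda>u \<in> ?V. - x u)"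
    proof (rule A.inv_equality)
      show "(\<lambda>u \<in> ?V. - x u) \<otimes>\<^bsub>A\<^esub> x = \<one>\<^bsub>A\<^esub>"
        unfolding multA by (auto simp: A_def one_free_Z restrict_def)
    qed (use x in \<open>auto simp: Z_def carA\<close>)
    then show "inv\<^bsub>A\<^esub> x \<in> Z" using x by (simp add: Z_def carA sum_negf)
    fix y assume "y \<in> Z"
    then show "x \<otimes>\<^bsub>A\<^esub> y \<in> Z" using x by (simp add: Z_def carA multA sum.distrib)
  qed
  let ?G = "A\<lparr>carrier := Z\<rparr>"
  have grpG: "group ?G" by (rule A.subgroup_imp_group[OF subZ])
  have grpB: "group ?B" by simp
  have hom: "h \<in> hom ?G ?B"
  proof (rule homI)
    fix x assume "x \<in> carrier ?G"
    show "h x \<in> carrier ?B" using pos by (auto simp: h_def carrier_integer_mod_group)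
  next
    fix x y assume "x \<in> carrier ?G" "y \<in> carrier ?G"
    have "(\<Sum>u \<in> ?V. P j u * (x \<otimes>\<^bsub>A\<^esub> y) u) = (\<Sum>u \<in> ?V. P j u * x u) + (\<Sum>u \<in> ?V. P j u * y u)" for j
      unfolding sum.distrib[symmetric] multA by (intro sum.cong) (auto simp: distrib_left)
    then show "h (x \<otimes>\<^bsub>?G\<^esub> y) = h x \<otimes>\<^bsub>?B\<^esub> h y"
      by (auto simp: h_def fun_eq_iff mod_add_eq)
  qed
  interpret h: group_hom ?G ?B h
    using grpG grpB hom by (simp add: group_hom_def group_hom_axioms_def)
  have img: "h ` carrier ?G = carrier ?B"
  proof (intro equalityI subsetI)
    fix b assume b: "b \<in> carrier ?B"
    obtain x where x: "sum x ?V = 0" "\<forall>j \<in> J. int (n j) dvd (\<Sum>u \<in> ?V. P j u * x u) - b j"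
      using surj by blast
    let ?x = "restrict x ?V"
    have "?x \<in> Z" using x(1) by (simp add: Z_def carA)
    moreover have "h ?x = b"
    proof (rule extensionalityI[of _ J])
      show "h ?x \<in> extensional J" by (simp add: h_def)
      show "b \<in> extensional J" using b by (simp add: PiE_def)
      fix j assume j: "j \<in> J"
      have "(\<Sum>u \<in> ?V. P j u * ?x u) = (\<Sum>u \<in> ?V. P j u * x u)" by (intro sum.cong) auto
      then have "h ?x j = b j mod int (n j)"
        using x(2) j by (simp add: h_def mod_eq_dvd_iff)
      moreover have "b j \<in> {0..<int (n j)}"
        using b j pos[OF j] by (auto simp: carrier_integer_mod_group dest!: PiE_mem[of _ _ _ j])
      ultimately show "h ?x j = b j" by simp
    qed
    ultimately show "b \<in> h ` carrier ?G" by auto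
  qed (use h.hom_closed in auto)
  have kerN: "kernel ?G ?B h = N"
    unfolding kernel_def using Nh NZ by auto
  have iso: "?G Mod N \<cong> ?B"
    using h.FactGroup_iso[OF img] unfolding kerN .
  have "subgroup N ?G" using h.subgroup_kernel unfolding kerN .
  then have subN: "subgroup N A" by (rule A.incl_subgroup[OF subZ])
  then have normN: "N \<lhd> A" by (simp add: A.normal_iff_subgroup)
  have pow: "x [^]\<^bsub>A\<^esub> k = (\<lambda>u \<in> ?V. int k * x u)" if "x \<in> carrier A" for x and k :: nat
    using pow_free_Z that unfolding A_def by blast
  have torsion: "(\<exists>k::nat. k > 0 \<and> x [^]\<^bsub>A\<^esub> k \<in> N) \<longleftrightarrow> x \<in> Z" if x: "x \<in> carrier A" for x
  proof
    assume "\<exists>k::nat. k > 0 \<and> x [^]\<^bsub>A\<^esub> k \<in> N"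
    then obtain k :: nat where k: "k > 0" "x [^]\<^bsub>A\<^esub> k \<in> Z" using NZ by blast
    then have "int k * sum x ?V = 0" by (simp add: Z_def pow[OF x] sum_distrib_left)
    then show "x \<in> Z" using k x by (simp add: Z_def)
  next
    assume Zx: "x \<in> Z"
    \<comment> \<open>A common multiple of all orders annihilates every class of degree 0.\<close>
    let ?k = "\<Prod>j \<in> J. n j"
    have "x [^]\<^bsub>A\<^esub> ?k \<in> Z"
      using Zx x A.nat_pow_closed[OF x, of ?k] by (simp add: Z_def pow[OF x] sum_distrib_left[symmetric])
    moreover have "(\<Sum>u \<in> ?V. P j u * (x [^]\<^bsub>A\<^esub> ?k) u) mod int (n j) = 0" if j: "j \<in> J" for j
    proof -
      have "(\<Sum>u \<in> ?V. P j u * (x [^]\<^bsub>A\<^esub> ?k) u) = int ?k * (\<Sum>u \<in> ?V. P j u * x u)"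
        unfolding pow[OF x] sum_distrib_left by (intro sum.cong) auto
      moreover have "int (n j) dvd int ?k" using dvd_prodI[OF fin(3) j, of n] by (simp only: int_dvd_int_iff)
      ultimately show ?thesis by simp
    qed
    then have "h (x [^]\<^bsub>A\<^esub> ?k) = \<one>\<^bsub>?B\<^esub>"
      unfolding h_def one_product_group one_integer_mod_group by (intro restrict_ext)
    ultimately have "x [^]\<^bsub>A\<^esub> ?k \<in> N" using Nh by blast
    moreover have "?k > 0" using pos by (intro prod_pos) auto
    ultimately show "\<exists>k::nat. k > 0 \<and> x [^]\<^bsub>A\<^esub> k \<in> N" by blast
  qed
  have coset: "(N #>\<^bsub>A\<^esub> x) [^]\<^bsub>A Mod N\<^esub> k = \<one>\<^bsub>A Mod N\<^esub> \<longleftrightarrow> x [^]\<^bsub>A\<^esub> k \<in> N"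
    if x: "x \<in> carrier A" for x and k :: nat
    unfolding normal.FactGroup_pow[OF normN x] one_FactGroup
    using A.coset_join1[OF _ A.nat_pow_closed[OF x] subN] A.coset_join2[OF A.nat_pow_closed[OF x] subN]
    by blast
  have "carrier (torsion_subgroup (A Mod N)) = (\<lambda>x. N #>\<^bsub>A\<^esub> x) ` Z"
  proof -
    have "carrier (torsion_subgroup (A Mod N)) =
        {X \<in> (\<lambda>x. N #>\<^bsub>A\<^esub> x) ` carrier A. \<exists>k::nat. k > 0 \<and> X [^]\<^bsub>A Mod N\<^esub> k = \<one>\<^bsub>A Mod N\<^esub>}"
      by (simp add: torsion_subgroup_def carrier_FactGroup)
    also have "\<dots> = (\<lambda>x. N #>\<^bsub>A\<^esub> x) ` {x \<in> carrier A. \<exists>k::nat. k > 0 \<and> x [^]\<^bsub>A\<^esub> k \<in> N}"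
      using coset by blast
    also have "{x \<in> carrier A. \<exists>k::nat. k > 0 \<and> x [^]\<^bsub>A\<^esub> k \<in> N} = Z"
      using torsion by (auto simp: Z_def)
    finally show ?thesis .
  qed
  moreover have "carrier (?G Mod N) = (\<lambda>x. N #>\<^bsub>A\<^esub> x) ` Z"
    by (simp add: carrier_FactGroup r_coset_def)
  \<comment> \<open>The torsion subgroup and the quotient of \<open>Z\<close> consist of the same
    cosets with the same product, so they are equal and not merely isomorphic.\<close>
  moreover have "set_mult ?G = set_mult A"
    by (auto simp: set_mult_def fun_eq_iff)
  ultimately have "sandpile_group G = ?G Mod N"
    unfolding sandpile_group_def A_def[symmetric] N_def[symmetric]
    by (simp add: torsion_subgroup_def FactGroup_def)
  then show ?thesis using iso by simp
qed


section \<open>Polygon flowers\<close>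

theorem mainTheorem4:
  fixes l :: nat
    and ks :: "nat \<Rightarrow> nat list"
    and PC :: "nat \<Rightarrow> ('v, 'e) mgraph"
    and Ps :: "nat \<Rightarrow> 'e set list"
    and e' :: "nat \<Rightarrow> 'e"
    and a b :: "nat \<Rightarrow> 'v"
  assumes "l \<ge> 3"
    and "\<And>i. i \<in> {1..l} \<Longrightarrow> polygon_chain (ks i) (PC i) (Ps i)"
    and "\<And>i. i \<in> {1..l} \<Longrightarrow> e' i \<in> edges (PC i) \<and> free_end_edge (Ps i) (e' i)"
    and "\<And>i. i \<in> {1..l} \<Longrightarrow> ends (PC i) (e' i) = {a i, b i}"
  defines "F \<equiv> polygon_flower l PC a b"
  shows "sandpile_group F \<cong>
    product_group {1..l - 1} (\<lambda>j. integer_mod_group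
      (if j = 1 then Delta l ks 1
       else if j \<le> l - 2 then Delta l ks j div Delta l ks (j - 1)
       else num_spanning_trees F div Delta l ks (l - 2)))"
proof -
  have "\<forall>i \<in> {1..l}. \<exists>s t. ladder_net (ends (PC i)) (verts (PC i)) (edges (PC i)) (a i) (b i) s t \<and>
      int t = omega (ks i)"
  proof
    fix i assume i: "i \<in> {1..l}"
    show "\<exists>s t. ladder_net (ends (PC i)) (verts (PC i)) (edges (PC i)) (a i) (b i) s t \<and>
        int t = omega (ks i)"
      using assms(3)[OF i] by (intro polygon_chain_net[OF assms(2)[OF i] _ assms(4)[OF i]]) blast
  qed
  then obtain s t where st:
    "\<And>i. i \<in> {1..l} \<Longrightarrow> ladder_net (ends (PC i)) (verts (PC i)) (edges (PC i)) (a i) (b i) (s i) (t i)"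
    "\<And>i. i \<in> {1..l} \<Longrightarrow> int (t i) = omega (ks i)"
    by metis
  define v :: "nat \<Rightarrow> nat + nat \<times> 'v" where "v i = (if i = Suc l then Inl 1 else Inl i)" for i
  let ?W = "\<lambda>i. glue l a b i ` verts (PC i)" and ?D = "\<lambda>i. Pair i ` edges (PC i)"
  have ab: "a i \<in> verts (PC i)" "b i \<in> verts (PC i)" "a i \<noteq> b i" if "i \<in> {1..l}" for i
    using ladder_net_terminals[OF st(1)[OF that]] by auto
  have v: "v i = Inl i" "v (Suc i) = Inl (cyc_succ l i)" "cyc_succ l i \<noteq> i" "cyc_succ l i \<in> {1..l}"
    if "i \<in> {1..l}" for i
    using that assms(1) by (auto simp: v_def cyc_succ_def)
  have glue_ab: "glue l a b i (a i) = v i" "glue l a b i (b i) = v (Suc i)" if "i \<in> {1..l}" for i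
    using v[OF that] ab[OF that] by (auto simp: glue_def)
  have W_cases: "u = v i \<or> u = v (Suc i) \<or> (\<exists>x. u = Inr (i, x))" if "i \<in> {1..l}" "u \<in> ?W i" for i u
    using that v[OF that(1)] by (auto simp: glue_def)
  have net: "ladder_net (ends F) (?W i) (?D i) (v i) (v (Suc i)) (s i) (t i)" if i: "i \<in> {1..l}" for i
  proof -
    \<comment> \<open>Gluing identifies no two vertices of one chain, because consecutive vertices
      of the cycle differ.\<close>
    have "inj_on (glue l a b i) (verts (PC i))"
      using v(3)[OF i] by (auto simp: inj_on_def glue_def)
    then have "ladder_net (ends F) (?W i) (?D i) (glue l a b i (a i)) (glue l a b i (b i)) (s i) (t i)"
      by (rule ladder_net_map[OF st(1)[OF i]]) (auto simp: F_def polygon_flower_def inj_on_def)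
    then show ?thesis unfolding glue_ab[OF i] .
  qed
  have v_img: "v ` {1..l} = Inl ` {1..l}" using v(1) by auto
  interpret net_cycle l "ends F" ?W ?D v s t
  proof
    show "l \<ge> 2" using assms(1) by simp
    show "inj_on v {1..l}" using v(1) by (auto simp: inj_on_def)
    show "v (Suc l) = v 1" using assms(1) by (simp add: v_def)
  next
    fix i assume i: "i \<in> {1..l}"
    show "ladder_net (ends F) (?W i) (?D i) (v i) (v (Suc i)) (s i) (t i)" by (rule net[OF i])
    have "v i \<in> ?W i" "v (Suc i) \<in> ?W i"
      using ladder_net_terminals[OF net[OF i]] by auto
    moreover have "v i \<in> v ` {1..l}" "v (Suc i) \<in> v ` {1..l}"
      unfolding v_img using v[OF i] i by auto
    moreover have "u \<in> {v i, v (Suc i)}" if "u \<in> ?W i" "u \<in> v ` {1..l}" for u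
      using W_cases[OF i that(1)] that(2) unfolding v_img by auto
    ultimately show "?W i \<inter> v ` {1..l} = {v i, v (Suc i)}" by blast
    fix j assume j: "j \<in> {1..l}" "i \<noteq> j"
    show "?W i \<inter> ?W j \<subseteq> v ` {1..l}"
    proof
      fix u assume u: "u \<in> ?W i \<inter> ?W j"
      \<comment> \<open>Inner vertices carry the index of their chain, so a vertex common to two
        chains lies on the cycle.\<close>
      have "\<not> ((\<exists>x. u = Inr (i, x)) \<and> (\<exists>x. u = Inr (j, x)))" using j(2) by auto
      then have "u \<in> {v i, v (Suc i), v j, v (Suc j)}"
        using W_cases[OF i, of u] W_cases[OF j(1), of u] u by blast
      then show "u \<in> v ` {1..l}" unfolding v_img using v[OF i] v[OF j(1)] i j by auto
    qed
    show "?D i \<inter> ?D j = {}" using j(2) by auto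
  qed
  have VF: "verts F = VF" and EF: "edges F = EF"
    by (auto simp: F_def polygon_flower_def)
  have fin: "finite (verts F)" "finite (edges F)"
    unfolding VF EF by (intro finite_UN_I finite_W finite_D finite_atLeastAtMost; assumption)+
  have wf: "\<forall>e \<in> edges F. card (ends F e) = 2 \<and> ends F e \<subseteq> verts F"
    unfolding VF EF using ends_D by fast
  let ?s = "\<lambda>i. int (s i)" and ?t = "\<lambda>i. int (t i)"
  have trees: "int (num_spanning_trees F) = det_sum l ?s ?t"
    unfolding num_spanning_trees_eq[OF wf] VF EF by (rule card_trees_cycle)
  have "{\<Prod>i \<in> I. omega (ks i) | I. I \<subseteq> {1..l} \<and> card I = j} =
      {\<Prod>i \<in> I. ?t i | I. I \<subseteq> {1..l} \<and> card I = j}" for j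
  proof -
    have "(\<Prod>i \<in> I. omega (ks i)) = (\<Prod>i \<in> I. ?t i)" if "I \<subseteq> {1..l}" for I
      using that st(2) by (intro prod.cong) auto
    then show ?thesis by (intro Collect_cong) metis
  qed
  then have Delta: "int (Delta l ks j) = det_div l ?t j" for j
    by (simp add: Delta_def det_div_def)
  have pos: "s i > 0" "t i > 0" if "i \<in> {1..l}" for i
    using ladder_net_pos[OF net[OF that]] by auto
  \<comment> \<open>The flower has a spanning tree. This makes every order positive, so that no
    factor of the product is infinite.\<close>
  have "det_sum l ?s ?t > 0"
    unfolding det_sum_def
  proof (rule sum_pos)
    fix i assume i: "i \<in> {1..l}"
    have "(\<Prod>j \<in> {1..l} - {i}. ?t j) > 0" using pos by (intro prod_pos) auto
    then show "?s i * (\<Prod>j \<in> {1..l} - {i}. ?t j) > 0" using pos[OF i] by simp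
  qed (use assms(1) in auto)
  moreover have "coprime_weights l ?s ?t"
    unfolding coprime_weights_def using pos ladder_net_coprime[OF net] by auto
  ultimately have pres: "presents l ?s ?t (\<lambda>j. if j = 1 then det_div l ?t 1
      else if j \<le> l - 2 then det_div l ?t j div det_div l ?t (j - 1)
      else det_sum l ?s ?t div det_div l ?t (l - 2))"
    and npos: "\<And>j. j \<in> {1..l - 1} \<Longrightarrow> (if j = 1 then det_div l ?t 1
      else if j \<le> l - 2 then det_div l ?t j div det_div l ?t (j - 1)
      else det_sum l ?s ?t div det_div l ?t (l - 2)) > 0"
    using presents_det_div[OF assms(1)] by blast+
  define n where "n j = (if j = 1 then Delta l ks 1
       else if j \<le> l - 2 then Delta l ks j div Delta l ks (j - 1)
       else num_spanning_trees F div Delta l ks (l - 2))" for j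
  have n: "int (n j) = (if j = 1 then det_div l ?t 1
      else if j \<le> l - 2 then det_div l ?t j div det_div l ?t (j - 1)
      else det_sum l ?s ?t div det_div l ?t (l - 2))" for j
    unfolding n_def by (simp add: zdiv_int Delta trees)
  have "presents l ?s ?t (\<lambda>j. int (n j))" unfolding n by (rule pres)
  from cokernel_lap_op[OF this] obtain P where P: "\<forall>x. sum x VF = 0 \<longrightarrow> ((\<exists>y. \<forall>u \<in> VF. lap_op (ends F) EF y u = x u) \<longleftrightarrow>
      (\<forall>j \<in> {1..l - 1}. int (n j) dvd (\<Sum>u \<in> VF. P j u * x u)))"
    "\<forall>y. \<exists>x. sum x VF = 0 \<and> (\<forall>j \<in> {1..l - 1}. int (n j) dvd (\<Sum>u \<in> VF. P j u * x u) - y j)"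
    by (elim exE conjE)
  have "sandpile_group F \<cong> product_group {1..l - 1} (\<lambda>j. integer_mod_group (n j))"
  proof (rule sandpile_group_iso[OF fin finite_atLeastAtMost wf])
    show "n j > 0" if "j \<in> {1..l - 1}" for j using npos[OF that] unfolding n[symmetric] by simp
    show "(\<exists>y. \<forall>u \<in> verts F. lap_op (ends F) (edges F) y u = x u) \<longleftrightarrow>
        (\<forall>j \<in> {1..l - 1}. int (n j) dvd (\<Sum>u \<in> verts F. P j u * x u))" if "sum x (verts F) = 0" for x
      using that unfolding VF EF by (rule mp[OF spec[OF P(1)]])
    show "\<exists>x. sum x (verts F) = 0 \<and>
        (\<forall>j \<in> {1..l - 1}. int (n j) dvd (\<Sum>u \<in> verts F. P j u * x u) - b j)" for b
      unfolding VF by (rule spec[OF P(2)])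
  qed
  then show ?thesis unfolding n_def .
qed

end
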